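(* Let $(G,K,L,\theta,\phi)$ be a character five such that $K/L$ is abelian of odd order. Then there is $H\leq G$ with $G=HK$ and $L=H\cap K$ such that every element of $H$ is $K$-$\phi$-good, and there is a magic representation $\sigma\colon H/L\to(\mathbb{C}Ke_\phi)^L$.
   Context: All groups are finite and characters are complex. Conventions: $a^x=x^{-1}ax$, $[x,y]=x^{-1}y^{-1}xy$; $e_\phi=\frac{\phi(1)}{|L|}\sum_{l\in L}\phi(l^{-1})l$. A character five is a quintuple $(G,K,L,\theta,\phi)$ where $G$ is a finite group, $L\leq K$ are normal subgroups of $G$, $\phi\in\operatorname{Irr}(L)$ is invariant in $G$ and fully ramified in $K$ (i.e. there is exactly one irreducible character of $K$ lying above $\phi$), and $\theta$ is this unique character of $K$ above $\phi$. $S=(\mathbb{C}Ke_\phi)^L$ is the centralizer of $L$ in $\mathbb{C}Ke_\phi$; $G/L$ acts on $S$ by conjugation. A magic representation on a complement $H/L$ of $K/L$ in $G/L$ is a map $\sigma\colon H/L\to S$ such that $\sigma(x)\in S^*$, $\sigma(xy)=\sigma(x)\sigma(y)$ and $s^x=s^{\sigma(x)}:=\sigma(x)^{-1}s\sigma(x)$ for all $x,y\in H/L$ and $s\in S$. Good elements: For $x\in G$ there is a unit $c_x\in(\mathbb{C}Le_\phi)^*$, unique up to scalars, with $a^x=a^{c_x}$ for all $a\in\mathbb{C}Le_\phi$. For $x,y\in G$ with $[x,y]\in L$, define $\langle\langle x,y\rangle\rangle_\phi\in\mathbb{C}^*$ by $\langle\langle x,y\rangle\rangle_\phi e_\phi=[x,y][c_y,c_x]$;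 it depends only on the cosets $xL,yL$. An element $g\in G$ is $K$-$\phi$-good if $\langle\langle c,g\rangle\rangle_\phi=1$ for all $c\in\mathbf{C}_{K/L}(g)$. *)

theory Defs
  imports
    "HOL-Algebra.Coset"
    "Jordan_Normal_Form.VS_Connect"
begin

section \<open>Irreducible complex characters\<close>

abbreviation subgrp :: "('a, 'b) monoid_scheme \<Rightarrow> 'a set \<Rightarrow> ('a, 'b) monoid_scheme"
  where "subgrp G H \<equiv> G\<lparr>carrier := H\<rparr>"

definition matrix_rep :: "('a, 'b) monoid_scheme \<Rightarrow> nat \<Rightarrow> ('a \<Rightarrow> complex mat) \<Rightarrow> bool"
  where "matrix_rep G n \<rho> \<longleftrightarrow> \<rho> \<in> hom G (units_of (ring_mat TYPE(complex) n ()))"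

definition irreducible_rep :: "('a, 'b) monoid_scheme \<Rightarrow> nat \<Rightarrow> ('a \<Rightarrow> complex mat) \<Rightarrow> bool"
  where "irreducible_rep G n \<rho> \<longleftrightarrow> matrix_rep G n \<rho> \<and> n > 0 \<and>
    (\<forall>W. VectorSpace.subspace class_ring W (module_vec TYPE(complex) n) \<and>
         (\<forall>g\<in>carrier G. \<forall>w\<in>W. \<rho> g *\<^sub>v w \<in> W) \<longrightarrow>
         W = {0\<^sub>v n} \<or> W = carrier_vec n)"

text \<open>Characters are extended by \<open>0\<close> outside the carrier, so that two characters of a group
  are equal as functions as soon as they agree on the group.\<close>

definition rep_character :: "('a, 'b) monoid_scheme \<Rightarrow> nat \<Rightarrow> ('a \<Rightarrow> complex mat) \<Rightarrow> 'a \<Rightarrow> complex"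
  where "rep_character G n \<rho> = (\<lambda>g. if g \<in> carrier G then (\<Sum>i<n. \<rho> g $$ (i, i)) else 0)"

definition Irr :: "('a, 'b) monoid_scheme \<Rightarrow> ('a \<Rightarrow> complex) set"
  where "Irr G = {rep_character G n \<rho> | n \<rho>. irreducible_rep G n \<rho>}"

definition char_inner :: "('a, 'b) monoid_scheme \<Rightarrow> ('a \<Rightarrow> complex) \<Rightarrow> ('a \<Rightarrow> complex) \<Rightarrow> complex"
  where "char_inner G \<chi> \<psi> = (\<Sum>g\<in>carrier G. \<chi> g * cnj (\<psi> g)) / of_nat (Coset.order G)"

text \<open>\<open>\<chi>\<close> lies above \<open>\<phi>\<close> if the restriction of \<open>\<chi>\<close> to \<open>L\<close> has \<open>\<phi>\<close> as a constituent;
  since the inner product only evaluates on \<open>L\<close>, the restriction is left implicit.\<close>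

definition lies_above ::
    "('a, 'b) monoid_scheme \<Rightarrow> 'a set \<Rightarrow> ('a \<Rightarrow> complex) \<Rightarrow> ('a \<Rightarrow> complex) \<Rightarrow> bool"
  where "lies_above G L \<chi> \<phi> \<longleftrightarrow> char_inner (subgrp G L) \<chi> \<phi> \<noteq> 0"

definition fully_ramified ::
    "('a, 'b) monoid_scheme \<Rightarrow> 'a set \<Rightarrow> 'a set \<Rightarrow> ('a \<Rightarrow> complex) \<Rightarrow> bool"
  where "fully_ramified G K L \<phi> \<longleftrightarrow> (\<exists>!\<chi>. \<chi> \<in> Irr (subgrp G K) \<and> lies_above G L \<chi> \<phi>)"

text \<open>\<open>a\<^sup>x\<close> and \<open>[x, y]\<close>; used both in groups and for units of rings.\<close>

definition conjugate_by :: "('a, 'b) monoid_scheme \<Rightarrow> 'a \<Rightarrow> 'a \<Rightarrow> 'a"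
  where "conjugate_by M a x = inv\<^bsub>M\<^esub> x \<otimes>\<^bsub>M\<^esub> a \<otimes>\<^bsub>M\<^esub> x"

definition commutator :: "('a, 'b) monoid_scheme \<Rightarrow> 'a \<Rightarrow> 'a \<Rightarrow> 'a"
  where "commutator M x y = inv\<^bsub>M\<^esub> x \<otimes>\<^bsub>M\<^esub> inv\<^bsub>M\<^esub> y \<otimes>\<^bsub>M\<^esub> x \<otimes>\<^bsub>M\<^esub> y"

locale character_five = group G for G (structure) +
  fixes K L :: "'a set" and \<theta> \<phi> :: "'a \<Rightarrow> complex"
  assumes finite_G: "finite (carrier G)"
    and normal_K: "K \<lhd> G"
    and normal_L: "L \<lhd> G"
    and L_le_K: "L \<subseteq> K"
    and phi_Irr: "\<phi> \<in> Irr (subgrp G L)"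
    and phi_invariant: "\<And>g l. g \<in> carrier G \<Longrightarrow> l \<in> L \<Longrightarrow> \<phi> (conjugate_by G l g) = \<phi> l"
    and phi_fully_ramified: "fully_ramified G K L \<phi>"
    and theta_Irr: "\<theta> \<in> Irr (subgrp G K)"
    and theta_above: "lies_above G L \<theta> \<phi>"

section \<open>The complex group algebra\<close>

text \<open>The group algebra of a finite group is realised as the ring of complex functions
  vanishing outside the carrier, under convolution. With this encoding the group algebra of a
  subgroup of \<open>G\<close> is literally a subset of the group algebra of \<open>G\<close>.\<close>

definition group_algebra :: "('a, 'b) monoid_scheme \<Rightarrow> ('a \<Rightarrow> complex) ring"
  where "group_algebra G =
    \<lparr>carrier = {a. \<forall>g. g \<notin> carrier G \<longrightarrow> a g = 0},
     mult = (\<lambda>a b g. \<Sum>h\<in>carrier G. \<Sum>k\<in>carrier G. if h \<otimes>\<^bsub>G\<^esub> k = g then a h * b k else 0),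
     one = (\<lambda>g. if g = \<one>\<^bsub>G\<^esub> then 1 else 0),
     zero = (\<lambda>g. 0),
     add = (\<lambda>a b g. a g + b g)\<rparr>"

definition basis_elem :: "'a \<Rightarrow> 'a \<Rightarrow> complex"
  where "basis_elem x = (\<lambda>g. if g = x then 1 else 0)"

definition char_idem :: "('a, 'b) monoid_scheme \<Rightarrow> 'a set \<Rightarrow> ('a \<Rightarrow> complex) \<Rightarrow> 'a \<Rightarrow> complex"
  where "char_idem G L \<phi> =
    (\<lambda>l. if l \<in> L then \<phi> \<one>\<^bsub>G\<^esub> / of_nat (card L) * \<phi> (inv\<^bsub>G\<^esub> l) else 0)"

text \<open>\<open>R e\<close> for a central idempotent \<open>e\<close>: a ring whose identity is \<open>e\<close>.\<close>

definition ideal_ring :: "'r ring \<Rightarrow> 'r \<Rightarrow> 'r ring"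
  where "ideal_ring R e = R\<lparr>carrier := {a \<otimes>\<^bsub>R\<^esub> e | a. a \<in> carrier R}, one := e\<rparr>"

definition centralizer_ring :: "'r ring \<Rightarrow> 'r set \<Rightarrow> 'r ring"
  where "centralizer_ring R X =
    R\<lparr>carrier := {r \<in> carrier R. \<forall>x\<in>X. x \<otimes>\<^bsub>R\<^esub> r = r \<otimes>\<^bsub>R\<^esub> x}\<rparr>"

text \<open>\<open>CLe G L \<phi>\<close> is \<open>\<complex>Le\<^sub>\<phi>\<close> and \<open>S_alg G K L \<phi>\<close> is \<open>S = (\<complex>Ke\<^sub>\<phi>)\<^sup>L\<close>.\<close>

definition CLe ::
    "('a, 'b) monoid_scheme \<Rightarrow> 'a set \<Rightarrow> ('a \<Rightarrow> complex) \<Rightarrow> ('a \<Rightarrow> complex) ring"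
  where "CLe G L \<phi> = ideal_ring (group_algebra (subgrp G L)) (char_idem G L \<phi>)"

definition S_alg ::
    "('a, 'b) monoid_scheme \<Rightarrow> 'a set \<Rightarrow> 'a set \<Rightarrow> ('a \<Rightarrow> complex) \<Rightarrow> ('a \<Rightarrow> complex) ring"
  where "S_alg G K L \<phi> =
    centralizer_ring (ideal_ring (group_algebra (subgrp G K)) (char_idem G L \<phi>)) (basis_elem ` L)"

text \<open>\<open>a\<^sup>x\<close> for \<open>a\<close> in the group algebra and \<open>x\<close> in the group.\<close>

definition alg_conj ::
    "('a, 'b) monoid_scheme \<Rightarrow> ('a \<Rightarrow> complex) \<Rightarrow> 'a \<Rightarrow> ('a \<Rightarrow> complex)"
  where "alg_conj G a x = conjugate_by (group_algebra G) a (basis_elem x)"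

section \<open>Good elements and magic representations\<close>

text \<open>\<open>inner_unit G L \<phi> x c\<close> says that \<open>c\<close> is a possible choice of the unit \<open>c\<^sub>x\<close>.\<close>

definition inner_unit ::
    "('a, 'b) monoid_scheme \<Rightarrow> 'a set \<Rightarrow> ('a \<Rightarrow> complex) \<Rightarrow> 'a \<Rightarrow> ('a \<Rightarrow> complex) \<Rightarrow> bool"
  where "inner_unit G L \<phi> x c \<longleftrightarrow> c \<in> Units (CLe G L \<phi>) \<and>
    (\<forall>a\<in>carrier (CLe G L \<phi>). alg_conj G a x = conjugate_by (CLe G L \<phi>) a c)"

text \<open>\<open>\<langle>\<langle>x,y\<rangle>\<rangle>\<^sub>\<phi>\<close>, meaningful when \<open>[x, y] \<in> L\<close>. The units \<open>c\<^sub>x\<close>, \<open>c\<^sub>y\<close> exist and are unique up to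
  scalars, which cancel in \<open>[c\<^sub>y, c\<^sub>x]\<close>; hence the existential choice inside the description
  is harmless.\<close>

definition bracket ::
    "('a, 'b) monoid_scheme \<Rightarrow> 'a set \<Rightarrow> ('a \<Rightarrow> complex) \<Rightarrow> 'a \<Rightarrow> 'a \<Rightarrow> complex"
  where "bracket G L \<phi> x y =
    (THE z. \<exists>cx cy. inner_unit G L \<phi> x cx \<and> inner_unit G L \<phi> y cy \<and>
       (\<lambda>l. z * char_idem G L \<phi> l) =
       basis_elem (commutator G x y) \<otimes>\<^bsub>group_algebra G\<^esub> commutator (CLe G L \<phi>) cy cx)"

text \<open>The bracket depends only on cosets of \<open>L\<close>, so \<open>c\<close> ranges over all elements of \<open>K\<close> whose
  coset lies in the centralizer of \<open>g\<close> in \<open>K/L\<close>.\<close>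

definition good ::
    "('a, 'b) monoid_scheme \<Rightarrow> 'a set \<Rightarrow> 'a set \<Rightarrow> ('a \<Rightarrow> complex) \<Rightarrow> 'a \<Rightarrow> bool"
  where "good G K L \<phi> g \<longleftrightarrow> g \<in> carrier G \<and>
    (\<forall>c\<in>K. (L #>\<^bsub>G\<^esub> c) \<otimes>\<^bsub>G Mod L\<^esub> (L #>\<^bsub>G\<^esub> g) = (L #>\<^bsub>G\<^esub> g) \<otimes>\<^bsub>G Mod L\<^esub> (L #>\<^bsub>G\<^esub> c)
       \<longrightarrow> bracket G L \<phi> c g = 1)"

text \<open>\<open>\<sigma>\<close> is defined on the cosets in \<open>H/L\<close>; its values elsewhere are irrelevant. The units of
  \<open>S\<close> are taken with respect to its own identity \<open>e\<^sub>\<phi>\<close>.\<close>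

definition magic_rep ::
    "('a, 'b) monoid_scheme \<Rightarrow> 'a set \<Rightarrow> 'a set \<Rightarrow> ('a \<Rightarrow> complex) \<Rightarrow> 'a set \<Rightarrow>
     ('a set \<Rightarrow> 'a \<Rightarrow> complex) \<Rightarrow> bool"
  where "magic_rep G K L \<phi> H \<sigma> \<longleftrightarrow>
    subgroup H G \<and> H <#>\<^bsub>G\<^esub> K = carrier G \<and> H \<inter> K = L \<and>
    \<sigma> \<in> hom (subgrp G H Mod L) (units_of (S_alg G K L \<phi>)) \<and>
    (\<forall>x\<in>H. \<forall>s\<in>carrier (S_alg G K L \<phi>).
       alg_conj G s x = conjugate_by (S_alg G K L \<phi>) s (\<sigma> (L #>\<^bsub>G\<^esub> x)))"

end

theory Submission
  imports Defs "Jordan_Normal_Form.Schur_Decomposition" "HOL-Library.Function_Algebras"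
    "HOL-Algebra.Multiplicative_Group"
begin

text \<open>
  For every \<open>x \<in> G\<close> the element \<open>x c\<^sub>x\<^sup>-\<^sup>1\<close> of \<open>\<complex>Ge\<^sub>\<phi>\<close> centralises \<open>L\<close> and depends, up to a scalar,
  only on the coset of \<open>x\<close>. Hence the centraliser of \<open>L\<close> in \<open>\<complex>Ge\<^sub>\<phi>\<close> is a twisted group algebra of \<open>G/L\<close>
  with basis \<open>W\<close>, and \<open>S\<close> is the part graded by \<open>A = K/L\<close>. The commutators of the basis elements form
  an alternating bicharacter \<open>\<omega>\<close> on \<open>A\<close>, nondegenerate by full ramification. Since \<open>|A|\<close> is odd, \<open>\<omega>\<close>
  has a square root \<open>\<beta>\<close>, and the basis of \<open>S\<close> can be rescaled to elements \<open>s\<^sub>a\<close> with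
  \<open>s\<^sub>a s\<^sub>b = \<beta>(a,b) s\<^sub>a\<^sub>b\<close>. Two such rescalings differ by a character of \<open>A\<close>, that is, by conjugation
  with an element of \<open>K\<close>, so the stabiliser \<open>H\<close> of one of them is a complement; its elements permute
  the \<open>s\<^sub>a\<close>, which gives goodness.

  For \<open>x \<in> H\<close> the element \<open>T\<^sub>x = \<Sum>\<^sub>a s\<^sub>a\<^sup>-\<^sup>1 s\<^sub>a\<^sub>x\<close>, with \<open>ax\<close> the conjugate of \<open>a\<close> by \<open>x\<close>, is a unit inducing
  the action of \<open>x\<close> on \<open>S\<close>, and these units multiply up to scalars. They commute with \<open>Z = \<Sum>\<^sub>a s\<^sub>a\<close>, where
  \<open>Z\<^sup>2 = |A|\<close>, and on the irreducible \<open>S\<close>-module the two eigenspaces of \<open>Z\<close> have dimensions differing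
  by one. The quotient of the determinants on the two eigenspaces is therefore a multiplicative
  functional \<open>D\<close> with \<open>D (c u) = c D u\<close>, and \<open>\<sigma> x = T\<^sub>x / D T\<^sub>x\<close> is multiplicative.
\<close>

text \<open>The obstacle is scalars. The action of \<open>x\<close> on \<open>S\<close> determines
  \<open>\<sigma> x\<close> only up to a factor, so the units \<open>T\<close> give a 2-cocycle on
  \<open>H/L\<close>, and a plain determinant on the \<open>S\<close>-module of dimension
  \<open>q\<close> would kill only its \<open>q\<close>-th power. Splitting the module by an
  involution that commutes with every \<open>T\<close> yields two determinants of consecutive
  degrees, whose quotient has degree one. The involution is not ad hoc: conjugation by
  \<open>Z\<close> sends \<open>s b\<close> to \<open>s (inv b)\<close>, so \<open>Z\<close>
  realises the inversion of \<open>A\<close>, which commutes with all automorphisms. The trace of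
  \<open>Z\<close> on the module sees only the term \<open>s \<one>\<close>; it equals
  \<open>q\<close>, so \<open>Z / q\<close> has trace 1. Oddness makes the square root canonical: a
  fixed power of \<omega> inherits the invariance of \<omega> under \<open>G\<close>, and therefore
  conjugation turns one normalised basis into another. Full ramification enters through the
  vanishing of \<theta> on \<open>K\<close> outside \<open>L\<close>, which gives both the
  nondegeneracy of \<omega> and \<open>q * q = card A\<close>.\<close>

section \<open>Common eigenvectors and linear characters of finite abelian groups\<close>

lemma sum_powers_root_of_unity:
  fixes r k :: nat
  assumes "0 < k" "k < r"
  shows "(\<Sum>j<r. cis (2 * pi / r) ^ (j * k)) = 0"
proof -
  define z where "z = cis (2 * pi / r) ^ k"
  have z: "z = cis (2 * pi * k / r)" unfolding z_def by (simp add: DeMoivre field_simps)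
  have "z \<noteq> 1"
  proof
    assume "z = 1"
    then have "cos (2 * pi * k / r) = 1" using z by (simp add: complex_eq_iff)
    then obtain m :: int where m: "2 * pi * k / r = m * (2 * pi)"
      by (auto simp: cos_one_2pi_int)
    then have "pi * 2 * (real k / r) = pi * 2 * m" by (simp add: field_simps)
    then have "real k / r = m" by (subst (asm) mult_cancel_left) simp
    moreover have "0 < real k / r" "real k / r < 1" using assms by auto
    ultimately show False by auto
  qed
  moreover have "z ^ r = 1"
    unfolding z using assms by (simp add: DeMoivre)
  ultimately have "(\<Sum>j<r. z ^ j) = 0" using geometric_sum[of z r] by simp
  then show ?thesis unfolding z_def by (simp add: power_mult[symmetric] mult.commute)
qed

text \<open>Induction on the operators. A power of \<open>U x\<close> acts on a common eigenvector
  \<open>v\<close> of the earlier operators as a scalar, so \<open>v\<close> splits into components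
  in eigenspaces of \<open>U x\<close>, given by finite Fourier sums in the powers of
  \<open>U x\<close>. Some component is nonzero; it remains in \<open>Q\<close>, and it remains an
  eigenvector of the earlier operators because they commute with \<open>U x\<close>.\<close>

lemma common_eigenvector:
  fixes scl :: "complex \<Rightarrow> 'v::ab_group_add \<Rightarrow> 'v" and U :: "'x \<Rightarrow> 'v \<Rightarrow> 'v"
  assumes "Vector_Spaces.vector_space scl" and "finite X"
    and add: "\<And>x u v. x \<in> X \<Longrightarrow> U x (u + v) = U x u + U x v"
    and scl: "\<And>x c v. x \<in> X \<Longrightarrow> U x (scl c v) = scl c (U x v)"
    and comm: "\<And>x y v. x \<in> X \<Longrightarrow> y \<in> X \<Longrightarrow> U x (U y v) = U y (U x v)"
    and pow: "\<And>x. x \<in> X \<Longrightarrow> \<exists>r \<kappa>. 0 < r \<and> \<kappa> \<noteq> 0 \<and> (\<forall>v. Q v \<longrightarrow> (U x ^^ r) v = scl \<kappa> v)"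
    and Q_add: "\<And>u v. Q u \<Longrightarrow> Q v \<Longrightarrow> Q (u + v)"
    and Q_scl: "\<And>c u. Q u \<Longrightarrow> Q (scl c u)"
    and Q_U: "\<And>x u. x \<in> X \<Longrightarrow> Q u \<Longrightarrow> Q (U x u)"
    and v0: "Q v0" "v0 \<noteq> 0"
  shows "\<exists>v \<mu>. Q v \<and> v \<noteq> 0 \<and> (\<forall>x\<in>X. U x v = scl (\<mu> x) v)"
  using \<open>finite X\<close> add scl comm pow Q_U
proof (induction X rule: finite_induct)
  case empty
  then show ?case using v0 by auto
next
  case (insert x X)
  interpret vector_space scl by fact
  have "\<exists>v \<mu>. Q v \<and> v \<noteq> 0 \<and> (\<forall>x\<in>X. U x v = scl (\<mu> x) v)"
    using insert.prems by (intro insert.IH) auto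
  then obtain v \<mu> where v: "Q v" "v \<noteq> 0" "\<And>y. y \<in> X \<Longrightarrow> U y v = scl (\<mu> y) v" by blast
  obtain r \<kappa> where r: "0 < r" "\<kappa> \<noteq> 0" and rv: "\<And>v. Q v \<Longrightarrow> (U x ^^ r) v = scl \<kappa> v"
    using insert.prems(4)[of x] by blast
  note add = insert.prems(1) and scl = insert.prems(2) and comm = insert.prems(3) and Q_U = insert.prems(5)
  have U_sum: "U y (\<Sum>i\<in>I. g i) = (\<Sum>i\<in>I. U y (g i))" if y: "y \<in> insert x X" for y g and I :: "nat set"
  proof (induction I rule: infinite_finite_induct)
    case (infinite I)
    have "U y 0 = 0" using scl[OF y, of 0 0] by simp
    then show ?case using infinite by simp
  next
    case empty
    show ?case using scl[OF y, of 0 0] by simp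
  next
    case (insert i I)
    then show ?case using add[OF y] by simp
  qed
  have Q_sum: "Q (\<Sum>i\<in>I. g i)" if "\<And>i. i \<in> I \<Longrightarrow> Q (g i)" for g and I :: "nat set"
    using that
  proof (induction I rule: infinite_finite_induct)
    case (insert i I)
    then show ?case by (simp add: Q_add)
  qed (use Q_scl[OF v(1), of 0] in auto)
  have QU: "Q ((U x ^^ k) v)" for k by (induction k) (auto simp: v Q_U)
  have UU: "U y ((U x ^^ k) v) = scl (\<mu> y) ((U x ^^ k) v)" if y: "y \<in> X" for y k
  proof (induction k)
    case 0
    then show ?case using v(3)[OF y] by simp
  next
    case (Suc k)
    have "U y ((U x ^^ Suc k) v) = U x (U y ((U x ^^ k) v))" using comm[of y x] y by simp
    then show ?case using Suc scl[of x] by simp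
  qed
  \<comment> \<open>One \<open>r\<close>-th root of \<open>\<kappa>\<close> in polar form; the
    others are \<open>z0 * inverse \<zeta> ^ j\<close> with \<open>j < r\<close>.\<close>
  define z0 where "z0 = rcis (root r (cmod \<kappa>)) (Arg \<kappa> / r)"
  have z0: "z0 ^ r = \<kappa>"
    using r by (simp add: z0_def DeMoivre2 rcis_cmod_Arg)
  then have "z0 \<noteq> 0" using r by auto
  note z0 = z0 this
  define \<zeta> where "\<zeta> = cis (2 * pi / r)"
  have \<zeta>: "\<zeta> ^ r = 1" "\<zeta> \<noteq> 0" using r by (auto simp: \<zeta>_def DeMoivre)
  \<comment> \<open>This is \<open>r\<close> times the component of \<open>v\<close> for the
    eigenvalue \<open>z0 * inverse \<zeta> ^ j\<close>. Applying \<open>U x\<close> shifts the sum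
    by one index, and the term of index \<open>r\<close> equals the term of index 0.\<close>
  define P where "P j = (\<Sum>k<r. scl (1 / (z0 * inverse \<zeta> ^ j) ^ k) ((U x ^^ k) v))" for j
  have eig: "U x (P j) = scl (z0 * inverse \<zeta> ^ j) (P j)" for j
  proof -
    define z where "z = z0 * inverse \<zeta> ^ j"
    have zr: "z ^ r = \<kappa>"
      unfolding z_def power_mult_distrib using z0 \<zeta>(1)
      by (simp add: power_mult[symmetric] mult.commute[of j] power_mult power_inverse)
    have z: "z \<noteq> 0" using z0 \<zeta> by (auto simp: z_def)
    define g where "g k = scl (1 / z ^ k) ((U x ^^ k) v)" for k
    have g: "U x (g k) = scl z (g (Suc k))" for k
      unfolding g_def using z scl[of x] by simp
    have "g r = g 0" unfolding g_def using rv[OF v(1)] zr r by simp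
    moreover have "(\<Sum>k<r. g (Suc k)) + g 0 = (\<Sum>k<r. g k) + g r"
      using sum.lessThan_Suc_shift[of g r] by (simp add: add.commute)
    ultimately have sh: "(\<Sum>k<r. g (Suc k)) = (\<Sum>k<r. g k)" by simp
    have "U x (P j) = (\<Sum>k<r. U x (g k))" unfolding P_def g_def z_def by (rule U_sum) simp
    also have "\<dots> = scl z (\<Sum>k<r. g (Suc k))" unfolding g by (simp add: scale_sum_right)
    finally show ?thesis unfolding sh unfolding P_def g_def z_def .
  qed
  \<comment> \<open>Only \<open>k = 0\<close> survives the sum over \<open>j\<close>, so the
    components add up to \<open>r\<close> times \<open>v\<close> and cannot all vanish.\<close>
  have "(\<Sum>j<r. P j) = (\<Sum>k<r. \<Sum>j<r. scl (1 / (z0 * inverse \<zeta> ^ j) ^ k) ((U x ^^ k) v))"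
    unfolding P_def by (rule sum.swap)
  also have "\<dots> = (\<Sum>k<r. if k = 0 then scl (of_nat r) v else 0)"
  proof (rule sum.cong[OF refl])
    fix k assume k: "k \<in> {..<r}"
    have *: "(\<Sum>j<r. 1 / (z0 * inverse \<zeta> ^ j) ^ k) = (if k = 0 then of_nat r else 0)"
    proof (cases "k = 0")
      case False
      have "(\<Sum>j<r. 1 / (z0 * inverse \<zeta> ^ j) ^ k) = (\<Sum>j<r. \<zeta> ^ (j * k)) / z0 ^ k"
        by (simp add: sum_divide_distrib power_mult_distrib power_mult[symmetric] power_inverse divide_simps)
      also have "\<dots> = 0" using sum_powers_root_of_unity[of k r] k False unfolding \<zeta>_def by simp
      finally show ?thesis using False by simp
    qed simp
    have "(\<Sum>j<r. scl (1 / (z0 * inverse \<zeta> ^ j) ^ k) ((U x ^^ k) v))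
       = scl (\<Sum>j<r. 1 / (z0 * inverse \<zeta> ^ j) ^ k) ((U x ^^ k) v)"
      by (simp add: scale_sum_left)
    then show "(\<Sum>j<r. scl (1 / (z0 * inverse \<zeta> ^ j) ^ k) ((U x ^^ k) v))
       = (if k = 0 then scl (of_nat r) v else 0)" unfolding * by simp
  qed
  also have "\<dots> = scl (of_nat r) v" using r by (simp add: sum.delta)
  finally have "(\<Sum>j<r. P j) \<noteq> 0" using v(2) r by simp
  then obtain j where j: "P j \<noteq> 0" by (metis sum.neutral)
  have "Q (P j)" unfolding P_def by (intro Q_sum Q_scl QU)
  moreover have "U y (P j) = scl ((\<mu>(x := z0 * inverse \<zeta> ^ j)) y) (P j)" if "y \<in> insert x X" for y
  proof (cases "y = x")
    case True
    then show ?thesis using eig by simp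
  next
    case False
    then have y: "y \<in> X" using that by simp
    have "U y (P j) = (\<Sum>k<r. scl (1 / (z0 * inverse \<zeta> ^ j) ^ k) (scl (\<mu> y) ((U x ^^ k) v)))"
      unfolding P_def using y by (subst U_sum) (auto simp: UU scl)
    also have "\<dots> = scl (\<mu> y) (P j)"
      unfolding P_def scale_sum_right by (simp add: mult.commute)
    finally show ?thesis using False by simp
  qed
  ultimately show ?case using j by (intro exI[of _ "P j"] exI[of _ "\<mu>(x := z0 * inverse \<zeta> ^ j)"]) blast
qed

text \<open>Together with pointwise addition this is the vector space on which both the regular
  representation and the group algebra live.\<close>

definition fun_scale :: "complex \<Rightarrow> ('x \<Rightarrow> complex) \<Rightarrow> 'x \<Rightarrow> complex" (infixr "\<cdot>\<^sub>f" 75)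
  where "c \<cdot>\<^sub>f f = (\<lambda>x. c * f x)"

lemma fun_scale_apply [simp]: "(c \<cdot>\<^sub>f f) x = c * f x"
  by (simp add: fun_scale_def)

lemma vector_space_fun_scale: "Vector_Spaces.vector_space fun_scale"
  by unfold_locales (auto simp: fun_eq_iff algebra_simps)

interpretation fun_vs: Vector_Spaces.vector_space fun_scale
  by (rule vector_space_fun_scale)

text \<open>The eigenvectors are sought in the left regular representation of the twisted group algebra.
  The predicate \<open>Q\<close> allows the search to be confined to an invariant subspace.\<close>

lemma (in comm_group) symmetric_cocycle_eigen:
  fixes \<gamma> :: "'a \<Rightarrow> 'a \<Rightarrow> complex"
  defines "U \<equiv> \<lambda>a f y. if y \<in> carrier G then \<gamma> a (inv a \<otimes> y) * f (inv a \<otimes> y) else 0"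
  assumes fin: "finite (carrier G)"
    and nz: "\<And>a b. a \<in> carrier G \<Longrightarrow> b \<in> carrier G \<Longrightarrow> \<gamma> a b \<noteq> 0"
    and sym: "\<And>a b. a \<in> carrier G \<Longrightarrow> b \<in> carrier G \<Longrightarrow> \<gamma> a b = \<gamma> b a"
    and coc: "\<And>a b c. a \<in> carrier G \<Longrightarrow> b \<in> carrier G \<Longrightarrow> c \<in> carrier G \<Longrightarrow>
      \<gamma> a b * \<gamma> (a \<otimes> b) c = \<gamma> a (b \<otimes> c) * \<gamma> b c"
    and Q_add: "\<And>u v. Q u \<Longrightarrow> Q v \<Longrightarrow> Q (u + v)"
    and Q_scl: "\<And>c u. Q u \<Longrightarrow> Q (c \<cdot>\<^sub>f u)"
    and Q_U: "\<And>x u. x \<in> carrier G \<Longrightarrow> Q u \<Longrightarrow> Q (U x u)"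
    and v0: "Q v0" "v0 \<noteq> 0"
    and Q_supp: "\<And>v x. Q v \<Longrightarrow> x \<notin> carrier G \<Longrightarrow> v x = 0"
  shows "\<exists>v \<mu>. Q v \<and> v \<noteq> 0 \<and> (\<forall>a\<in>carrier G. \<mu> a \<noteq> 0 \<and> U a v = \<mu> a \<cdot>\<^sub>f v) \<and>
    (\<forall>a\<in>carrier G. \<forall>b\<in>carrier G. \<mu> a * \<mu> b = \<gamma> a b * \<mu> (a \<otimes> b))"
proof -
  \<comment> \<open>The cocycle identity makes the twisted translations compose up to the scalar
    \<open>\<gamma> a b\<close>; symmetry of \<open>\<gamma>\<close> then makes them
    commute.\<close>
  have UU: "U a (U b f) = \<gamma> a b \<cdot>\<^sub>f U (a \<otimes> b) f" if "a \<in> carrier G" "b \<in> carrier G" for a b f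
  proof
    fix y
    show "U a (U b f) y = (\<gamma> a b \<cdot>\<^sub>f U (a \<otimes> b) f) y"
    proof (cases "y \<in> carrier G")
      case True
      define z where "z = inv b \<otimes> (inv a \<otimes> y)"
      have z: "z \<in> carrier G" "inv b \<otimes> (inv a \<otimes> y) = z" "inv (a \<otimes> b) \<otimes> y = z"
        using that True by (simp_all add: z_def inv_mult m_ac)
      have "b \<otimes> z = (b \<otimes> inv b) \<otimes> (inv a \<otimes> y)"
        unfolding z_def using that True by (subst m_assoc) auto
      then have "inv a \<otimes> y = b \<otimes> z" using that True by simp
      note z = z this
      have "U a (U b f) y = (\<gamma> a (b \<otimes> z) * \<gamma> b z) * f z"
        using that True z(2) by (simp add: U_def z(4)[symmetric])
      also have "\<dots> = (\<gamma> a b \<cdot>\<^sub>f U (a \<otimes> b) f) y"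
        using coc[of a b z] that True z(1,3) by (simp add: U_def)
      finally show ?thesis .
    qed (simp add: U_def)
  qed
  have g1: "\<gamma> \<one> c = \<gamma> \<one> \<one>" if "c \<in> carrier G" for c
    using coc[of \<one> \<one> c] that nz[of \<one> c] by simp
  have U1: "U \<one> v = \<gamma> \<one> \<one> \<cdot>\<^sub>f v" if "Q v" for v
  proof
    fix y
    show "U \<one> v y = (\<gamma> \<one> \<one> \<cdot>\<^sub>f v) y"
      using g1[of y] Q_supp[OF that, of y] by (cases "y \<in> carrier G") (simp_all add: U_def)
  qed
  \<comment> \<open>Applied with \<open>k\<close> the group order: there \<open>x [^] k\<close> is
    the identity, and the power of \<open>U x\<close> is a nonzero scalar on
    \<open>Q\<close>.\<close>
  have Upow: "\<exists>\<kappa>. \<kappa> \<noteq> 0 \<and> (\<forall>v. Q v \<longrightarrow> (U x ^^ k) v = \<kappa> \<cdot>\<^sub>f U (x [^] k) v)" if x: "x \<in> carrier G" for x k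
  proof (induction k)
    case 0
    have "v = (1 / \<gamma> \<one> \<one>) \<cdot>\<^sub>f U \<one> v" if "Q v" for v
      unfolding U1[OF that] using nz[of \<one> \<one>] by simp
    then show ?case using nz[of \<one> \<one>] by (intro exI[of _ "1 / \<gamma> \<one> \<one>"]) simp
  next
    case (Suc k)
    then obtain \<kappa> where k: "\<kappa> \<noteq> 0" "\<And>v. Q v \<Longrightarrow> (U x ^^ k) v = \<kappa> \<cdot>\<^sub>f U (x [^] k) v" by blast
    have "(U x ^^ Suc k) v = (\<kappa> * \<gamma> x (x [^] k)) \<cdot>\<^sub>f U (x [^] Suc k) v" if "Q v" for v
    proof -
      have "(U x ^^ Suc k) v = U x (\<kappa> \<cdot>\<^sub>f U (x [^] k) v)" using k(2)[OF that] by simp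
      also have "\<dots> = \<kappa> \<cdot>\<^sub>f U x (U (x [^] k) v)" by (auto simp: U_def fun_eq_iff)
      finally show ?thesis using x by (simp add: UU fun_vs.scale_scale m_comm[of x])
    qed
    then show ?case using k(1) nz[OF x, of "x [^] k"] x by (intro exI[of _ "\<kappa> * \<gamma> x (x [^] k)"]) simp
  qed
  have "\<exists>v \<mu>. Q v \<and> v \<noteq> 0 \<and> (\<forall>x\<in>carrier G. U x v = \<mu> x \<cdot>\<^sub>f v)"
  proof (rule common_eigenvector[OF vector_space_fun_scale fin])
    fix x y v assume x: "x \<in> carrier G" "y \<in> carrier G"
    then show "U x (U y v) = U y (U x v)" using UU sym m_comm by metis
  next
    fix x assume x: "x \<in> carrier G"
    obtain \<kappa> where k: "\<kappa> \<noteq> 0" "\<And>v. Q v \<Longrightarrow> (U x ^^ Coset.order G) v = \<kappa> \<cdot>\<^sub>f U (x [^] Coset.order G) v"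
      using Upow[OF x] by blast
    then have "(U x ^^ Coset.order G) v = (\<kappa> * \<gamma> \<one> \<one>) \<cdot>\<^sub>f v" if "Q v" for v
      using that U1[OF that] pow_order_eq_1[OF x] by (simp add: fun_vs.scale_scale)
    moreover have "0 < Coset.order G" using fin order_gt_0_iff_finite by blast
    ultimately show "\<exists>r \<kappa>. 0 < r \<and> \<kappa> \<noteq> 0 \<and> (\<forall>v. Q v \<longrightarrow> (U x ^^ r) v = \<kappa> \<cdot>\<^sub>f v)"
      using k(1) nz[of \<one> \<one>] by (intro exI[of _ "Coset.order G"] exI[of _ "\<kappa> * \<gamma> \<one> \<one>"]) simp
  qed (use Q_add Q_scl Q_U v0 in \<open>auto simp: U_def fun_eq_iff algebra_simps\<close>)
  then obtain v \<mu> where v: "Q v" "v \<noteq> 0" and \<mu>: "\<And>a. a \<in> carrier G \<Longrightarrow> U a v = \<mu> a \<cdot>\<^sub>f v" by blast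
  have Uscl: "U a (c \<cdot>\<^sub>f f) = c \<cdot>\<^sub>f U a f" for a c f by (auto simp: U_def fun_eq_iff)
  have mult: "\<mu> a * \<mu> b = \<gamma> a b * \<mu> (a \<otimes> b)" if "a \<in> carrier G" "b \<in> carrier G" for a b
  proof -
    have "(\<mu> b * \<mu> a) \<cdot>\<^sub>f v = (\<gamma> a b * \<mu> (a \<otimes> b)) \<cdot>\<^sub>f v"
      using UU[OF that, of v] that by (simp add: \<mu> Uscl fun_vs.scale_scale)
    then show ?thesis using v(2) by (simp add: mult.commute)
  qed
  have "\<mu> \<one> = \<gamma> \<one> \<one>" using \<mu>[of \<one>] U1[OF v(1)] v(2) by simp
  then have "\<mu> a \<noteq> 0" if "a \<in> carrier G" for a
    using mult[OF that inv_closed[OF that]] that nz[of \<one> \<one>] nz[of a "inv a"] by auto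
  then show ?thesis using v \<mu> mult by blast
qed

text \<open>The eigenvalues \<open>\<mu>\<close> of the twisted translations on a common eigenvector
  exhibit \<open>\<gamma>\<close> as a coboundary.\<close>

lemma (in comm_group) symmetric_cocycle_trivial:
  fixes \<gamma> :: "'a \<Rightarrow> 'a \<Rightarrow> complex"
  assumes fin: "finite (carrier G)"
    and nz: "\<And>a b. a \<in> carrier G \<Longrightarrow> b \<in> carrier G \<Longrightarrow> \<gamma> a b \<noteq> 0"
    and sym: "\<And>a b. a \<in> carrier G \<Longrightarrow> b \<in> carrier G \<Longrightarrow> \<gamma> a b = \<gamma> b a"
    and coc: "\<And>a b c. a \<in> carrier G \<Longrightarrow> b \<in> carrier G \<Longrightarrow> c \<in> carrier G \<Longrightarrow>
      \<gamma> a b * \<gamma> (a \<otimes> b) c = \<gamma> a (b \<otimes> c) * \<gamma> b c"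
  obtains \<mu> where "\<And>a. a \<in> carrier G \<Longrightarrow> \<mu> a \<noteq> 0"
    and "\<And>a b. a \<in> carrier G \<Longrightarrow> b \<in> carrier G \<Longrightarrow> \<mu> a * \<mu> b = \<gamma> a b * \<mu> (a \<otimes> b)"
proof -
  let ?Q = "\<lambda>f::'a \<Rightarrow> complex. \<forall>x. x \<notin> carrier G \<longrightarrow> f x = 0"
  have "basis_elem \<one> \<noteq> 0" by (auto simp: basis_elem_def fun_eq_iff)
  then have "\<exists>v \<mu>. ?Q v \<and> v \<noteq> 0 \<and> (\<forall>a\<in>carrier G. \<mu> a \<noteq> 0 \<and>
      (\<lambda>y. if y \<in> carrier G then \<gamma> a (inv a \<otimes> y) * v (inv a \<otimes> y) else 0) = \<mu> a \<cdot>\<^sub>f v) \<and>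
    (\<forall>a\<in>carrier G. \<forall>b\<in>carrier G. \<mu> a * \<mu> b = \<gamma> a b * \<mu> (a \<otimes> b))"
    by (intro symmetric_cocycle_eigen[OF fin, of \<gamma> ?Q "basis_elem \<one>"] nz sym coc)
      (simp_all add: basis_elem_def)
  then show thesis using that by blast
qed

text \<open>For the trivial cocycle the eigenvalues form a linear character. Confining the search to
  functions whose sums along the orbits of \<open>a\<close> vanish excludes the eigenvalue 1 at
  \<open>a\<close>: a vector fixed by \<open>a\<close> is constant on these orbits, hence
  zero.\<close>

lemma (in comm_group) nontrivial_linear_character:
  assumes fin: "finite (carrier G)" and a: "a \<in> carrier G" "a \<noteq> \<one>"
  obtains \<mu> :: "'a \<Rightarrow> complex" where "\<And>x. x \<in> carrier G \<Longrightarrow> \<mu> x \<noteq> 0"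
    and "\<And>x y. x \<in> carrier G \<Longrightarrow> y \<in> carrier G \<Longrightarrow> \<mu> (x \<otimes> y) = \<mu> x * \<mu> y"
    and "\<mu> a \<noteq> 1"
proof -
  define U where "U x f y = (if y \<in> carrier G then f (inv x \<otimes> y) else 0 :: complex)" for x f y
  have U': "U = (\<lambda>a f y. if y \<in> carrier G then 1 * f (inv a \<otimes> y) else 0)"
    by (auto simp: U_def fun_eq_iff)
  \<comment> \<open>The sum takes as many powers of \<open>a\<close> as the group has elements, so
    it is a multiple of the orbit sum and is unchanged by a shift by \<open>a\<close>.\<close>
  let ?Q = "\<lambda>f::'a \<Rightarrow> complex. (\<forall>x. x \<notin> carrier G \<longrightarrow> f x = 0) \<and>
    (\<forall>y\<in>carrier G. (\<Sum>k<Coset.order G. f (a [^] k \<otimes> y)) = 0)"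
  let ?v = "\<lambda>x. basis_elem \<one> x - basis_elem (inv a) x"
  have ia: "inv a \<noteq> \<one>" using a by (metis inv_inv inv_one)
  have sh: "(\<Sum>k<Coset.order G. f (a [^] Suc k \<otimes> y)) = (\<Sum>k<Coset.order G. f (a [^] k \<otimes> y))"
    if y: "y \<in> carrier G" for f :: "'a \<Rightarrow> complex" and y
    using sum.lessThan_Suc_shift[of "\<lambda>k. f (a [^] k \<otimes> y)" "Coset.order G"] pow_order_eq_1[OF a(1)] y
    by simp
  have "\<exists>v \<mu>. ?Q v \<and> v \<noteq> 0 \<and> (\<forall>a\<in>carrier G. \<mu> a \<noteq> 0 \<and> U a v = \<mu> a \<cdot>\<^sub>f v) \<and>
    (\<forall>a\<in>carrier G. \<forall>b\<in>carrier G. \<mu> a * \<mu> b = (1::complex) * \<mu> (a \<otimes> b))"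
    unfolding U'
  proof (rule symmetric_cocycle_eigen[OF fin, of "\<lambda>_ _. 1" ?Q ?v])
    show "?v \<noteq> 0" using ia by (auto simp: basis_elem_def fun_eq_iff)
    have "(\<Sum>k<Coset.order G. ?v (a [^] k \<otimes> y)) = 0" if y: "y \<in> carrier G" for y
    proof -
      have "basis_elem (inv a) (a [^] k \<otimes> y) = basis_elem \<one> (a [^] Suc k \<otimes> y)" for k
      proof -
        have "a [^] Suc k \<otimes> y = a \<otimes> (a [^] k \<otimes> y)" using a(1) y
          by (simp add: m_ac)
        moreover have "a [^] k \<otimes> y = inv a \<longleftrightarrow> a \<otimes> (a [^] k \<otimes> y) = \<one>"
          using a(1) y inv_char[of "a" "a [^] k \<otimes> y"] m_comm[of a "a [^] k \<otimes> y"] by auto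
        ultimately show ?thesis by (simp add: basis_elem_def)
      qed
      then show ?thesis using sh[OF y, of "basis_elem \<one>"] by (simp add: sum_subtractf)
    qed
    then show "?Q ?v" using a by (auto simp: basis_elem_def)
  next
    fix x f assume x: "x \<in> carrier G" and f: "?Q f"
    have "a [^] k \<otimes> y \<in> carrier G" "inv x \<otimes> (a [^] k \<otimes> y) = a [^] k \<otimes> (inv x \<otimes> y)"
      if "y \<in> carrier G" for y and k :: nat using that x a(1) by (auto simp: m_lcomm)
    then show "?Q (\<lambda>y. if y \<in> carrier G then 1 * f (inv x \<otimes> y) else 0)"
      using f x by simp
  qed (auto simp: sum.distrib sum_distrib_left[symmetric])
  then obtain v \<mu> where v: "?Q v" "v \<noteq> 0"
    and \<mu>: "\<And>a. a \<in> carrier G \<Longrightarrow> \<mu> a \<noteq> 0 \<and> U a v = \<mu> a \<cdot>\<^sub>f v"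
      "\<And>a b. a \<in> carrier G \<Longrightarrow> b \<in> carrier G \<Longrightarrow> \<mu> a * \<mu> b = \<mu> (a \<otimes> b)"
    by (simp only: mult_1_left) blast
  have "\<mu> a \<noteq> 1"
  proof
    assume 1: "\<mu> a = 1"
    then have "U a v = v" using \<mu>(1)[OF a(1)] by simp
    then have inva: "v (a \<otimes> y) = v y" if "y \<in> carrier G" for y
    proof -
      have "U a v (a \<otimes> y) = v y" using that a(1) by (simp add: U_def m_assoc[symmetric])
      then show ?thesis using \<open>U a v = v\<close> by simp
    qed
    have pw: "v (a [^] k \<otimes> y) = v y" if y: "y \<in> carrier G" for y and k :: nat
    proof (induction k)
      case (Suc k)
      have "a [^] Suc k \<otimes> y = a \<otimes> (a [^] k \<otimes> y)" using a(1) y by (simp add: m_ac)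
      then show ?case using inva[of "a [^] k \<otimes> y"] Suc y a(1) by simp
    qed (use y in simp)
    have "v y = 0" if y: "y \<in> carrier G" for y
    proof -
      have "(\<Sum>k<Coset.order G. v (a [^] k \<otimes> y)) = 0" using v(1) y by blast
      then have "of_nat (Coset.order G) * v y = 0" by (simp add: pw[OF y])
      moreover have "0 < Coset.order G" using fin order_gt_0_iff_finite by blast
      ultimately show ?thesis by simp
    qed
    then show False using v by (auto simp: fun_eq_iff)
  qed
  then show thesis using \<mu> that by metis
qed

section \<open>Twisted group algebras\<close>

lemma (in group) sum_left_translate:
  fixes f :: "'a \<Rightarrow> 'm::comm_monoid_add"
  assumes "subgroup A G" "a \<in> A"
  shows "(\<Sum>b\<in>A. f (a \<otimes> b)) = sum f A"
proof -
  interpret A: subgroup A G by fact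
  have "a \<otimes> (inv a \<otimes> b) = b" "inv a \<otimes> (a \<otimes> b) = b" if "b \<in> A" for b
    using that assms(2) by (simp_all add: m_assoc[symmetric] A.mem_carrier)
  then have "bij_betw (\<lambda>b. a \<otimes> b) A A"
    using assms(2) by (intro bij_betwI[of _ _ _ "\<lambda>b. inv a \<otimes> b"]) auto
  then show ?thesis by (rule sum.reindex_bij_betw)
qed

lemma (in group) sum_character_eq_0:
  fixes \<chi> :: "'a \<Rightarrow> complex"
  assumes A: "subgroup A G" and mult: "\<And>a b. a \<in> A \<Longrightarrow> b \<in> A \<Longrightarrow> \<chi> (a \<otimes> b) = \<chi> a * \<chi> b"
    and "b \<in> A" "\<chi> b \<noteq> 1"
  shows "sum \<chi> A = 0"
proof -
  have "\<chi> b * sum \<chi> A = (\<Sum>a\<in>A. \<chi> (b \<otimes> a))"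
    unfolding sum_distrib_left using assms by (intro sum.cong) auto
  then have "\<chi> b * sum \<chi> A = sum \<chi> A" using sum_left_translate[OF A \<open>b \<in> A\<close>, of \<chi>] by simp
  then show ?thesis using assms(4) by auto
qed

text \<open>Here \<open>Q\<close> stands for \<open>G/L\<close>, \<open>A\<close> for
  \<open>K/L\<close>, and \<open>W'\<close> for the inverses of the basis elements \<open>W\<close>.
  The ambient algebra may be larger than the span of \<open>W\<close>, so inverses and neutrality
  refer to the idempotent \<open>e\<close>.\<close>

locale twisted_algebra = Vector_Spaces.vector_space scl + group Q
  for scl :: "complex \<Rightarrow> 'v::ab_group_add \<Rightarrow> 'v" (infixr "*\<^sub>c" 75)
    and Q :: "('q, 'r) monoid_scheme" (structure) +
  fixes mul :: "'v \<Rightarrow> 'v \<Rightarrow> 'v" (infixl "\<star>" 77) and e :: 'v and W W' :: "'q \<Rightarrow> 'v" and A :: "'q set"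
  assumes mul_assoc: "u \<star> v \<star> w = u \<star> (v \<star> w)"
    and mul_add_left: "(u + v) \<star> w = u \<star> w + v \<star> w"
    and mul_add_right: "w \<star> (u + v) = w \<star> u + w \<star> v"
    and mul_scl_left: "(c *\<^sub>c u) \<star> v = c *\<^sub>c (u \<star> v)"
    and mul_scl_right: "u \<star> (c *\<^sub>c v) = c *\<^sub>c (u \<star> v)"
    and W_mult: "x \<in> carrier Q \<Longrightarrow> y \<in> carrier Q \<Longrightarrow> \<exists>c. W x \<star> W y = c *\<^sub>c W (x \<otimes> y)"
    and W_W': "x \<in> carrier Q \<Longrightarrow> W x \<star> W' x = e"
    and W'_W: "x \<in> carrier Q \<Longrightarrow> W' x \<star> W x = e"
    and e_W: "x \<in> carrier Q \<Longrightarrow> e \<star> W x = W x"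
    and W_e: "x \<in> carrier Q \<Longrightarrow> W x \<star> e = W x"
    and e_W': "x \<in> carrier Q \<Longrightarrow> e \<star> W' x = W' x"
    and W'_e: "x \<in> carrier Q \<Longrightarrow> W' x \<star> e = W' x"
    and e_neq_0: "e \<noteq> 0"
    and finite_A: "finite A"
    and normal_A: "A \<lhd> Q"
    and A_comm: "a \<in> A \<Longrightarrow> b \<in> A \<Longrightarrow> a \<otimes> b = b \<otimes> a"
    and odd_A: "odd (card A)"
    and nondegenerate: "a \<in> A \<Longrightarrow> (\<And>b. b \<in> A \<Longrightarrow> W a \<star> W b = W b \<star> W a) \<Longrightarrow> a = \<one>"
begin

lemma subgroup_A: "subgroup A Q"
  using normal_A by (rule normal_imp_subgroup)

lemma A_carrier [simp]: "a \<in> A \<Longrightarrow> a \<in> carrier Q"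
  using subgroup_A by (rule subgroup.mem_carrier)

lemma A_closed [simp]: "a \<in> A \<Longrightarrow> b \<in> A \<Longrightarrow> a \<otimes> b \<in> A" "a \<in> A \<Longrightarrow> inv a \<in> A" "\<one> \<in> A"
  using subgroup_A by (auto simp: subgroup.m_closed subgroup.m_inv_closed subgroup.one_closed)

lemma zero_mul [simp]: "0 \<star> v = 0"
  using mul_scl_left[of 0 0 v] by simp

lemma mul_zero [simp]: "v \<star> 0 = 0"
  using mul_scl_right[of v 0 0] by simp

lemma sum_mul: "(\<Sum>i\<in>I. f i) \<star> v = (\<Sum>i\<in>I. f i \<star> v)"
  by (induction I rule: infinite_finite_induct) (auto simp: mul_add_left)

lemma mul_sum: "v \<star> (\<Sum>i\<in>I. f i) = (\<Sum>i\<in>I. v \<star> f i)"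
  by (induction I rule: infinite_finite_induct) (auto simp: mul_add_right)

lemmas scl_simps = mul_scl_left mul_scl_right scale_scale

lemma e_e: "e \<star> e = e"
  using mul_assoc[of e "W \<one>" "W' \<one>"] by (simp add: W_W' e_W)

subsection \<open>The commutator form\<close>

definition al where "al x y = (SOME c. W x \<star> W y = c *\<^sub>c W (x \<otimes> y))"

lemma W_W: "x \<in> carrier Q \<Longrightarrow> y \<in> carrier Q \<Longrightarrow> W x \<star> W y = al x y *\<^sub>c W (x \<otimes> y)"
  unfolding al_def by (rule someI_ex) (rule W_mult)

lemma cancel_right: "x \<in> carrier Q \<Longrightarrow> u \<star> e = u \<Longrightarrow> v \<star> e = v \<Longrightarrow> u \<star> W x = v \<star> W x \<Longrightarrow> u = v"
  by (metis mul_assoc W_W')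

lemma W_neq_0: "x \<in> carrier Q \<Longrightarrow> W x \<noteq> 0"
  using W_W'[of x] e_neq_0 by auto

lemma W_W_neq_0:
  assumes "x \<in> carrier Q" "y \<in> carrier Q"
  shows "W x \<star> W y \<noteq> 0"
proof
  assume "W x \<star> W y = 0"
  then have "W x = 0" using cancel_right[of y "W x" 0] assms by (simp add: W_e)
  then show False using W_neq_0 assms by blast
qed

lemma al_neq_0: "x \<in> carrier Q \<Longrightarrow> y \<in> carrier Q \<Longrightarrow> al x y \<noteq> 0"
  using W_W[of x y] W_W_neq_0[of x y] by auto

lemma al_cocycle:
  assumes "x \<in> carrier Q" "y \<in> carrier Q" "z \<in> carrier Q"
  shows "al x y * al (x \<otimes> y) z = al x (y \<otimes> z) * al y z"
proof -
  have "(al x y * al (x \<otimes> y) z) *\<^sub>c W (x \<otimes> y \<otimes> z) = W x \<star> W y \<star> W z"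
    using assms by (simp add: W_W scl_simps)
  also have "\<dots> = W x \<star> (W y \<star> W z)" by (rule mul_assoc)
  also have "\<dots> = (al x (y \<otimes> z) * al y z) *\<^sub>c W (x \<otimes> y \<otimes> z)"
    using assms by (simp add: W_W scl_simps m_assoc mult.commute)
  finally show ?thesis using W_neq_0[of "x \<otimes> y \<otimes> z"] assms by simp
qed

text \<open>The scalar of the commutator of \<open>W a\<close> and \<open>W b\<close> for commuting
  \<open>a\<close> and \<open>b\<close>. In contrast to \<open>al\<close> it does not change when
  the basis is rescaled.\<close>

definition \<omega> where "\<omega> a b = al a b / al b a"

lemma \<omega>_neq_0: "a \<in> A \<Longrightarrow> b \<in> A \<Longrightarrow> \<omega> a b \<noteq> 0"
  by (simp add: \<omega>_def al_neq_0)

lemma \<omega>_swap: "\<omega> b a = 1 / \<omega> a b"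
  by (simp add: \<omega>_def)

lemma \<omega>_self: "a \<in> A \<Longrightarrow> \<omega> a a = 1"
  by (simp add: \<omega>_def al_neq_0)

lemma W_\<omega>: "a \<in> A \<Longrightarrow> b \<in> A \<Longrightarrow> W a \<star> W b = \<omega> a b *\<^sub>c (W b \<star> W a)"
  by (simp add: W_W \<omega>_def al_neq_0 A_comm[of a b])

text \<open>Moving \<open>W c\<close> to the left past \<open>W b\<close> and then past
  \<open>W a\<close> costs \<open>\<omega> b c * \<omega> a c\<close>; moving it past
  \<open>W (a \<otimes> b)\<close> at once costs \<open>\<omega> (a \<otimes> b) c\<close>.\<close>

lemma \<omega>_mult_left:
  assumes "a \<in> A" "b \<in> A" "c \<in> A"
  shows "\<omega> (a \<otimes> b) c = \<omega> a c * \<omega> b c"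
proof -
  have "al a b *\<^sub>c (W (a \<otimes> b) \<star> W c) = W a \<star> (W b \<star> W c)"
    using assms by (simp add: mul_assoc[symmetric] W_W[of a b] scl_simps)
  also have "\<dots> = \<omega> b c *\<^sub>c (W a \<star> W c \<star> W b)"
    using assms by (simp add: W_\<omega>[of b c] scl_simps mul_assoc)
  also have "\<dots> = (\<omega> b c * \<omega> a c) *\<^sub>c (W c \<star> (W a \<star> W b))"
    using assms by (simp add: W_\<omega>[of a c] scl_simps mul_assoc)
  also have "\<dots> = (\<omega> b c * \<omega> a c * al a b) *\<^sub>c (W c \<star> W (a \<otimes> b))"
    using assms by (simp add: W_W[of a b] scl_simps)
  finally have "(al a b * \<omega> (a \<otimes> b) c) *\<^sub>c (W c \<star> W (a \<otimes> b))
    = (\<omega> b c * \<omega> a c * al a b) *\<^sub>c (W c \<star> W (a \<otimes> b))"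
    using assms by (simp add: W_\<omega>[of "a \<otimes> b" c] scl_simps)
  then show ?thesis using W_W_neq_0[of c "a \<otimes> b"] assms al_neq_0[of a b] by simp
qed

lemma \<omega>_mult_right: "a \<in> A \<Longrightarrow> b \<in> A \<Longrightarrow> c \<in> A \<Longrightarrow> \<omega> c (a \<otimes> b) = \<omega> c a * \<omega> c b"
  using \<omega>_mult_left[of a b c] by (simp add: \<omega>_swap[of c])

lemma \<omega>_nondegenerate:
  assumes "a \<in> A" "a \<noteq> \<one>"
  obtains b where "b \<in> A" "\<omega> a b \<noteq> 1"
  using nondegenerate[OF assms(1)] W_\<omega>[OF assms(1)] assms by (metis scale_one)

text \<open>Translation by \<open>a\<close> permutes \<open>A\<close>, so the product of all
  \<open>\<omega> c b\<close> reproduces itself times \<open>\<omega> a b ^ card A\<close>.\<close>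

lemma \<omega>_power_card:
  assumes "a \<in> A" "b \<in> A"
  shows "\<omega> a b ^ card A = 1"
proof -
  have "(\<lambda>c. a \<otimes> c) ` A = A"
  proof
    show "A \<subseteq> (\<lambda>c. a \<otimes> c) ` A"
    proof
      fix c assume c: "c \<in> A"
      then have "c = a \<otimes> (inv a \<otimes> c)" using assms by (simp add: m_assoc[symmetric])
      then show "c \<in> (\<lambda>c. a \<otimes> c) ` A" using c assms by (metis A_closed(1,2) imageI)
    qed
  qed (use assms in auto)
  moreover have "inj_on (\<lambda>c. a \<otimes> c) A" using assms by (auto simp: inj_on_def)
  ultimately have "(\<Prod>c\<in>A. \<omega> (a \<otimes> c) b) = (\<Prod>c\<in>A. \<omega> c b)"
    using prod.reindex[of "\<lambda>c. a \<otimes> c" A "\<lambda>c. \<omega> c b"] by simp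
  then have "\<omega> a b ^ card A * (\<Prod>c\<in>A. \<omega> c b) = (\<Prod>c\<in>A. \<omega> c b)"
    using assms by (simp add: \<omega>_mult_left prod.distrib)
  moreover have "(\<Prod>c\<in>A. \<omega> c b) \<noteq> 0" using assms finite_A by (simp add: \<omega>_neq_0)
  ultimately show ?thesis by simp
qed

text \<open>As \<open>|A|\<close> is odd, \<open>\<beta>\<close> is a bicharacter that is a square root of \<open>\<omega>\<close>.\<close>

definition \<beta> where "\<beta> a b = \<omega> a b ^ ((card A + 1) div 2)"

lemma \<beta>_square: "a \<in> A \<Longrightarrow> b \<in> A \<Longrightarrow> \<beta> a b * \<beta> a b = \<omega> a b"
proof -
  assume "a \<in> A" "b \<in> A"
  \<comment> \<open>Oddness makes the division by 2 exact; of the doubled exponent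
    \<open>card A + 1\<close> the part \<open>card A\<close> drops out by
    \<open>\<omega>_power_card\<close>.\<close>
  moreover have "(card A + 1) div 2 + (card A + 1) div 2 = card A + 1" using odd_A by presburger
  ultimately show ?thesis unfolding \<beta>_def power_add[symmetric] by (simp add: \<omega>_power_card)
qed

lemma \<beta>_neq_0: "a \<in> A \<Longrightarrow> b \<in> A \<Longrightarrow> \<beta> a b \<noteq> 0"
  by (simp add: \<beta>_def \<omega>_neq_0)

lemma \<beta>_swap: "\<beta> b a = 1 / \<beta> a b"
  by (simp add: \<beta>_def \<omega>_swap[of b a] power_divide)

lemma \<beta>_self: "a \<in> A \<Longrightarrow> \<beta> a a = 1"
  by (simp add: \<beta>_def \<omega>_self)

lemma \<beta>_mult_left: "a \<in> A \<Longrightarrow> b \<in> A \<Longrightarrow> c \<in> A \<Longrightarrow> \<beta> (a \<otimes> b) c = \<beta> a c * \<beta> b c"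
  by (simp add: \<beta>_def \<omega>_mult_left power_mult_distrib)

lemma \<beta>_mult_right: "a \<in> A \<Longrightarrow> b \<in> A \<Longrightarrow> c \<in> A \<Longrightarrow> \<beta> c (a \<otimes> b) = \<beta> c a * \<beta> c b"
  by (simp add: \<beta>_def \<omega>_mult_right power_mult_distrib)

lemma \<beta>_one: "a \<in> A \<Longrightarrow> \<beta> \<one> a = 1" "a \<in> A \<Longrightarrow> \<beta> a \<one> = 1"
  using \<beta>_mult_left[of \<one> \<one> a] \<beta>_mult_right[of \<one> \<one> a] \<beta>_neq_0[of \<one> a] \<beta>_neq_0[of a \<one>] by auto

lemma \<beta>_inv_left: "a \<in> A \<Longrightarrow> b \<in> A \<Longrightarrow> \<beta> (inv a) b = 1 / \<beta> a b"
  using \<beta>_mult_left[of a "inv a" b] \<beta>_neq_0[of a b] by (simp add: \<beta>_one field_simps)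

lemma \<beta>_inv_right: "a \<in> A \<Longrightarrow> b \<in> A \<Longrightarrow> \<beta> a (inv b) = 1 / \<beta> a b"
  using \<beta>_mult_right[of b "inv b" a] \<beta>_neq_0[of a b] by (simp add: \<beta>_one field_simps)

lemma sum_\<omega>: "a \<in> A \<Longrightarrow> (\<Sum>b\<in>A. \<omega> a b) = (if a = \<one> then of_nat (card A) else 0)"
proof (cases "a = \<one>")
  case True
  then show ?thesis using \<omega>_mult_left[of \<one> \<one>] \<omega>_neq_0[of \<one>] by simp
next
  case False
  assume "a \<in> A"
  then show ?thesis using False \<omega>_nondegenerate[of a] sum_character_eq_0[OF subgroup_A, of "\<omega> a"]
    by (metis \<omega>_mult_right)
qed

text \<open>Nondegeneracy passes from \<open>\<omega>\<close> to \<open>\<beta>\<close>, since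
  \<open>\<beta> a b = 1\<close> forces its square \<open>\<omega> a b\<close> to be 1.\<close>

lemma sum_\<beta>: "a \<in> A \<Longrightarrow> (\<Sum>b\<in>A. \<beta> a b) = (if a = \<one> then of_nat (card A) else 0)"
proof (cases "a = \<one>")
  case True
  then show ?thesis by (simp add: \<beta>_one)
next
  case False
  assume a: "a \<in> A"
  obtain b where "b \<in> A" "\<omega> a b \<noteq> 1" using \<omega>_nondegenerate a False by blast
  then have "b \<in> A" "\<beta> a b \<noteq> 1" using \<beta>_square[of a b] a by auto
  then show ?thesis using False a sum_character_eq_0[OF subgroup_A, of "\<beta> a"]
    by (simp add: \<beta>_mult_right)
qed

subsection \<open>The normalised basis\<close>

text \<open>The cocycles \<open>al\<close> and \<open>\<beta>\<close> have the same antisymmetric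
  part: \<open>\<beta> a b / \<beta> b a\<close> is the square of \<open>\<beta> a b\<close>, which
  is \<open>\<omega> a b\<close>. Their quotient is thus a symmetric cocycle on the abelian group
  \<open>A\<close>, and its trivialisation provides the rescaling factors.\<close>

lemma ex_normalisation:
  "\<exists>\<mu>. (\<forall>a\<in>A. \<mu> a \<noteq> 0) \<and> (\<forall>a\<in>A. \<forall>b\<in>A. \<mu> a * \<mu> b * al a b = \<beta> a b * \<mu> (a \<otimes> b))"
proof -
  interpret QA: comm_group "Q\<lparr>carrier := A\<rparr>"
    using subgroup.subgroup_is_group[OF subgroup_A is_group] A_comm
    by (intro group.group_comm_groupI) auto
  define \<gamma> where "\<gamma> a b = \<beta> a b / al a b" for a b
  obtain \<mu> where \<mu>: "\<And>a. a \<in> carrier (Q\<lparr>carrier := A\<rparr>) \<Longrightarrow> \<mu> a \<noteq> 0"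
    "\<And>a b. a \<in> carrier (Q\<lparr>carrier := A\<rparr>) \<Longrightarrow> b \<in> carrier (Q\<lparr>carrier := A\<rparr>) \<Longrightarrow>
      \<mu> a * \<mu> b = \<gamma> a b * \<mu> (a \<otimes>\<^bsub>Q\<lparr>carrier := A\<rparr>\<^esub> b)"
  proof (rule QA.symmetric_cocycle_trivial[of \<gamma>])
    fix a b assume "a \<in> carrier (Q\<lparr>carrier := A\<rparr>)" "b \<in> carrier (Q\<lparr>carrier := A\<rparr>)"
    then have ab: "a \<in> A" "b \<in> A" by auto
    then show "\<gamma> a b \<noteq> 0" by (simp add: \<gamma>_def \<beta>_neq_0 al_neq_0)
    show "\<gamma> a b = \<gamma> b a"
      using \<beta>_square[OF ab] \<beta>_neq_0[OF ab] al_neq_0[of a b] al_neq_0[of b a] ab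
      by (simp add: \<gamma>_def \<beta>_swap[of b a] \<omega>_def field_simps)
  next
    fix a b c assume "a \<in> carrier (Q\<lparr>carrier := A\<rparr>)" "b \<in> carrier (Q\<lparr>carrier := A\<rparr>)"
      "c \<in> carrier (Q\<lparr>carrier := A\<rparr>)"
    then have abc: "a \<in> A" "b \<in> A" "c \<in> A" by auto
    have "\<beta> a b * \<beta> (a \<otimes> b) c = \<beta> a (b \<otimes> c) * \<beta> b c"
      using abc by (simp add: \<beta>_mult_left \<beta>_mult_right)
    then show "\<gamma> a b * \<gamma> (a \<otimes>\<^bsub>Q\<lparr>carrier := A\<rparr>\<^esub> b) c = \<gamma> a (b \<otimes>\<^bsub>Q\<lparr>carrier := A\<rparr>\<^esub> c) * \<gamma> b c"
      using abc al_cocycle[of a b c] by (simp add: \<gamma>_def)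
  qed (use finite_A in auto)
  then show ?thesis
    by (intro exI[of _ \<mu>]) (auto simp: \<gamma>_def al_neq_0 field_simps)
qed

definition \<mu> where
  "\<mu> = (SOME \<mu>. (\<forall>a\<in>A. \<mu> a \<noteq> 0) \<and> (\<forall>a\<in>A. \<forall>b\<in>A. \<mu> a * \<mu> b * al a b = \<beta> a b * \<mu> (a \<otimes> b)))"

lemma \<mu>_neq_0: "a \<in> A \<Longrightarrow> \<mu> a \<noteq> 0"
  and \<mu>_mult: "a \<in> A \<Longrightarrow> b \<in> A \<Longrightarrow> \<mu> a * \<mu> b * al a b = \<beta> a b * \<mu> (a \<otimes> b)"
  using someI_ex[OF ex_normalisation] unfolding \<mu>_def[symmetric] by auto

definition s where "s a = \<mu> a *\<^sub>c W a"

lemma s_s: "a \<in> A \<Longrightarrow> b \<in> A \<Longrightarrow> s a \<star> s b = \<beta> a b *\<^sub>c s (a \<otimes> b)"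
  using \<mu>_mult[of a b] by (simp add: s_def scl_simps W_W mult_ac)

lemma W_eq_s: "a \<in> A \<Longrightarrow> W a = (1 / \<mu> a) *\<^sub>c s a"
  by (simp add: s_def \<mu>_neq_0)

lemma e_s [simp]: "a \<in> A \<Longrightarrow> e \<star> s a = s a"
  and s_e [simp]: "a \<in> A \<Longrightarrow> s a \<star> e = s a"
  by (simp_all add: s_def scl_simps e_W W_e)

text \<open>\<open>\<beta>\<close> is 1 on the diagonal, so \<open>s \<one>\<close> is idempotent,
  and an invertible idempotent is the identity \<open>e\<close>.\<close>

lemma s_one: "s \<one> = e"
proof -
  have "s \<one> \<star> s \<one> = s \<one>" by (simp add: s_s \<beta>_self)
  then have "s \<one> \<star> s \<one> \<star> ((1 / \<mu> \<one>) *\<^sub>c W' \<one>) = s \<one> \<star> ((1 / \<mu> \<one>) *\<^sub>c W' \<one>)" by simp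
  then show ?thesis
    unfolding mul_assoc unfolding s_def using \<mu>_neq_0[of \<one>] by (simp add: scl_simps W_W' W_e)
qed

lemma s_inv [simp]: "a \<in> A \<Longrightarrow> s a \<star> s (inv a) = e" "a \<in> A \<Longrightarrow> s (inv a) \<star> s a = e"
  by (simp_all add: s_s \<beta>_inv_left \<beta>_inv_right \<beta>_self s_one)

lemma s_\<omega>: "a \<in> A \<Longrightarrow> b \<in> A \<Longrightarrow> s a \<star> s b = \<omega> a b *\<^sub>c (s b \<star> s a)"
  by (simp add: s_def scl_simps W_\<omega>[of a b] mult_ac)

lemma s_conj: "a \<in> A \<Longrightarrow> b \<in> A \<Longrightarrow> s (inv b) \<star> s a \<star> s b = \<omega> a b *\<^sub>c s a"
  by (simp add: mul_assoc s_\<omega>[of a b] scl_simps) (simp add: mul_assoc[symmetric])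

lemma s_mult: "a \<in> A \<Longrightarrow> b \<in> A \<Longrightarrow> s (a \<otimes> b) = (1 / \<beta> a b) *\<^sub>c (s a \<star> s b)"
  by (simp add: s_s \<beta>_neq_0)

lemma s_inv_mult: "a \<in> A \<Longrightarrow> b \<in> A \<Longrightarrow> s (inv (a \<otimes> b)) = \<beta> a b *\<^sub>c (s (inv b) \<star> s (inv a))"
  by (simp add: s_s \<beta>_inv_left \<beta>_inv_right inv_mult_group \<beta>_swap[of b a] \<beta>_neq_0)

lemma s_neq_0: "a \<in> A \<Longrightarrow> s a \<noteq> 0"
  using s_inv(1)[of a] e_neq_0 by (metis zero_mul)

section \<open>The span of the normalised basis and its centre\<close>

definition Sp where "Sp = span (s ` A)"

lemma s_Sp [simp]: "a \<in> A \<Longrightarrow> s a \<in> Sp"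
  unfolding Sp_def by (rule span_base) auto

lemma e_Sp [simp]: "e \<in> Sp"
  using s_Sp[of \<one>] by (simp add: s_one)

lemma Sp_scale: "v \<in> Sp \<Longrightarrow> c *\<^sub>c v \<in> Sp" and Sp_sum: "(\<And>i. i \<in> I \<Longrightarrow> g i \<in> Sp) \<Longrightarrow> sum g I \<in> Sp"
  and Sp_add: "u \<in> Sp \<Longrightarrow> v \<in> Sp \<Longrightarrow> u + v \<in> Sp" and Sp_zero: "0 \<in> Sp"
  unfolding Sp_def by (auto intro: span_scale span_sum span_add span_zero)

lemma Sp_induct [consumes 1, case_names basis zero add scale]:
  assumes "v \<in> Sp" and "\<And>a. a \<in> A \<Longrightarrow> P (s a)" and "P 0"
    and "\<And>u v. P u \<Longrightarrow> P v \<Longrightarrow> P (u + v)" and "\<And>c v. P v \<Longrightarrow> P (c *\<^sub>c v)"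
  shows "P v"
proof -
  have "v \<in> span (s ` A)" using assms(1) by (simp add: Sp_def)
  then show ?thesis
    by (induction rule: span_induct_alt) (use assms in auto)
qed

lemma Sp_mul:
  assumes "u \<in> Sp" "v \<in> Sp"
  shows "u \<star> v \<in> Sp"
  using assms(1)
proof (induction rule: Sp_induct)
  case (basis a)
  show ?case using assms(2)
    by (induction rule: Sp_induct) (auto simp: basis s_s scl_simps mul_add_right Sp_scale Sp_add Sp_zero)
qed (auto simp: scl_simps mul_add_left Sp_scale Sp_add Sp_zero)

lemma Sp_e: "v \<in> Sp \<Longrightarrow> v \<star> e = v" "v \<in> Sp \<Longrightarrow> e \<star> v = v"
  by (induction rule: Sp_induct) (auto simp: mul_add_left mul_add_right scl_simps)

text \<open>Divided by \<open>card A\<close>, this sum of conjugates projects \<open>Sp\<close> onto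
  the multiples of \<open>e\<close>, because the sum of \<open>\<omega> a b\<close> over
  \<open>b\<close> vanishes for \<open>a\<close> other than \<open>\<one>\<close>.\<close>

definition avg where "avg v = (\<Sum>b\<in>A. s (inv b) \<star> v \<star> s b)"

lemma avg_add: "avg (u + v) = avg u + avg v"
  by (simp add: avg_def mul_add_left mul_add_right sum.distrib)

lemma avg_scale: "avg (c *\<^sub>c v) = c *\<^sub>c avg v"
  by (simp add: avg_def scl_simps scale_sum_right)

lemma avg_sum: "avg (\<Sum>i\<in>I. f i) = (\<Sum>i\<in>I. avg (f i))"
  by (induction I rule: infinite_finite_induct) (simp_all add: avg_add, simp_all add: avg_def)

lemma avg_s: "a \<in> A \<Longrightarrow> avg (s a) = (if a = \<one> then of_nat (card A) else 0) *\<^sub>c s a"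
  by (simp add: avg_def s_conj scale_sum_left[symmetric] sum_\<omega>)

lemma avg_scalar: "v \<in> Sp \<Longrightarrow> \<exists>\<kappa>. avg v = \<kappa> *\<^sub>c e"
proof (induction rule: Sp_induct)
  case (basis a)
  then show ?case by (auto simp: avg_s s_one intro: exI[of _ 0])
next
  case zero
  show ?case by (auto simp: avg_def intro: exI[of _ 0])
next
  case (add u v)
  then show ?case by (metis avg_add scale_left_distrib)
next
  case (scale c v)
  then show ?case by (metis avg_scale scale_scale)
qed

lemma card_A_neq_0: "card A \<noteq> 0"
  using finite_A A_closed(3) card_0_eq by blast

text \<open>Such a \<open>v\<close> is its own average up to the factor \<open>card A\<close>, and
  averages are multiples of \<open>e\<close>. This is how products of intertwiners are recognised as
  scalars.\<close>

lemma central_scalar: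
  assumes "v \<in> Sp" and "\<And>b. b \<in> A \<Longrightarrow> s b \<star> v = v \<star> s b"
  obtains \<kappa> where "v = \<kappa> *\<^sub>c e"
proof -
  have "s (inv b) \<star> v \<star> s b = v" if "b \<in> A" for b
    using that assms by (simp add: mul_assoc assms(2)[symmetric]) (simp add: mul_assoc[symmetric] Sp_e)
  then have "avg v = of_nat (card A) *\<^sub>c v" by (simp add: avg_def sum_constant_scale)
  then obtain \<kappa> where "of_nat (card A) *\<^sub>c v = \<kappa> *\<^sub>c e" using avg_scalar[OF assms(1)] by auto
  then have "v = (\<kappa> / of_nat (card A)) *\<^sub>c e"
    using card_A_neq_0 by (metis divide_inverse mult.commute of_nat_eq_0_iff right_inverse scale_one scale_scale)
  then show thesis by (rule that)
qed

end

context twisted_algebra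
begin

subsection \<open>The complement\<close>

definition cj where "cj x a = inv x \<otimes> a \<otimes> x"

lemma cj_A [simp]: "x \<in> carrier Q \<Longrightarrow> a \<in> A \<Longrightarrow> cj x a \<in> A"
  using normal.inv_op_closed1[OF normal_A] by (simp add: cj_def)

lemma cj_mult: "x \<in> carrier Q \<Longrightarrow> a \<in> A \<Longrightarrow> b \<in> A \<Longrightarrow> cj x (a \<otimes> b) = cj x a \<otimes> cj x b"
proof -
  assume 1: "x \<in> carrier Q" "a \<in> A" "b \<in> A"
  then have "x \<otimes> (inv x \<otimes> (b \<otimes> x)) = b \<otimes> x" by (simp add: m_assoc[symmetric])
  then show ?thesis using 1 by (simp add: cj_def m_assoc)
qed

lemma cj_cj: "x \<in> carrier Q \<Longrightarrow> y \<in> carrier Q \<Longrightarrow> a \<in> A \<Longrightarrow> cj y (cj x a) = cj (x \<otimes> y) a"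
  by (simp add: cj_def inv_mult_group m_assoc)

lemma cj_inv: "x \<in> carrier Q \<Longrightarrow> a \<in> A \<Longrightarrow> cj x (inv a) = inv (cj x a)"
  by (simp add: cj_def inv_mult_group m_assoc)

lemma cj_self: "a \<in> A \<Longrightarrow> b \<in> A \<Longrightarrow> cj b a = a"
  using A_comm[of "inv b" a] by (simp add: cj_def m_assoc)

lemma cj_one: "a \<in> A \<Longrightarrow> cj \<one> a = a"
  by (simp add: cj_def)

lemma bij_cj: "x \<in> carrier Q \<Longrightarrow> bij_betw (cj x) A A"
  by (intro bij_betwI[of _ _ _ "cj (inv x)"]) (auto simp: cj_cj cj_one)

lemma mult_cj: "x \<in> carrier Q \<Longrightarrow> a \<in> A \<Longrightarrow> x \<otimes> cj x a = a \<otimes> x"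
  by (simp add: cj_def m_assoc[symmetric])

text \<open>On \<open>Sp\<close> this will turn out to be conjugation by any group element of the
  coset \<open>x\<close>.\<close>

definition act where "act x v = W' x \<star> v \<star> W x"

lemma act_add: "act x (u + v) = act x u + act x v"
  and act_scale: "act x (c *\<^sub>c v) = c *\<^sub>c act x v"
  by (simp_all add: act_def mul_add_left mul_add_right scl_simps)

lemma act_zero [simp]: "act x 0 = 0"
  by (simp add: act_def)

lemma act_mul: "x \<in> carrier Q \<Longrightarrow> u \<star> e = u \<Longrightarrow> act x (u \<star> v) = act x u \<star> act x v"
proof -
  assume 1: "x \<in> carrier Q" "u \<star> e = u"
  have "act x u \<star> act x v = W' x \<star> (u \<star> (W x \<star> W' x)) \<star> v \<star> W x"
    unfolding act_def by (simp add: mul_assoc)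
  then show ?thesis using 1 by (simp add: W_W' act_def mul_assoc)
qed

text \<open>The scalar \<open>al x y\<close> relating \<open>W x \<star> W y\<close> to
  \<open>W (x \<otimes> y)\<close> cancels against the one in the inverses, so the projective family
  \<open>W\<close> gives a genuine right action.\<close>

lemma act_act:
  assumes "x \<in> carrier Q" "y \<in> carrier Q"
  shows "act y (act x v) = act (x \<otimes> y) v"
proof -
  let ?xy = "x \<otimes> y" and ?c = "al x y"
  have Wxy: "W ?xy = (1 / ?c) *\<^sub>c (W x \<star> W y)" using assms al_neq_0[of x y] by (simp add: W_W)
  have "W' y \<star> W' x \<star> (W x \<star> W y) = W' y \<star> (W' x \<star> W x) \<star> W y" by (simp add: mul_assoc)
  also have "\<dots> = e" using assms by (simp add: W'_W W'_e)
  finally have "W' y \<star> W' x \<star> (?c *\<^sub>c W ?xy) = e" by (simp add: W_W assms)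
  then have "W' y \<star> W' x \<star> (?c *\<^sub>c W ?xy) \<star> W' ?xy = W' ?xy" using assms by (simp add: e_W')
  then have "?c *\<^sub>c (W' y \<star> W' x \<star> (W ?xy \<star> W' ?xy)) = W' ?xy" by (simp add: scl_simps mul_assoc)
  then have "W' ?xy = ?c *\<^sub>c (W' y \<star> W' x)" using assms by (simp add: W_W' mul_assoc W'_e)
  then show ?thesis unfolding act_def Wxy using assms al_neq_0[of x y] by (simp add: scl_simps mul_assoc)
qed

lemma ex_\<eta>:
  assumes "x \<in> carrier Q" "a \<in> A"
  shows "\<exists>c. act x (s a) = c *\<^sub>c s (cj x a)"
proof -
  define c where "c = al a x / al x (cj x a)"
  have "W a \<star> W x = c *\<^sub>c (W x \<star> W (cj x a))"
    using assms al_neq_0[of x "cj x a"] by (simp add: W_W mult_cj c_def)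
  then have "act x (W a) = c *\<^sub>c (W' x \<star> W x \<star> W (cj x a))"
    by (simp add: act_def mul_assoc scl_simps)
  then have "act x (W a) = c *\<^sub>c W (cj x a)" using assms by (simp add: W'_W e_W)
  then show ?thesis using assms
    by (auto simp: s_def[of a] act_scale W_eq_s[of "cj x a"] scale_scale)
qed

definition \<eta> where "\<eta> x a = (SOME c. act x (s a) = c *\<^sub>c s (cj x a))"

lemma act_s: "x \<in> carrier Q \<Longrightarrow> a \<in> A \<Longrightarrow> act x (s a) = \<eta> x a *\<^sub>c s (cj x a)"
  unfolding \<eta>_def by (rule someI_ex) (rule ex_\<eta>)

lemma act_e: "x \<in> carrier Q \<Longrightarrow> act x e = e"
  by (simp add: act_def W'_e W'_W)

lemma \<eta>_neq_0: "x \<in> carrier Q \<Longrightarrow> a \<in> A \<Longrightarrow> \<eta> x a \<noteq> 0"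
proof
  assume 1: "x \<in> carrier Q" "a \<in> A" "\<eta> x a = 0"
  then have "act x (s a \<star> s (inv a)) = 0" by (subst act_mul) (auto simp: act_s)
  then show False using 1 e_neq_0 by (simp add: act_e)
qed

lemma cj_\<omega>:
  assumes "x \<in> carrier Q" "a \<in> A" "b \<in> A"
  shows "\<omega> (cj x a) (cj x b) = \<omega> a b"
proof -
  have "act x (s a \<star> s b) = act x (\<omega> a b *\<^sub>c (s b \<star> s a))"
    using assms by (simp add: s_\<omega>[of a b])
  then have "(\<eta> x a * \<eta> x b * \<omega> (cj x a) (cj x b)) *\<^sub>c (s (cj x b) \<star> s (cj x a)) =
     (\<eta> x a * \<eta> x b * \<omega> a b) *\<^sub>c (s (cj x b) \<star> s (cj x a))"
    using assms by (simp add: act_mul act_scale act_s scl_simps s_\<omega>[of "cj x a" "cj x b"] mult_ac)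
  moreover have "s (cj x b) \<star> s (cj x a) \<noteq> 0" using assms by (simp add: s_s \<beta>_neq_0 s_neq_0)
  ultimately show ?thesis using assms by (simp add: \<eta>_neq_0)
qed

lemma cj_\<beta>: "x \<in> carrier Q \<Longrightarrow> a \<in> A \<Longrightarrow> b \<in> A \<Longrightarrow> \<beta> (cj x a) (cj x b) = \<beta> a b"
  by (simp add: \<beta>_def cj_\<omega>)

text \<open>Conjugation by \<open>x\<close> preserves \<open>\<beta>\<close>, so
  \<open>act x\<close> carries the normalised basis to one with the same multiplication rule, and
  the discrepancy between the two is a character of \<open>A\<close>.\<close>

lemma \<eta>_mult:
  assumes "x \<in> carrier Q" "a \<in> A" "b \<in> A"
  shows "\<eta> x (a \<otimes> b) = \<eta> x a * \<eta> x b"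
proof -
  have "act x (s a \<star> s b) = (\<eta> x a * \<eta> x b * \<beta> a b) *\<^sub>c s (cj x (a \<otimes> b))"
    using assms by (subst act_mul) (simp_all add: act_s scl_simps s_s cj_\<beta> cj_mult mult_ac)
  moreover have "act x (s a \<star> s b) = (\<beta> a b * \<eta> x (a \<otimes> b)) *\<^sub>c s (cj x (a \<otimes> b))"
    using assms by (simp add: s_s act_scale act_s scl_simps)
  ultimately show ?thesis using s_neq_0[of "cj x (a \<otimes> b)"] assms \<beta>_neq_0[of a b] by simp
qed

text \<open>Summing over all \<open>c\<close> and \<open>a\<close> shows that some product of \<open>\<chi>\<close> with a character \<open>\<omega> c\<close>
  has nonzero sum, hence is trivial.\<close>

lemma character_eq_\<omega>:
  fixes \<chi> :: "'q \<Rightarrow> complex"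
  assumes nz: "\<And>a. a \<in> A \<Longrightarrow> \<chi> a \<noteq> 0"
    and mult: "\<And>a b. a \<in> A \<Longrightarrow> b \<in> A \<Longrightarrow> \<chi> (a \<otimes> b) = \<chi> a * \<chi> b"
  obtains c where "c \<in> A" "\<And>a. a \<in> A \<Longrightarrow> \<chi> a * \<omega> a c = 1"
proof -
  have "\<chi> \<one> = 1" using mult[of \<one> \<one>] nz[of \<one>] by simp
  have "(\<Sum>c\<in>A. \<Sum>a\<in>A. \<chi> a * \<omega> a c) = (\<Sum>a\<in>A. \<chi> a * (\<Sum>c\<in>A. \<omega> a c))"
    unfolding sum_distrib_left by (rule sum.swap)
  also have "\<dots> = (\<Sum>a\<in>A. if a = \<one> then of_nat (card A) else 0)"
    using \<open>\<chi> \<one> = 1\<close> by (intro sum.cong) (auto simp: sum_\<omega>)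
  also have "\<dots> = of_nat (card A)" using finite_A by (simp add: sum.delta)
  finally have "(\<Sum>c\<in>A. \<Sum>a\<in>A. \<chi> a * \<omega> a c) \<noteq> 0" using card_A_neq_0 by simp
  then obtain c where c: "c \<in> A" "(\<Sum>a\<in>A. \<chi> a * \<omega> a c) \<noteq> 0" by (rule sum.not_neutral_contains_not_neutral)
  have "\<chi> a * \<omega> a c = 1" if "a \<in> A" for a
  proof (rule ccontr)
    assume "\<chi> a * \<omega> a c \<noteq> 1"
    then have "(\<Sum>a\<in>A. \<chi> a * \<omega> a c) = 0"
      by (intro sum_character_eq_0[OF subgroup_A _ that]) (simp_all add: mult \<omega>_mult_left c)
    then show False using c by simp
  qed
  then show thesis using c that by blast
qed

lemma \<omega>_one: "a \<in> A \<Longrightarrow> \<omega> a \<one> = 1"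
  using \<omega>_mult_right[of \<one> \<one> a] \<omega>_neq_0[of a \<one>] by simp

definition H where "H = {x \<in> carrier Q. \<forall>a\<in>A. act x (s a) = s (cj x a)}"

lemma H_I: "x \<in> carrier Q \<Longrightarrow> (\<And>a. a \<in> A \<Longrightarrow> act x (s a) = s (cj x a)) \<Longrightarrow> x \<in> H"
  by (simp add: H_def)

lemma H_carrier [simp]: "x \<in> H \<Longrightarrow> x \<in> carrier Q"
  by (simp add: H_def)

lemma act_H [simp]: "x \<in> H \<Longrightarrow> a \<in> A \<Longrightarrow> act x (s a) = s (cj x a)"
  unfolding H_def by blast

text \<open>Elements of \<open>A\<close> act diagonally on the normalised basis through the
  characters \<open>\<omega> _ b\<close>. By nondegeneracy these are all the characters of
  \<open>A\<close>, each for exactly one \<open>b\<close>; that is what makes the stabiliser a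
  complement.\<close>

lemma act_A:
  assumes "a \<in> A" "b \<in> A"
  shows "act b (s a) = \<omega> a b *\<^sub>c s a"
proof -
  have "act b (s a) = W' b \<star> (s a \<star> W b)" by (simp add: act_def mul_assoc)
  also have "\<dots> = \<omega> a b *\<^sub>c (W' b \<star> W b \<star> s a)"
    using assms by (simp add: W_eq_s[of b] s_\<omega>[of a b] scl_simps mul_assoc mult_ac)
  finally show ?thesis using assms by (simp add: W'_W)
qed

lemma subgroup_H: "subgroup H Q"
proof
  show "\<one> \<in> H" by (rule H_I) (simp_all add: cj_one act_A \<omega>_one)
next
  fix x y assume "x \<in> H" "y \<in> H"
  then show "x \<otimes> y \<in> H"
    by (intro H_I) (simp_all add: act_act[symmetric] cj_cj[symmetric])
next
  fix x assume x: "x \<in> H"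
  have "act (inv x) (s a) = s (cj (inv x) a)" if a: "a \<in> A" for a
  proof -
    have "s a = act x (s (cj (inv x) a))" using x a by (simp add: cj_cj cj_one)
    then have "act (inv x) (s a) = act \<one> (s (cj (inv x) a))" using x by (simp add: act_act)
    then show ?thesis using x a by (simp add: act_A \<omega>_one)
  qed
  then show "inv x \<in> H" using x by (intro H_I) simp_all
qed auto

text \<open>An element \<open>c\<close> of both fixes each \<open>s b\<close> and also multiplies it
  by \<open>\<omega> b c\<close>, so it lies in the radical of the form.\<close>

lemma H_inter_A: "H \<inter> A = {\<one>}"
proof -
  have "c = \<one>" if c: "c \<in> H" "c \<in> A" for c
  proof (rule ccontr)
    assume "c \<noteq> \<one>"
    then obtain b where b: "b \<in> A" "\<omega> c b \<noteq> 1" using c \<omega>_nondegenerate by blast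
    have "s b = \<omega> b c *\<^sub>c s b" using act_A[of b c] act_H[of c b] b c by (simp add: cj_self)
    then have "\<omega> b c = 1" using s_neq_0[OF b(1)] by (metis scale_cancel_right scale_one)
    then show False using b \<omega>_swap[of c b] by simp
  qed
  then show ?thesis using subgroup.one_closed[OF subgroup_H] A_closed(3) by blast
qed

text \<open>The discrepancy \<open>\<eta> x\<close> is a character, hence cancelled by the action of
  some \<open>c\<close> in \<open>A\<close>; then \<open>x \<otimes> c\<close> stabilises the
  basis.\<close>

lemma H_A_decompose:
  assumes x: "x \<in> carrier Q"
  obtains h a where "h \<in> H" "a \<in> A" "x = h \<otimes> a"
proof -
  \<comment> \<open>\<open>act x\<close> moves the label \<open>a\<close> to \<open>cj x a\<close>
    before \<open>c\<close> acts, so the discrepancy is rewritten as a function of the moved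
    label.\<close>
  define \<chi> where "\<chi> b = \<eta> x (cj (inv x) b)" for b
  obtain c where c: "c \<in> A" "\<And>b. b \<in> A \<Longrightarrow> \<chi> b * \<omega> b c = 1"
  proof (rule character_eq_\<omega>[of \<chi>])
    fix a b assume "a \<in> A" "b \<in> A"
    then show "\<chi> a \<noteq> 0" "\<chi> (a \<otimes> b) = \<chi> a * \<chi> b"
      using x by (simp_all add: \<chi>_def \<eta>_neq_0 cj_mult \<eta>_mult)
  qed blast
  have "act (x \<otimes> c) (s a) = s (cj (x \<otimes> c) a)" if a: "a \<in> A" for a
  proof -
    have "act (x \<otimes> c) (s a) = (\<eta> x a * \<omega> (cj x a) c) *\<^sub>c s (cj x a)"
      using x c a by (subst act_act[symmetric]) (simp_all add: act_s[OF x] act_scale act_A scl_simps)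
    moreover have "\<chi> (cj x a) = \<eta> x a" using x a by (simp add: \<chi>_def cj_cj cj_one)
    ultimately show ?thesis using c(2)[of "cj x a"] x a c(1)
      by (simp add: cj_cj[symmetric] cj_self)
  qed
  then have "x \<otimes> c \<in> H" using x c by (intro H_I) simp_all
  moreover have "x = (x \<otimes> c) \<otimes> inv c" using x c by (simp add: m_assoc)
  ultimately show thesis using c that by (metis A_closed(2))
qed

text \<open>Goodness in abstract form: such an \<open>x\<close> fixes the label \<open>a\<close>,
  hence \<open>s a\<close> itself and not merely the line through it, hence commutes with
  \<open>W a\<close>.\<close>

lemma H_commute:
  assumes "x \<in> H" "a \<in> A" "x \<otimes> a = a \<otimes> x"
  shows "W x \<star> W a = W a \<star> W x"
proof -
  have "cj x a = a" using assms by (simp add: cj_def m_assoc) (simp add: m_assoc[symmetric] flip: assms(3))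
  then have "act x (s a) = s a" using assms by simp
  then have "act x (W a) = W a" using assms by (simp add: W_eq_s act_scale)
  then have "W x \<star> act x (W a) = W x \<star> W a" by simp
  moreover have "W x \<star> act x (W a) = W x \<star> W' x \<star> W a \<star> W x" by (simp add: act_def mul_assoc)
  ultimately show ?thesis using assms by (simp add: W_W' e_W)
qed

subsection \<open>The intertwining elements\<close>

text \<open>The averaging intertwiner, as in the proof of Maschke's theorem, between the relabelled
  bases \<open>s (p a)\<close> and \<open>s (q a)\<close>.\<close>

definition T where "T p q = (\<Sum>a\<in>A. s (inv (p a)) \<star> s (q a))"

text \<open>Relabellings under which the basis keeps its multiplication rule; they are applied as
  the identity and as the conjugations \<open>cj x\<close>.\<close>

definition admissible where
  "admissible p \<longleftrightarrow> (\<forall>a\<in>A. p a \<in> A \<and> (\<forall>b\<in>A. p (a \<otimes> b) = p a \<otimes> p b \<and> \<beta> (p a) (p b) = \<beta> a b))"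

lemma admissible_cj: "x \<in> carrier Q \<Longrightarrow> admissible (cj x)"
  by (simp add: admissible_def cj_mult cj_\<beta>)

lemma admissible_id: "admissible (\<lambda>a. a)"
  by (simp add: admissible_def)

text \<open>Replacing \<open>a\<close> by \<open>b \<otimes> a\<close> splits off
  \<open>s (inv (p b))\<close> on the left and \<open>s (q b)\<close> on the right. The two factors
  \<open>\<beta>\<close> that arise cancel because \<open>p\<close> and \<open>q\<close> both
  preserve \<open>\<beta>\<close>.\<close>

lemma T_intertwines:
  assumes "admissible p" "admissible q" "b \<in> A"
  shows "s (p b) \<star> T p q = T p q \<star> s (q b)"
proof -
  have "s (p b) \<star> T p q = s (p b) \<star> (\<Sum>a\<in>A. s (inv (p (b \<otimes> a))) \<star> s (q (b \<otimes> a)))"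
    unfolding T_def using sum_left_translate[OF subgroup_A \<open>b \<in> A\<close>, of "\<lambda>a. s (inv (p a)) \<star> s (q a)"]
    by simp
  also have "\<dots> = (\<Sum>a\<in>A. s (inv (p a)) \<star> s (q a) \<star> s (q b))"
    unfolding mul_sum
  proof (rule sum.cong[OF refl])
    fix a assume a: "a \<in> A"
    have pq: "p a \<in> A" "p b \<in> A" "q a \<in> A" "q b \<in> A" "p (a \<otimes> b) = p a \<otimes> p b" "q (a \<otimes> b) = q a \<otimes> q b"
      "\<beta> (p a) (p b) = \<beta> a b" "\<beta> (q a) (q b) = \<beta> a b"
      using assms a by (auto simp: admissible_def)
    have "s (p b) \<star> (s (inv (p (b \<otimes> a))) \<star> s (q (b \<otimes> a))) =
      s (p b) \<star> s (inv (p b)) \<star> s (inv (p a)) \<star> s (q a) \<star> s (q b)"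
      using a assms(3) pq \<beta>_neq_0[of a b]
      by (simp add: A_comm[of b a] s_inv_mult s_mult scl_simps mul_assoc del: s_inv)
    then show "s (p b) \<star> (s (inv (p (b \<otimes> a))) \<star> s (q (b \<otimes> a))) = s (inv (p a)) \<star> s (q a) \<star> s (q b)"
      using pq by simp
  qed
  finally show ?thesis by (simp add: T_def sum_mul)
qed

lemma T_Sp: "admissible p \<Longrightarrow> admissible q \<Longrightarrow> T p q \<in> Sp"
  unfolding T_def by (intro Sp_sum Sp_mul) (auto simp: admissible_def)

definition Tx where "Tx x = T (\<lambda>a. a) (cj x)"

definition Tx' where "Tx' x = T (cj x) (\<lambda>a. a)"

lemma Tx_intertwines: "x \<in> carrier Q \<Longrightarrow> b \<in> A \<Longrightarrow> s b \<star> Tx x = Tx x \<star> s (cj x b)"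
  unfolding Tx_def using T_intertwines[OF admissible_id admissible_cj] by simp

lemma Tx'_intertwines: "x \<in> carrier Q \<Longrightarrow> b \<in> A \<Longrightarrow> s (cj x b) \<star> Tx' x = Tx' x \<star> s b"
  unfolding Tx'_def using T_intertwines[OF admissible_cj admissible_id] by simp

lemma Tx_Sp [simp]: "x \<in> carrier Q \<Longrightarrow> Tx x \<in> Sp" and Tx'_Sp [simp]: "x \<in> carrier Q \<Longrightarrow> Tx' x \<in> Sp"
  unfolding Tx_def Tx'_def by (auto intro!: T_Sp admissible_id admissible_cj)

text \<open>The order of \<open>A\<close> times the order of the centraliser of \<open>x\<close> in
  \<open>A\<close>. It is the multiple of \<open>e\<close> to which \<open>Tx x\<close> and
  \<open>Tx' x\<close> multiply in either order, so \<open>Tx' x\<close> serves as inverse of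
  \<open>Tx x\<close> up to this factor.\<close>

definition NF :: "'q \<Rightarrow> complex" where "NF x = of_nat (card A) * of_nat (card {a \<in> A. cj x a = a})"

lemma NF_neq_0: "x \<in> carrier Q \<Longrightarrow> NF x \<noteq> 0"
proof -
  assume "x \<in> carrier Q"
  then have "\<one> \<in> {a \<in> A. cj x a = a}" by (simp add: cj_def)
  then have "card {a \<in> A. cj x a = a} \<noteq> 0" using finite_A by (metis (no_types, lifting) card_eq_0_iff empty_iff finite_subset mem_Collect_eq subsetI)
  then show ?thesis using card_A_neq_0 by (simp add: NF_def)
qed

text \<open>Averaging kills \<open>s (inv (cj x a)) \<star> s a\<close> unless
  \<open>cj x a = a\<close>, and each fixed \<open>a\<close> contributes \<open>card A\<close> times
  \<open>e\<close>.\<close>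

lemma avg_Tx':
  assumes x: "x \<in> carrier Q"
  shows "avg (Tx' x) = NF x *\<^sub>c e"
proof -
  have "avg (Tx' x) = (\<Sum>a\<in>A. avg (s (inv (cj x a)) \<star> s a))"
    unfolding Tx'_def T_def by (rule avg_sum)
  also have "\<dots> = (\<Sum>a\<in>A. (if cj x a = a then of_nat (card A) else 0) *\<^sub>c e)"
  proof (rule sum.cong[OF refl])
    fix a assume a: "a \<in> A"
    show "avg (s (inv (cj x a)) \<star> s a) = (if cj x a = a then of_nat (card A) else 0) *\<^sub>c e"
    proof (cases "cj x a = a")
      case True
      then show ?thesis using a avg_s[of \<one>] by (simp add: s_one)
    next
      case False
      then have "inv (cj x a) \<otimes> a \<noteq> \<one>" using x a inv_equality[of "inv (cj x a)" a] inv_inv[of "cj x a"]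
        by (metis A_carrier A_closed(2) cj_A inv_equality inv_inv)
      then show ?thesis using False x a by (simp add: s_s avg_scale avg_s)
    qed
  qed
  also have "\<dots> = (\<Sum>a\<in>A. if cj x a = a then of_nat (card A) else 0) *\<^sub>c e"
    by (simp add: scale_sum_left)
  also have "(\<Sum>a\<in>A. if cj x a = a then of_nat (card A) else (0::complex)) = NF x"
    using finite_A by (simp add: sum.If_cases NF_def Int_def mult.commute)
  finally show ?thesis .
qed

text \<open>Intertwining pushes \<open>Tx' x\<close> between \<open>s (inv a)\<close> and
  \<open>s a\<close>, which turns the product into an average.\<close>

lemma Tx_Tx':
  assumes x: "x \<in> carrier Q"
  shows "Tx x \<star> Tx' x = NF x *\<^sub>c e"
proof -
  have "Tx x \<star> Tx' x = (\<Sum>a\<in>A. s (inv a) \<star> (s (cj x a) \<star> Tx' x))"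
    unfolding Tx_def T_def by (simp add: sum_mul mul_assoc)
  also have "\<dots> = avg (Tx' x)" unfolding avg_def using x by (simp add: Tx'_intertwines mul_assoc)
  finally show ?thesis using avg_Tx'[OF x] by simp
qed

lemma Tx'_Tx:
  assumes x: "x \<in> carrier Q"
  shows "Tx' x \<star> Tx x = NF x *\<^sub>c e"
proof -
  have "Tx' x \<star> Tx x = (\<Sum>a\<in>A. Tx' x \<star> s (inv a) \<star> s (cj x a))"
    unfolding Tx_def T_def by (simp add: mul_sum mul_assoc)
  also have "\<dots> = (\<Sum>a\<in>A. s (inv (cj x a)) \<star> Tx' x \<star> s (cj x a))"
    using x by (intro sum.cong) (auto simp: Tx'_intertwines[symmetric] cj_inv)
  also have "\<dots> = avg (Tx' x)" unfolding avg_def by (rule sum.reindex_bij_betw[OF bij_cj[OF x]])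
  finally show ?thesis using avg_Tx'[OF x] by simp
qed

lemma Tx_act:
  assumes "x \<in> H" "v \<in> Sp"
  shows "v \<star> Tx x = Tx x \<star> act x v"
  using assms(2)
proof (induction rule: Sp_induct)
  case (basis a)
  then show ?case using assms(1) by (simp add: Tx_intertwines)
qed (auto simp: act_add act_scale mul_add_left mul_add_right scl_simps)

text \<open>Both sides intertwine the same two relabelled bases. Composing the left side with
  \<open>Tx' (x \<otimes> y)\<close> gives an element commuting with every \<open>s b\<close>, hence
  a scalar, which is nonzero because all factors are units.\<close>

lemma Tx_Tx:
  assumes x: "x \<in> carrier Q" "y \<in> carrier Q"
  obtains \<kappa> where "\<kappa> \<noteq> 0" "Tx x \<star> Tx y = \<kappa> *\<^sub>c Tx (x \<otimes> y)"
proof -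
  let ?xy = "x \<otimes> y"
  have xy: "?xy \<in> carrier Q" using x by simp
  have "s b \<star> (Tx x \<star> Tx y \<star> Tx' ?xy) = Tx x \<star> Tx y \<star> Tx' ?xy \<star> s b" if b: "b \<in> A" for b
  proof -
    have "s b \<star> (Tx x \<star> Tx y \<star> Tx' ?xy) = Tx x \<star> (s (cj x b) \<star> Tx y) \<star> Tx' ?xy"
      using x b Tx_intertwines[of x b] by (simp add: mul_assoc[symmetric])
    also have "\<dots> = Tx x \<star> Tx y \<star> (s (cj ?xy b) \<star> Tx' ?xy)"
      using x b Tx_intertwines[of y "cj x b"] by (simp add: mul_assoc cj_cj)
    also have "\<dots> = Tx x \<star> Tx y \<star> Tx' ?xy \<star> s b"
      using xy b Tx'_intertwines[of ?xy b] by (simp add: mul_assoc)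
    finally show ?thesis .
  qed
  then obtain \<kappa> where \<kappa>: "Tx x \<star> Tx y \<star> Tx' ?xy = \<kappa> *\<^sub>c e"
    using central_scalar[of "Tx x \<star> Tx y \<star> Tx' ?xy"] x xy by (metis Sp_mul Tx_Sp Tx'_Sp)
  have "\<kappa> *\<^sub>c Tx ?xy = Tx x \<star> Tx y \<star> (Tx' ?xy \<star> Tx ?xy)"
    using \<kappa> xy by (simp add: mul_assoc[symmetric] scl_simps Sp_e)
  also have "\<dots> = NF ?xy *\<^sub>c (Tx x \<star> Tx y)" using x xy by (simp add: Tx'_Tx scl_simps Sp_e Sp_mul)
  finally have 1: "Tx x \<star> Tx y = (\<kappa> / NF ?xy) *\<^sub>c Tx ?xy"
    using NF_neq_0[OF xy] by (metis divide_inverse mult.commute right_inverse scale_one scale_scale)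
  have "\<kappa> \<noteq> 0"
  proof
    assume "\<kappa> = 0"
    then have "Tx x \<star> Tx y \<star> Tx' y = 0" using 1 by simp
    then have "NF y *\<^sub>c Tx x = 0" using x by (simp add: mul_assoc Tx_Tx' scl_simps Sp_e)
    then have "Tx x = 0" using NF_neq_0 x by simp
    then show False using Tx_Tx'[OF x(1)] NF_neq_0[OF x(1)] e_neq_0 by (simp add: scale_eq_0_iff)
  qed
  then show thesis using 1 that[of "\<kappa> / NF ?xy"] NF_neq_0[OF xy] by simp
qed

subsection \<open>The canonical involution\<close>

definition Z where "Z = (\<Sum>a\<in>A. s a)"

lemma Z_Sp: "Z \<in> Sp"
  unfolding Z_def by (intro Sp_sum) simp

text \<open>With \<open>a = inv b \<otimes> c\<close> each product \<open>s a \<star> s b\<close>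
  collapses to \<open>\<beta> c b *\<^sub>c s c\<close>, and orthogonality in \<open>b\<close>
  leaves only \<open>c = \<one>\<close>.\<close>

lemma Z_square: "Z \<star> Z = of_nat (card A) *\<^sub>c e"
proof -
  have "Z \<star> Z = (\<Sum>b\<in>A. \<Sum>a\<in>A. s a \<star> s b)" unfolding Z_def sum_mul mul_sum by (rule sum.swap refl)
  also have "\<dots> = (\<Sum>b\<in>A. \<Sum>c\<in>A. \<beta> c b *\<^sub>c s c)"
  proof (rule sum.cong[OF refl])
    fix b assume b: "b \<in> A"
    have "(\<Sum>a\<in>A. s a \<star> s b) = (\<Sum>c\<in>A. s (inv b \<otimes> c) \<star> s b)"
      using sum_left_translate[OF subgroup_A, of "inv b" "\<lambda>a. s a \<star> s b"] b by simp
    also have "\<dots> = (\<Sum>c\<in>A. \<beta> c b *\<^sub>c s c)"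
    proof (rule sum.cong[OF refl])
      fix c assume c: "c \<in> A"
      have "s (inv b \<otimes> c) \<star> s b = \<beta> c b *\<^sub>c (s c \<star> (s (inv b) \<star> s b))"
        using b c \<beta>_neq_0[of c b]
        by (simp add: A_comm[of "inv b" c] s_mult[of c "inv b"] \<beta>_inv_right scl_simps mul_assoc del: s_inv)
      then show "s (inv b \<otimes> c) \<star> s b = \<beta> c b *\<^sub>c s c" using b c by simp
    qed
    finally show "(\<Sum>a\<in>A. s a \<star> s b) = (\<Sum>c\<in>A. \<beta> c b *\<^sub>c s c)" .
  qed
  also have "\<dots> = (\<Sum>c\<in>A. (\<Sum>b\<in>A. \<beta> c b) *\<^sub>c s c)"
    unfolding scale_sum_left by (rule sum.swap)
  also have "\<dots> = (\<Sum>c\<in>A. if c = \<one> then of_nat (card A) *\<^sub>c e else 0)"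
    by (intro sum.cong) (auto simp: sum_\<beta> s_one)
  also have "\<dots> = of_nat (card A) *\<^sub>c e" using finite_A by (simp add: sum.delta)
  finally show ?thesis .
qed

lemma Z_Tx: "x \<in> carrier Q \<Longrightarrow> Z \<star> Tx x = Tx x \<star> Z"
proof -
  assume x: "x \<in> carrier Q"
  have "Z \<star> Tx x = (\<Sum>a\<in>A. Tx x \<star> s (cj x a))" using x by (simp add: Z_def sum_mul Tx_intertwines)
  also have "\<dots> = Tx x \<star> Z" unfolding Z_def mul_sum by (rule sum.reindex_bij_betw[OF bij_cj[OF x]])
  finally show ?thesis .
qed

text \<open>These units preserve the eigenspaces of \<open>Z\<close>, so the determinants on the
  eigenspaces are multiplicative on them.\<close>

definition C where "C = {u \<in> Sp. u \<star> Z = Z \<star> u \<and> (\<exists>u'\<in>Sp. u \<star> u' = e \<and> u' \<star> u = e)}"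

lemma Tx_C: "x \<in> carrier Q \<Longrightarrow> Tx x \<in> C"
  unfolding C_def using Z_Tx[of x] NF_neq_0[of x]
  by (auto intro!: bexI[of _ "(1 / NF x) *\<^sub>c Tx' x"] simp: scl_simps Tx_Tx' Tx'_Tx Sp_scale)

text \<open>If \<open>Tx x \<star> Tx y = \<kappa> *\<^sub>c Tx (x \<otimes> y)\<close>, then
  \<open>D (Tx x) * D (Tx y) = \<kappa> * D (Tx (x \<otimes> y))\<close>, so dividing by
  \<open>D\<close> removes \<open>\<kappa>\<close>. The functional stays abstract here because its
  construction uses the matrices of a representation of \<open>K\<close>.\<close>

theorem magic_from_determinant:
  assumes D_mult: "\<And>u v. u \<in> C \<Longrightarrow> v \<in> C \<Longrightarrow> D (u \<star> v) = D u * D v"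
    and D_scale: "\<And>c u. u \<in> C \<Longrightarrow> c \<noteq> 0 \<Longrightarrow> D (c *\<^sub>c u) = c * D u"
    and D_neq_0: "\<And>u. u \<in> C \<Longrightarrow> D u \<noteq> (0::complex)"
  obtains \<sigma> \<sigma>' where
    "\<And>x. x \<in> H \<Longrightarrow> \<sigma> x \<in> Sp \<and> \<sigma>' x \<in> Sp \<and> \<sigma> x \<star> \<sigma>' x = e \<and> \<sigma>' x \<star> \<sigma> x = e"
    "\<And>x y. x \<in> H \<Longrightarrow> y \<in> H \<Longrightarrow> \<sigma> (x \<otimes> y) = \<sigma> x \<star> \<sigma> y"
    "\<And>x v. x \<in> H \<Longrightarrow> v \<in> Sp \<Longrightarrow> act x v = \<sigma>' x \<star> v \<star> \<sigma> x"
proof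
  define \<sigma> where "\<sigma> x = (1 / D (Tx x)) *\<^sub>c Tx x" for x
  define \<sigma>' where "\<sigma>' x = (D (Tx x) / NF x) *\<^sub>c Tx' x" for x
  note nz = NF_neq_0 D_neq_0[OF Tx_C]
  have inv1: "\<sigma> x \<star> \<sigma>' x = e" "\<sigma>' x \<star> \<sigma> x = e" if "x \<in> H" for x
    using that nz[of x] by (simp_all add: \<sigma>_def \<sigma>'_def scl_simps Tx_Tx' Tx'_Tx)
  then show "\<sigma> x \<in> Sp \<and> \<sigma>' x \<in> Sp \<and> \<sigma> x \<star> \<sigma>' x = e \<and> \<sigma>' x \<star> \<sigma> x = e" if "x \<in> H" for x
    using that by (simp add: \<sigma>_def \<sigma>'_def Sp_scale)
  show "\<sigma> (x \<otimes> y) = \<sigma> x \<star> \<sigma> y" if "x \<in> H" "y \<in> H" for x y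
  proof -
    have xy: "x \<in> carrier Q" "y \<in> carrier Q" "x \<otimes> y \<in> carrier Q" using that by auto
    obtain \<kappa> where \<kappa>: "\<kappa> \<noteq> 0" "Tx x \<star> Tx y = \<kappa> *\<^sub>c Tx (x \<otimes> y)" using Tx_Tx xy by blast
    then have "D (Tx x) * D (Tx y) = \<kappa> * D (Tx (x \<otimes> y))"
      using xy by (metis D_mult D_scale Tx_C)
    then show ?thesis using \<kappa> nz xy by (simp add: \<sigma>_def scl_simps field_simps)
  qed
  show "act x v = \<sigma>' x \<star> v \<star> \<sigma> x" if "x \<in> H" "v \<in> Sp" for x v
  proof -
    have "\<sigma>' x \<star> v \<star> \<sigma> x = \<sigma>' x \<star> (\<sigma> x \<star> act x v)"
      using Tx_act[OF that] by (simp add: \<sigma>_def scl_simps mul_assoc)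
    also have "\<dots> = e \<star> act x v" using inv1 that by (simp add: mul_assoc[symmetric])
    also have "\<dots> = act x v" using that by (simp add: act_def mul_assoc[symmetric] e_W')
    finally show ?thesis by simp
  qed
qed

end

section \<open>Complex matrices\<close>

definition mtr :: "complex mat \<Rightarrow> complex" where "mtr A = (\<Sum>i<dim_row A. A $$ (i, i))"

lemma mtr_mult_sum:
  assumes "A \<in> carrier_mat n n" "B \<in> carrier_mat n n"
  shows "mtr (A * B) = (\<Sum>i<n. \<Sum>j<n. A $$ (i, j) * B $$ (j, i))"
  using assms by (auto simp: mtr_def scalar_prod_def lessThan_atLeast0 intro!: sum.cong)

lemma mtr_comm:
  assumes "A \<in> carrier_mat n n" "B \<in> carrier_mat n n"
  shows "mtr (A * B) = mtr (B * A)"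
  using assms unfolding mtr_mult_sum[OF assms] mtr_mult_sum[OF assms(2,1)]
  by (subst sum.swap) (simp add: mult.commute)

lemma mtr_add: "A \<in> carrier_mat n n \<Longrightarrow> B \<in> carrier_mat n n \<Longrightarrow> mtr (A + B) = mtr A + mtr B"
  by (simp add: mtr_def sum.distrib)

lemma mtr_smult: "A \<in> carrier_mat n n \<Longrightarrow> mtr (c \<cdot>\<^sub>m A) = c * mtr A"
  by (simp add: mtr_def sum_distrib_left)

lemma mtr_one: "mtr (1\<^sub>m n) = of_nat n"
  by (simp add: mtr_def)

lemma similar_upper_triangular:
  fixes A :: "complex mat"
  assumes A: "A \<in> carrier_mat n n"
  obtains B P Q where "B \<in> carrier_mat n n" "P \<in> carrier_mat n n" "Q \<in> carrier_mat n n"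
    "P * Q = 1\<^sub>m n" "Q * P = 1\<^sub>m n" "A = P * B * Q" "upper_triangular B"
proof -
  obtain es where es: "char_poly A = (\<Prod>a\<leftarrow>es. [:- a, 1:])" using char_poly_factorized[OF A] by blast
  obtain B P Q where BPQ: "schur_decomposition A es = (B, P, Q)" by (metis prod_cases3)
  have "similar_mat_wit A B P Q" "upper_triangular B"
    using schur_decomposition[OF A es BPQ] by blast+
  then show thesis using that similar_mat_witD2[OF A] by metis
qed

lemma upper_triangular_mult:
  fixes A B :: "complex mat"
  assumes AB: "A \<in> carrier_mat n n" "B \<in> carrier_mat n n" and ut: "upper_triangular A" "upper_triangular B"
  shows "upper_triangular (A * B)" and "i < n \<Longrightarrow> (A * B) $$ (i, i) = A $$ (i, i) * B $$ (i, i)"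
proof -
  have A0: "A $$ (i, j) = 0" if "j < i" "i < n" for i j using ut(1) that AB by auto
  have B0: "B $$ (i, j) = 0" if "j < i" "i < n" for i j using ut(2) that AB by auto
  have ent: "(A * B) $$ (i, j) = (\<Sum>k<n. A $$ (i, k) * B $$ (k, j))" if "i < n" "j < n" for i j
    using AB that by (simp add: scalar_prod_def lessThan_atLeast0)
  have "(A * B) $$ (i, j) = 0" if "j < i" "i < n" for i j
  proof -
    have "A $$ (i, k) * B $$ (k, j) = 0" if "k < n" for k
      using A0[of k i] B0[of j k] that \<open>j < i\<close> \<open>i < n\<close> by (cases "k < i") auto
    then have "(\<Sum>k<n. A $$ (i, k) * B $$ (k, j)) = 0" by (intro sum.neutral) blast
    then show ?thesis using that ent[of i j] by simp
  qed
  then show "upper_triangular (A * B)" using AB by auto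
  show "(A * B) $$ (i, i) = A $$ (i, i) * B $$ (i, i)" if i: "i < n"
  proof -
    have "A $$ (i, k) * B $$ (k, i) = (if k = i then A $$ (i, i) * B $$ (i, i) else 0)" if "k < n" for k
      using A0[of k i] B0[of i k] that i by (cases k i rule: linorder_cases) auto
    then have "(\<Sum>k<n. A $$ (i, k) * B $$ (k, i)) = (\<Sum>k<n. if k = i then A $$ (i, i) * B $$ (i, i) else 0)"
      by (intro sum.cong) auto
    then show ?thesis unfolding ent[OF i i] using i by simp
  qed
qed

lemma mult_cancel_conj:
  fixes U V X :: "complex mat"
  assumes "U \<in> carrier_mat n n" "V \<in> carrier_mat n n" "U * V = 1\<^sub>m n" "X \<in> carrier_mat n n"
  shows "U * (V * X * U) * V = X"
proof -
  have "U * (V * X * U) * V = (U * V) * X * (U * V)"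
    using assms(1,2,4) by (simp add: assoc_mult_mat[of _ n n _ n _ n])
  then show ?thesis using assms by simp
qed

text \<open>In triangular form the diagonal of an idempotent consists of zeros and ones. The number
  of ones is the trace, and also the exponent of \<open>c\<close>, since \<open>c\<close> is the
  scalar on the image and 1 the one on the kernel.\<close>

lemma det_idempotent:
  fixes P :: "complex mat"
  assumes P: "P \<in> carrier_mat n n" and idem: "P * P = P"
  obtains k :: nat where "mtr P = of_nat k" "\<And>c. det (c \<cdot>\<^sub>m P + (1\<^sub>m n - P)) = c ^ k"
proof -
  obtain B V U where B: "B \<in> carrier_mat n n" and V: "V \<in> carrier_mat n n" and U: "U \<in> carrier_mat n n"
    and VU: "V * U = 1\<^sub>m n" and UV: "U * V = 1\<^sub>m n" and PB: "P = V * B * U" and ut: "upper_triangular B"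
    using similar_upper_triangular[OF P] by blast
  note conj = mult_cancel_conj[OF U V UV]
  have "V * B * U * (V * B * U) = V * (B * (U * V) * B) * U"
    using U V B by (simp add: assoc_mult_mat[of _ n n _ n _ n])
  then have "V * (B * B) * U = V * B * U" using idem B by (simp add: PB UV)
  then have BB: "B * B = B" using conj[of B] conj[of "B * B"] B by simp
  have b: "B $$ (i, i) = 0 \<or> B $$ (i, i) = 1" if "i < n" for i
    using upper_triangular_mult(2)[OF B B ut ut that] BB by auto
  define k where "k = card {i. i < n \<and> B $$ (i, i) = 1}"
  have "mtr P = mtr (U * (V * B))" unfolding PB using mtr_comm[of "V * B" n U] U V B by simp
  also have "U * (V * B) = B" using assoc_mult_mat[OF U V B] UV B by simp
  also have "mtr B = (\<Sum>i<n. if B $$ (i, i) = 1 then 1 else 0)"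
    unfolding mtr_def
  proof (rule sum.cong)
    fix i assume "i \<in> {..<n}"
    then show "B $$ (i, i) = (if B $$ (i, i) = 1 then 1 else 0)" using b[of i] by auto
  qed (use B in simp)
  also have "\<dots> = of_nat k" by (simp add: k_def sum.If_cases Collect_conj_eq lessThan_def)
  finally have tr: "mtr P = of_nat k" .
  have "det (c \<cdot>\<^sub>m P + (1\<^sub>m n - P)) = c ^ k" for c
  proof -
    define X where "X = c \<cdot>\<^sub>m B + (1\<^sub>m n - B)"
    have X: "X \<in> carrier_mat n n" using B by (simp add: X_def minus_carrier_mat)
    have "V * X * U = c \<cdot>\<^sub>m P + (1\<^sub>m n - P)"
    proof -
      have VB: "V * B \<in> carrier_mat n n" using V B by simp
      have "V * X = V * (c \<cdot>\<^sub>m B) + V * (1\<^sub>m n - B)"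
        unfolding X_def using B by (intro mult_add_distrib_mat[OF V]) (auto simp: minus_carrier_mat)
      also have "\<dots> = c \<cdot>\<^sub>m (V * B) + (V - V * B)"
        using mult_smult_distrib[OF V B] mult_minus_distrib_mat[OF V one_carrier_mat B] V by simp
      finally have "V * X * U = c \<cdot>\<^sub>m (V * B) * U + (V - V * B) * U"
        using add_mult_distrib_mat[OF _ _ U, of "c \<cdot>\<^sub>m (V * B)" n "V - V * B"] VB
        by (simp add: minus_carrier_mat)
      also have "\<dots> = c \<cdot>\<^sub>m P + (1\<^sub>m n - P)"
        using mult_smult_assoc_mat[OF VB U] minus_mult_distrib_mat[OF V VB U] by (simp add: PB VU)
      finally show ?thesis .
    qed
    then have "det (c \<cdot>\<^sub>m P + (1\<^sub>m n - P)) = det V * det X * det U"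
      using det_mult[of "V * X" n U] det_mult[of V n X] V X U by simp
    also have "\<dots> = det X * det (V * U)" using det_mult[OF V U] by simp
    also have "\<dots> = det X" by (simp add: VU)
    also have "upper_triangular X"
    proof (rule upper_triangularI)
      fix i j assume "j < i" "i < dim_row X"
      then show "X $$ (i, j) = 0" using upper_triangularD[OF ut, of j i] B by (simp add: X_def)
    qed
    then have "det X = prod_list (diag_mat X)" by (rule det_upper_triangular[OF _ X])
    also have "\<dots> = (\<Prod>i<n. X $$ (i, i))" using X by (simp add: prod_list_diag_prod lessThan_atLeast0)
    also have "\<dots> = (\<Prod>i<n. if B $$ (i, i) = 1 then c else 1)"
    proof (rule prod.cong[OF refl])
      fix i assume "i \<in> {..<n}"
      then show "X $$ (i, i) = (if B $$ (i, i) = 1 then c else 1)" using b[of i] B by (auto simp: X_def)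
    qed
    also have "\<dots> = c ^ k" by (simp add: k_def prod.If_cases Collect_conj_eq lessThan_def)
    finally show ?thesis .
  qed
  then show thesis using tr that by blast
qed

text \<open>The diagonal entries of a triangular form of \<open>M\<close> are roots of unity.\<close>

lemma mtr_inverse_finite_order:
  assumes M: "M \<in> carrier_mat n n" and N: "N \<in> carrier_mat n n" and MN: "M * N = 1\<^sub>m n"
    and pow: "M ^\<^sub>m r = 1\<^sub>m n" "0 < r"
  shows "mtr N = cnj (mtr M)"
proof -
  obtain B V U where B: "B \<in> carrier_mat n n" and V: "V \<in> carrier_mat n n" and U: "U \<in> carrier_mat n n"
    and VU: "V * U = 1\<^sub>m n" and UV: "U * V = 1\<^sub>m n" and MB: "M = V * B * U" and ut: "upper_triangular B"
    using similar_upper_triangular[OF M] by blast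
  have Bk: "upper_triangular (B ^\<^sub>m k) \<and> (\<forall>i<n. (B ^\<^sub>m k) $$ (i, i) = B $$ (i, i) ^ k)" for k
  proof (induction k)
    case 0
    then show ?case using B by auto
  next
    case (Suc k)
    then show ?case using upper_triangular_mult[of "B ^\<^sub>m k" n B] ut B by simp
  qed
  have Mk: "M ^\<^sub>m k = V * B ^\<^sub>m k * U" for k
  proof (induction k)
    case 0
    then show ?case using M B V by (simp add: VU)
  next
    case (Suc k)
    have "V * X * U * (V * B * U) = V * (X * (U * V) * B) * U" if "X \<in> carrier_mat n n" for X
      using U V B that by (simp add: assoc_mult_mat[of _ n n _ n _ n])
    from this[of "B ^\<^sub>m k"] have "V * B ^\<^sub>m k * U * (V * B * U) = V * (B ^\<^sub>m k * (U * V) * B) * U"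
      using B by simp
    then show ?case using Suc B by (simp add: MB UV)
  qed
  note BU = mult_cancel_conj[OF U V UV]
  have "B ^\<^sub>m r = U * 1\<^sub>m n * V" using BU[of "B ^\<^sub>m r"] B Mk[of r] pow by simp
  then have "B ^\<^sub>m r = 1\<^sub>m n" using U V UV by simp
  then have b: "B $$ (i, i) ^ r = 1" if "i < n" for i using Bk[of r] that by auto
  have mtr_V: "mtr (V * X * U) = mtr X" if X: "X \<in> carrier_mat n n" for X
    using mtr_comm[of "V * X" n U] assoc_mult_mat[OF U V X] UV V X U by simp
  \<comment> \<open>The inverse is \<open>M ^\<^sub>m (r - 1)\<close>, so its trace sums the powers
    \<open>r - 1\<close> of the eigenvalues, which for \<open>r\<close>-th roots of unity are their
    conjugates.\<close>
  obtain r' where r': "r = Suc r'" using pow(2) by (cases r) auto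
  have "N = (M ^\<^sub>m r' * M) * N" using pow(1) N by (simp add: r')
  also have "\<dots> = M ^\<^sub>m r'" using M N MN by (simp add: assoc_mult_mat[of _ n n _ n _ n])
  finally have "N = V * B ^\<^sub>m r' * U" using Mk by simp
  then have "mtr N = (\<Sum>i<n. B $$ (i, i) ^ r')"
    using mtr_V[of "B ^\<^sub>m r'"] B Bk[of r'] by (simp add: mtr_def)
  also have "\<dots> = (\<Sum>i<n. cnj (B $$ (i, i)))"
  proof (intro sum.cong refl)
    fix i assume "i \<in> {..<n}"
    then have "B $$ (i, i) ^ r = 1" using b by simp
    then have "cmod (B $$ (i, i)) = 1"
      using pow(2) by (metis norm_ge_zero norm_one norm_power power_eq_imp_eq_base power_one zero_le_one)
    then have "B $$ (i, i) * cnj (B $$ (i, i)) = 1"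
      using complex_norm_square[of "B $$ (i, i)"] by simp
    moreover have "B $$ (i, i) * B $$ (i, i) ^ r' = 1" using \<open>B $$ (i, i) ^ r = 1\<close> by (simp add: r')
    ultimately show "B $$ (i, i) ^ r' = cnj (B $$ (i, i))"
      by (metis mult_cancel_left mult_zero_left zero_neq_one)
  qed
  also have "\<dots> = cnj (mtr M)" using mtr_V[OF B] B by (simp add: MB mtr_def)
  finally show ?thesis .
qed

section \<open>Convolution\<close>

locale finite_group_algebra = group G for G :: "('a, 'b) monoid_scheme" (structure) +
  assumes finite_carrier: "finite (carrier G)"
begin

definition conv :: "('a \<Rightarrow> complex) \<Rightarrow> ('a \<Rightarrow> complex) \<Rightarrow> 'a \<Rightarrow> complex" (infixl "\<star>" 77)
  where "a \<star> b = a \<otimes>\<^bsub>group_algebra G\<^esub> b"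

text \<open>Group algebras of subgroups and the components supported on single cosets are all
  treated as such subsets, with the one product \<open>conv\<close>.\<close>

definition supp_in :: "'a set \<Rightarrow> ('a \<Rightarrow> complex) set"
  where "supp_in X = {a. \<forall>g. g \<notin> X \<longrightarrow> a g = 0}"

abbreviation \<delta> where "\<delta> \<equiv> basis_elem"

lemma conv_apply:
  "(a \<star> b) g = (if g \<in> carrier G then \<Sum>h\<in>carrier G. a h * b (inv h \<otimes> g) else 0)"
proof (cases "g \<in> carrier G")
  case True
  have "(\<Sum>k\<in>carrier G. if h \<otimes> k = g then a h * b k else 0) = a h * b (inv h \<otimes> g)" if h: "h \<in> carrier G" for h
  proof -
    have "(\<Sum>k\<in>carrier G. if h \<otimes> k = g then a h * b k else 0) =
        (\<Sum>k\<in>carrier G. if k = inv h \<otimes> g then a h * b k else 0)"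
    proof (intro sum.cong refl)
      fix k assume k: "k \<in> carrier G"
      show "(if h \<otimes> k = g then a h * b k else 0) = (if k = inv h \<otimes> g then a h * b k else 0)"
        using inv_solve_left[of k h g] k True h by auto
    qed
    also have "\<dots> = a h * b (inv h \<otimes> g)" using True h finite_carrier by (simp add: sum.delta)
    finally show ?thesis .
  qed
  then show ?thesis using True by (simp add: conv_def group_algebra_def)
next
  case False
  then show ?thesis by (auto simp: conv_def group_algebra_def intro!: sum.neutral)
qed

lemma sum_translate: "h \<in> carrier G \<Longrightarrow> (\<Sum>g\<in>carrier G. f (h \<otimes> g)) = sum f (carrier G)"
  using sum_left_translate[OF subgroup_self] by blast

text \<open>Convolution reads its arguments only on the carrier and vanishes outside it, so the law
  holds for arbitrary functions, the form in which \<open>twisted_algebra\<close> asks for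
  it.\<close>

lemma conv_assoc: "a \<star> b \<star> c = a \<star> (b \<star> c)"
proof
  fix g
  show "(a \<star> b \<star> c) g = (a \<star> (b \<star> c)) g"
  proof (cases "g \<in> carrier G")
    case True
    have "(a \<star> b \<star> c) g = (\<Sum>h\<in>carrier G. \<Sum>k\<in>carrier G. a k * b (inv k \<otimes> h) * c (inv h \<otimes> g))"
      using True by (simp add: conv_apply sum_distrib_right)
    also have "\<dots> = (\<Sum>k\<in>carrier G. \<Sum>h\<in>carrier G. a k * b (inv k \<otimes> h) * c (inv h \<otimes> g))"
      by (rule sum.swap)
    also have "\<dots> = (\<Sum>k\<in>carrier G. \<Sum>h\<in>carrier G. a k * (b h * c (inv h \<otimes> (inv k \<otimes> g))))"
    proof (rule sum.cong[OF refl])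
      fix k assume k: "k \<in> carrier G"
      have "(\<Sum>h\<in>carrier G. a k * b (inv k \<otimes> h) * c (inv h \<otimes> g)) =
        (\<Sum>h\<in>carrier G. a k * b (inv k \<otimes> (k \<otimes> h)) * c (inv (k \<otimes> h) \<otimes> g))"
        using sum_translate[OF k, of "\<lambda>h. a k * b (inv k \<otimes> h) * c (inv h \<otimes> g)"] by simp
      also have "\<dots> = (\<Sum>h\<in>carrier G. a k * (b h * c (inv h \<otimes> (inv k \<otimes> g))))"
        using k True by (intro sum.cong) (auto simp: inv_mult_group m_assoc[symmetric])
      finally show "(\<Sum>h\<in>carrier G. a k * b (inv k \<otimes> h) * c (inv h \<otimes> g)) =
        (\<Sum>h\<in>carrier G. a k * (b h * c (inv h \<otimes> (inv k \<otimes> g))))" .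
    qed
    also have "\<dots> = (a \<star> (b \<star> c)) g" using True by (simp add: conv_apply sum_distrib_left)
    finally show ?thesis .
  qed (simp add: conv_apply)
qed

lemma conv_add_left: "(a + b) \<star> c = a \<star> c + b \<star> c"
  and conv_add_right: "c \<star> (a + b) = c \<star> a + c \<star> b"
  by (auto simp: fun_eq_iff conv_apply algebra_simps sum.distrib)

lemma conv_scale_left: "(z \<cdot>\<^sub>f a) \<star> b = z \<cdot>\<^sub>f (a \<star> b)"
  and conv_scale_right: "a \<star> (z \<cdot>\<^sub>f b) = z \<cdot>\<^sub>f (a \<star> b)"
  by (auto simp: fun_eq_iff conv_apply sum_distrib_left mult_ac)

lemma conv_zero_left [simp]: "0 \<star> a = 0" and conv_zero_right [simp]: "a \<star> 0 = 0"
  by (auto simp: fun_eq_iff conv_apply)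

lemma conv_sum_left: "(\<Sum>i\<in>I. f i) \<star> b = (\<Sum>i\<in>I. f i \<star> b)"
  by (induction I rule: infinite_finite_induct) (simp_all only: sum.infinite sum.empty sum.insert conv_zero_left conv_add_left not_False_eq_True)

lemma conv_sum_right: "b \<star> (\<Sum>i\<in>I. f i) = (\<Sum>i\<in>I. b \<star> f i)"
  by (induction I rule: infinite_finite_induct) (simp_all only: sum.infinite sum.empty sum.insert conv_zero_right conv_add_right not_False_eq_True)

lemma delta_conv: "x \<in> carrier G \<Longrightarrow> (\<delta> x \<star> a) g = (if g \<in> carrier G then a (inv x \<otimes> g) else 0)"
proof -
  assume x: "x \<in> carrier G"
  have "(\<Sum>h\<in>carrier G. \<delta> x h * a (inv h \<otimes> g)) = (\<Sum>h\<in>carrier G. if h = x then a (inv h \<otimes> g) else 0)"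
    by (intro sum.cong) (auto simp: basis_elem_def)
  then show ?thesis using x finite_carrier by (simp add: conv_apply sum.delta)
qed

lemma conv_delta: "x \<in> carrier G \<Longrightarrow> (a \<star> \<delta> x) g = (if g \<in> carrier G then a (g \<otimes> inv x) else 0)"
proof (cases "g \<in> carrier G")
  case True
  assume x: "x \<in> carrier G"
  have "(\<Sum>h\<in>carrier G. a h * \<delta> x (inv h \<otimes> g)) = (\<Sum>h\<in>carrier G. if h = g \<otimes> inv x then a h else 0)"
  proof (intro sum.cong refl)
    fix h assume h: "h \<in> carrier G"
    have "inv h \<otimes> g = x \<longleftrightarrow> h = g \<otimes> inv x"
      using h True x inv_solve_left'[of x h g] inv_solve_right[of h g x] by auto
    then show "a h * \<delta> x (inv h \<otimes> g) = (if h = g \<otimes> inv x then a h else 0)"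
      by (auto simp: basis_elem_def)
  qed
  then show ?thesis using True x finite_carrier by (simp add: conv_apply sum.delta)
qed (simp add: conv_apply)

lemma delta_delta: "x \<in> carrier G \<Longrightarrow> y \<in> carrier G \<Longrightarrow> \<delta> x \<star> \<delta> y = \<delta> (x \<otimes> y)"
proof
  fix g assume x: "x \<in> carrier G" "y \<in> carrier G"
  have "inv x \<otimes> g = y \<longleftrightarrow> g = x \<otimes> y" if "g \<in> carrier G"
    using x that inv_solve_left'[of y x g] by auto
  then show "(\<delta> x \<star> \<delta> y) g = \<delta> (x \<otimes> y) g"
    using x by (cases "g \<in> carrier G") (simp_all add: delta_conv, auto simp: basis_elem_def)
qed

lemma supp_in_delta: "x \<in> X \<Longrightarrow> \<delta> x \<in> supp_in X"
  by (auto simp: supp_in_def basis_elem_def)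

lemma supp_in_add: "a \<in> supp_in X \<Longrightarrow> b \<in> supp_in X \<Longrightarrow> a + b \<in> supp_in X"
  and supp_in_scale: "a \<in> supp_in X \<Longrightarrow> c \<cdot>\<^sub>f a \<in> supp_in X"
  and supp_in_mono: "a \<in> supp_in X \<Longrightarrow> X \<subseteq> Y \<Longrightarrow> a \<in> supp_in Y"
  and supp_in_zero: "0 \<in> supp_in X"
  by (auto simp: supp_in_def)

lemma supp_in_sum: "(\<And>i. i \<in> I \<Longrightarrow> f i \<in> supp_in X) \<Longrightarrow> sum f I \<in> supp_in X"
  by (induction I rule: infinite_finite_induct) (auto simp: supp_in_add supp_in_zero)

lemma supp_in_conv:
  assumes "a \<in> supp_in X" "b \<in> supp_in Y"
  shows "a \<star> b \<in> supp_in (X <#> Y)"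
proof -
  have "(a \<star> b) g = 0" if g: "g \<notin> X <#> Y" for g
  proof (cases "g \<in> carrier G")
    case True
    have "a h * b (inv h \<otimes> g) = 0" if h: "h \<in> carrier G" for h
    proof (rule ccontr)
      assume "a h * b (inv h \<otimes> g) \<noteq> 0"
      then have "h \<in> X" "inv h \<otimes> g \<in> Y" using assms by (auto simp: supp_in_def)
      moreover have "g = h \<otimes> (inv h \<otimes> g)" using h True by (simp add: m_assoc[symmetric])
      ultimately show False using g unfolding set_mult_def by blast
    qed
    then show ?thesis by (simp add: conv_apply)
  qed (simp add: conv_apply)
  then show ?thesis by (simp add: supp_in_def)
qed

lemma supp_in_conv_subgroup:
  "subgroup X G \<Longrightarrow> a \<in> supp_in X \<Longrightarrow> b \<in> supp_in X \<Longrightarrow> a \<star> b \<in> supp_in X"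
  using subgroup.m_closed[of X G] by (intro supp_in_mono[OF supp_in_conv]) (auto simp: set_mult_def)

lemma carrier_group_algebra: "carrier (group_algebra (subgrp G X)) = supp_in X"
  by (simp add: group_algebra_def supp_in_def)

lemma one_conv: "a \<in> supp_in (carrier G) \<Longrightarrow> \<delta> \<one> \<star> a = a" and conv_one: "a \<in> supp_in (carrier G) \<Longrightarrow> a \<star> \<delta> \<one> = a"
  by (auto simp: fun_eq_iff delta_conv conv_delta supp_in_def)

lemma sum_delta: "finite X \<Longrightarrow> a \<in> supp_in X \<Longrightarrow> a = (\<Sum>x\<in>X. a x \<cdot>\<^sub>f \<delta> x)"
proof
  fix g assume X: "finite X" "a \<in> supp_in X"
  have "(\<Sum>x\<in>X. a x \<cdot>\<^sub>f \<delta> x) g = (\<Sum>x\<in>X. if x = g then a x else 0)"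
    using X(1) by (induction X rule: finite_induct) (auto simp: basis_elem_def)
  then show "a g = (\<Sum>x\<in>X. a x \<cdot>\<^sub>f \<delta> x) g" using X by (auto simp: supp_in_def sum.delta)
qed

text \<open>The sums over \<open>X\<close> extend by zero to the carrier. This identifies the
  products of the several group algebras of the statement with \<open>conv\<close>.\<close>

lemma subgroup_conv:
  assumes X: "subgroup X G" and a: "a \<in> supp_in X" and b: "b \<in> supp_in X"
  shows "a \<otimes>\<^bsub>group_algebra (subgrp G X)\<^esub> b = a \<star> b"
proof
  fix g
  have X': "X \<subseteq> carrier G" using X by (rule subgroup.subset)
  have "(\<Sum>h\<in>X. \<Sum>k\<in>X. if h \<otimes> k = g then a h * b k else 0) =
     (\<Sum>h\<in>carrier G. \<Sum>k\<in>X. if h \<otimes> k = g then a h * b k else 0)"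
    using X' finite_carrier a by (intro sum.mono_neutral_left) (auto simp: supp_in_def intro!: sum.neutral)
  also have "\<dots> = (\<Sum>h\<in>carrier G. \<Sum>k\<in>carrier G. if h \<otimes> k = g then a h * b k else 0)"
    using X' finite_carrier b by (intro sum.cong refl sum.mono_neutral_left) (auto simp: supp_in_def)
  finally show "(a \<otimes>\<^bsub>group_algebra (subgrp G X)\<^esub> b) g = (a \<star> b) g"
    by (simp add: conv_def group_algebra_def)
qed

end

text \<open>The size is explicit so that the empty sum is the zero matrix of the right
  dimension.\<close>

definition msum :: "nat \<Rightarrow> ('i \<Rightarrow> complex mat) \<Rightarrow> 'i set \<Rightarrow> complex mat"
  where "msum n f I = mat n n (\<lambda>(i, j). \<Sum>x\<in>I. f x $$ (i, j))"

lemma msum_carrier [simp]: "msum n f I \<in> carrier_mat n n"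
  by (simp add: msum_def)

lemma index_msum [simp]: "i < n \<Longrightarrow> j < n \<Longrightarrow> msum n f I $$ (i, j) = (\<Sum>x\<in>I. f x $$ (i, j))"
  by (simp add: msum_def)

lemma index_mult_mat_sum:
  assumes "A \<in> carrier_mat n n" "B \<in> carrier_mat n n" "i < n" "j < n"
  shows "(A * B) $$ (i, j) = (\<Sum>k<n. A $$ (i, k) * B $$ (k, j))"
  using assms by (simp add: scalar_prod_def lessThan_atLeast0)

lemma msum_cong: "(\<And>x. x \<in> I \<Longrightarrow> f x = g x) \<Longrightarrow> msum n f I = msum n g I"
  by (simp add: msum_def cong: sum.cong)

lemma mult_msum:
  assumes A: "A \<in> carrier_mat n n" and f: "\<And>x. x \<in> I \<Longrightarrow> f x \<in> carrier_mat n n"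
  shows "A * msum n f I = msum n (\<lambda>x. A * f x) I"
proof (rule eq_matI)
  fix i j assume "i < dim_row (msum n (\<lambda>x. A * f x) I)" "j < dim_col (msum n (\<lambda>x. A * f x) I)"
  then have ij: "i < n" "j < n" by (auto simp: msum_def)
  have "(A * msum n f I) $$ (i, j) = (\<Sum>k<n. \<Sum>x\<in>I. A $$ (i, k) * f x $$ (k, j))"
    unfolding index_mult_mat_sum[OF A msum_carrier ij]
    using ij by (intro sum.cong) (auto simp: sum_distrib_left)
  also have "\<dots> = (\<Sum>x\<in>I. (A * f x) $$ (i, j))"
    using ij A f by (subst sum.swap) (simp add: index_mult_mat_sum del: index_mult_mat)
  finally show "(A * msum n f I) $$ (i, j) = msum n (\<lambda>x. A * f x) I $$ (i, j)" using ij by simp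
qed (use A in \<open>auto simp: msum_def\<close>)

lemma msum_mult:
  assumes A: "A \<in> carrier_mat n n" and f: "\<And>x. x \<in> I \<Longrightarrow> f x \<in> carrier_mat n n"
  shows "msum n f I * A = msum n (\<lambda>x. f x * A) I"
proof (rule eq_matI)
  fix i j assume "i < dim_row (msum n (\<lambda>x. f x * A) I)" "j < dim_col (msum n (\<lambda>x. f x * A) I)"
  then have ij: "i < n" "j < n" by (auto simp: msum_def)
  have "(msum n f I * A) $$ (i, j) = (\<Sum>k<n. \<Sum>x\<in>I. f x $$ (i, k) * A $$ (k, j))"
    unfolding index_mult_mat_sum[OF msum_carrier A ij]
    using ij by (intro sum.cong) (auto simp: sum_distrib_right)
  also have "\<dots> = (\<Sum>x\<in>I. (f x * A) $$ (i, j))"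
    using ij by (subst sum.swap) (simp add: index_mult_mat_sum[OF f A] del: index_mult_mat)
  finally show "(msum n f I * A) $$ (i, j) = msum n (\<lambda>x. f x * A) I $$ (i, j)" using ij by simp
qed (use A in \<open>auto simp: msum_def\<close>)

lemma mtr_msum:
  assumes "\<And>x. x \<in> I \<Longrightarrow> f x \<in> carrier_mat n n"
  shows "mtr (msum n f I) = (\<Sum>x\<in>I. mtr (f x))"
proof -
  have "mtr (f x) = (\<Sum>i<n. f x $$ (i, i))" if "x \<in> I" for x
    using assms[OF that] by (simp add: mtr_def)
  moreover have "mtr (msum n f I) = (\<Sum>i<n. \<Sum>x\<in>I. f x $$ (i, i))"
    by (simp add: mtr_def msum_def)
  ultimately show ?thesis by (subst (asm) sum.swap) (simp cong: sum.cong)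
qed

lemma msum_reindex: "bij_betw h I J \<Longrightarrow> msum n (\<lambda>x. f (h x)) I = msum n f J"
  unfolding msum_def by (subst sum.reindex_bij_betw[of h I J]) simp_all

definition unit_mat :: "nat \<Rightarrow> nat \<Rightarrow> nat \<Rightarrow> complex mat"
  where "unit_mat n k l = mat n n (\<lambda>(i, j). if i = k \<and> j = l then 1 else 0)"

lemma unit_mat_carrier [simp]: "unit_mat n k l \<in> carrier_mat n n"
  by (simp add: unit_mat_def)

lemma index_mult_unit_mat_mult:
  assumes "A \<in> carrier_mat n n" "B \<in> carrier_mat n n" "i < n" "j < n" "k < n" "l < n"
  shows "(A * unit_mat n k l * B) $$ (i, j) = A $$ (i, k) * B $$ (l, j)"
proof -
  have "(A * unit_mat n k l) $$ (i, m) = (if m = l then A $$ (i, k) else 0)" if "m < n" for m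
  proof -
    have "(A * unit_mat n k l) $$ (i, m) = (\<Sum>p<n. if p = k then (if m = l then A $$ (i, k) else 0) else 0)"
      unfolding index_mult_mat_sum[OF assms(1) unit_mat_carrier assms(3) that]
      using that assms by (intro sum.cong) (auto simp: unit_mat_def)
    then show ?thesis using assms by simp
  qed
  then have "(A * unit_mat n k l * B) $$ (i, j) = (\<Sum>m<n. if m = l then A $$ (i, k) * B $$ (l, j) else 0)"
    unfolding index_mult_mat_sum[OF mult_carrier_mat[OF assms(1) unit_mat_carrier] assms(2-4)] by (intro sum.cong) auto
  then show ?thesis using assms by simp
qed

lemma mtr_unit_mat: "k < n \<Longrightarrow> mtr (unit_mat n k l) = (if k = l then 1 else 0)"
proof -
  assume k: "k < n"
  have "mtr (unit_mat n k l) = (\<Sum>i<n. if i = k then (if k = l then 1 else 0) else 0)"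
    unfolding mtr_def by (auto simp: unit_mat_def intro!: sum.cong)
  then show ?thesis using k by simp
qed

lemma unit_mat_idem: "k < n \<Longrightarrow> unit_mat n k k * unit_mat n k k = unit_mat n k k"
proof (rule eq_matI)
  fix i j assume k: "k < n" and "i < dim_row (unit_mat n k k)" "j < dim_col (unit_mat n k k)"
  then have ij: "i < n" "j < n" by (auto simp: unit_mat_def)
  have "(unit_mat n k k * unit_mat n k k) $$ (i, j) = (1\<^sub>m n * unit_mat n k k * unit_mat n k k) $$ (i, j)"
    by (simp only: left_mult_one_mat[OF unit_mat_carrier])
  also have "\<dots> = unit_mat n k k $$ (i, j)"
    using k ij by (subst index_mult_unit_mat_mult) (auto simp: unit_mat_def)
  finally show "(unit_mat n k k * unit_mat n k k) $$ (i, j) = unit_mat n k k $$ (i, j)" .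
qed (auto simp: unit_mat_def)

section \<open>Irreducible representations of a subgroup\<close>

lemma sum_fun_apply:
  fixes f :: "'i \<Rightarrow> 'x \<Rightarrow> complex"
  shows "finite I \<Longrightarrow> (\<Sum>i\<in>I. f i) x = (\<Sum>i\<in>I. f i x)"
  by (induction I rule: finite_induct) (simp_all only: sum.empty sum.insert plus_fun_apply zero_fun_apply not_False_eq_True)

lemma square_mult_carrier [simp]:
  "A \<in> carrier_mat n n \<Longrightarrow> B \<in> carrier_mat n n \<Longrightarrow> A * B \<in> carrier_mat n n"
  by (rule mult_carrier_mat)

lemma square_mult_one [simp]:
  fixes A :: "complex mat"
  shows "A \<in> carrier_mat n n \<Longrightarrow> A * 1\<^sub>m n = A" "A \<in> carrier_mat n n \<Longrightarrow> 1\<^sub>m n * A = A"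
  using right_mult_one_mat[of A n n] left_mult_one_mat[of A n n] by auto

locale subgroup_irrep = finite_group_algebra G for G :: "('a, 'b) monoid_scheme" (structure) +
  fixes H :: "'a set" and n :: nat and \<rho> :: "'a \<Rightarrow> complex mat"
  assumes subgroup_H: "subgroup H G" and irreducible: "irreducible_rep (subgrp G H) n \<rho>"
begin

lemma H_carrier: "x \<in> H \<Longrightarrow> x \<in> carrier G"
  using subgroup_H by (rule subgroup.mem_carrier)

lemma H_closed [simp]: "x \<in> H \<Longrightarrow> y \<in> H \<Longrightarrow> x \<otimes> y \<in> H" "x \<in> H \<Longrightarrow> inv x \<in> H" "\<one> \<in> H"
  using subgroup_H by (auto simp: subgroup.m_closed subgroup.m_inv_closed subgroup.one_closed)

lemma finite_H [simp]: "finite H"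
  using finite_subset[OF subgroup.subset[OF subgroup_H] finite_carrier] .

lemma card_H: "card H \<noteq> 0"
  using finite_H H_closed(3) by (metis card_0_eq empty_iff)

lemma n_pos: "0 < n"
  using irreducible by (simp add: irreducible_rep_def)

lemma rho_Units: "x \<in> H \<Longrightarrow> \<rho> x \<in> Units (ring_mat TYPE(complex) n ())"
  and rho_mult: "x \<in> H \<Longrightarrow> y \<in> H \<Longrightarrow> \<rho> (x \<otimes> y) = \<rho> x * \<rho> y"
  using irreducible by (auto simp: irreducible_rep_def matrix_rep_def hom_def units_of_def ring_mat_def)

lemma rho_carrier [simp]: "x \<in> H \<Longrightarrow> \<rho> x \<in> carrier_mat n n"
  using rho_Units[of x] by (auto simp: Units_def ring_mat_def)

lemma rho_one: "\<rho> \<one> = 1\<^sub>m n"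
proof -
  obtain M where M: "M \<in> carrier_mat n n" "M * \<rho> \<one> = 1\<^sub>m n"
    using rho_Units[of \<one>] by (auto simp: Units_def ring_mat_def)
  have "M * (\<rho> \<one> * \<rho> \<one>) = M * \<rho> \<one>" using rho_mult[of \<one> \<one>] by simp
  then have "(M * \<rho> \<one>) * \<rho> \<one> = M * \<rho> \<one>" using assoc_mult_mat[OF M(1) rho_carrier rho_carrier, of \<one> \<one>] by simp
  then show ?thesis using M(2) left_mult_one_mat[OF rho_carrier[of \<one>]] by simp
qed

lemma rho_inv: "x \<in> H \<Longrightarrow> \<rho> x * \<rho> (inv x) = 1\<^sub>m n" "x \<in> H \<Longrightarrow> \<rho> (inv x) * \<rho> x = 1\<^sub>m n"
  by (simp_all add: rho_mult[symmetric] H_carrier rho_one)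

text \<open>The eigenspace of \<open>M\<close> for a root of its characteristic polynomial is
  invariant and nonzero, so by irreducibility it is everything.\<close>

lemma schur:
  assumes M: "M \<in> carrier_mat n n" and comm: "\<And>x. x \<in> H \<Longrightarrow> M * \<rho> x = \<rho> x * M"
  obtains c where "M = c \<cdot>\<^sub>m 1\<^sub>m n"
proof -
  obtain es where es: "char_poly M = (\<Prod>a\<leftarrow>es. [:- a, 1:])" "length es = n"
    using char_poly_factorized[OF M] by blast
  define c where "c = hd es"
  have "poly (char_poly M) c = 0" using es n_pos by (cases es) (auto simp: c_def)
  then obtain v where v: "v \<in> carrier_vec n" "v \<noteq> 0\<^sub>v n" "M *\<^sub>v v = c \<cdot>\<^sub>v v"
    using M eigenvalue_root_char_poly[OF M] by (auto simp: eigenvalue_def eigenvector_def)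
  define W where "W = {w \<in> carrier_vec n. M *\<^sub>v w = c \<cdot>\<^sub>v w}"
  have mod: "Module.module (class_ring :: complex ring) (module_vec TYPE(complex) n)" by (rule vec_module)
  have "submodule (class_ring :: complex ring) W (module_vec TYPE(complex) n)"
  proof (rule submodule.intro[OF mod])
    show "W \<subseteq> carrier (module_vec TYPE(complex) n)" by (auto simp: W_def module_vec_simps)
    show "v \<oplus>\<^bsub>module_vec TYPE(complex) n\<^esub> w \<in> W" if "v \<in> W" "w \<in> W" for v w
      using that M by (auto simp: W_def module_vec_simps mult_add_distrib_mat_vec[OF M] smult_add_distrib_vec)
    show "\<zero>\<^bsub>module_vec TYPE(complex) n\<^esub> \<in> W" using M by (auto simp: W_def module_vec_simps)
    show "a \<odot>\<^bsub>module_vec TYPE(complex) n\<^esub> v \<in> W" if "v \<in> W" for a v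
      using that M by (auto simp: W_def module_vec_simps mult_mat_vec[OF M] smult_smult_assoc mult.commute)
  qed
  then have "VectorSpace.subspace class_ring W (module_vec TYPE(complex) n)"
    by (intro VectorSpace.subspace.intro vec_vs)
  moreover have "\<rho> g *\<^sub>v w \<in> W" if g: "g \<in> H" and w: "w \<in> W" for g w
  proof -
    have w': "w \<in> carrier_vec n" "M *\<^sub>v w = c \<cdot>\<^sub>v w" using w by (auto simp: W_def)
    have "M *\<^sub>v (\<rho> g *\<^sub>v w) = (\<rho> g * M) *\<^sub>v w"
      using assoc_mult_mat_vec[OF M rho_carrier[OF g] w'(1)] comm[OF g] by simp
    also have "\<dots> = \<rho> g *\<^sub>v (c \<cdot>\<^sub>v w)"
      using assoc_mult_mat_vec[OF rho_carrier[OF g] M w'(1)] w'(2) by simp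
    also have "\<dots> = c \<cdot>\<^sub>v (\<rho> g *\<^sub>v w)" using mult_mat_vec[OF rho_carrier[OF g] w'(1)] by simp
    finally show ?thesis using g w' mult_mat_vec_carrier[OF rho_carrier[OF g] w'(1)] by (simp add: W_def)
  qed
  ultimately have "W = {0\<^sub>v n} \<or> W = carrier_vec n"
    using irreducible by (simp add: irreducible_rep_def)
  moreover have "v \<in> W" using v by (simp add: W_def)
  ultimately have W: "W = carrier_vec n" using v by auto
  have "M = c \<cdot>\<^sub>m 1\<^sub>m n"
  proof (rule eq_matI)
    fix i j assume "i < dim_row (c \<cdot>\<^sub>m 1\<^sub>m n)" "j < dim_col (c \<cdot>\<^sub>m 1\<^sub>m n)"
    then have ij: "i < n" "j < n" by auto
    have "unit_vec n j \<in> W" using W by simp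
    then have "M *\<^sub>v unit_vec n j = c \<cdot>\<^sub>v unit_vec n j" by (simp add: W_def)
    then have "(M *\<^sub>v unit_vec n j) $ i = (c \<cdot>\<^sub>v unit_vec n j) $ i" by simp
    moreover have "(M *\<^sub>v unit_vec n j) $ i = M $$ (i, j)"
      using ij M scalar_prod_right_unit[of j n "row M i"] by auto
    ultimately show "M $$ (i, j) = (c \<cdot>\<^sub>m 1\<^sub>m n) $$ (i, j)"
      using ij by (auto simp: index_unit_vec)
  qed (use M in auto)
  then show thesis by (rule that)
qed

lemma bij_mult_left: "h \<in> H \<Longrightarrow> bij_betw (\<lambda>g. h \<otimes> g) H H"
  by (intro bij_betwI[of _ _ _ "\<lambda>g. inv h \<otimes> g"]) (auto simp: H_carrier m_assoc[symmetric])

lemma mult3_carrier: "x \<in> H \<Longrightarrow> y \<in> H \<Longrightarrow> X \<in> carrier_mat n n \<Longrightarrow> \<rho> x * X * \<rho> y \<in> carrier_mat n n"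
  by (metis mult_carrier_mat rho_carrier)

text \<open>Replacing \<open>g\<close> by \<open>h \<otimes> g\<close> moves \<open>r h\<close> out
  on the left and cancels \<open>r' h\<close> on the right. Two representations are involved because
  averages between \<open>\<rho>\<close> and its conjugate by a group element will be taken in both
  directions.\<close>

lemma msum_intertwines:
  assumes r: "\<And>x. x \<in> H \<Longrightarrow> r x \<in> carrier_mat n n" "\<And>x y. x \<in> H \<Longrightarrow> y \<in> H \<Longrightarrow> r (x \<otimes> y) = r x * r y"
    and r': "\<And>x. x \<in> H \<Longrightarrow> r' x \<in> carrier_mat n n" "\<And>x y. x \<in> H \<Longrightarrow> y \<in> H \<Longrightarrow> r' (x \<otimes> y) = r' x * r' y"
    and r'_one: "r' \<one> = 1\<^sub>m n" and h: "h \<in> H" and X: "X \<in> carrier_mat n n"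
  shows "msum n (\<lambda>g. r g * X * r' (inv g)) H * r' h = r h * msum n (\<lambda>g. r g * X * r' (inv g)) H"
proof -
  note [simp] = r r'(1)
  have r'_inv: "r' (inv h) * r' h = 1\<^sub>m n"
    using r'(2)[of "inv h" h] h by (simp add: H_carrier r'_one)
  have "msum n (\<lambda>g. r g * X * r' (inv g)) H * r' h = msum n (\<lambda>g. r g * X * r' (inv g) * r' h) H"
    using h X by (intro msum_mult) auto
  also have "\<dots> = msum n (\<lambda>g. r (h \<otimes> g) * X * r' (inv (h \<otimes> g)) * r' h) H"
    using msum_reindex[OF bij_mult_left[OF h], of n "\<lambda>g. r g * X * r' (inv g) * r' h"] by simp
  also have "\<dots> = msum n (\<lambda>g. r h * (r g * X * r' (inv g))) H"
  proof (rule msum_cong)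
    fix g assume g: "g \<in> H"
    have "r (h \<otimes> g) * X * r' (inv (h \<otimes> g)) * r' h = r h * (r g * X * r' (inv g)) * (r' (inv h) * r' h)"
      using g h X by (simp add: r'(2) inv_mult_group H_carrier assoc_mult_mat[of _ n n _ n _ n])
    then show "r (h \<otimes> g) * X * r' (inv (h \<otimes> g)) * r' h = r h * (r g * X * r' (inv g))"
      using g h X by (simp add: r'_inv)
  qed
  also have "\<dots> = r h * msum n (\<lambda>g. r g * X * r' (inv g)) H"
    using h X by (intro mult_msum[symmetric]) auto
  finally show ?thesis .
qed

text \<open>Schur's lemma makes the average a scalar matrix; the scalar is read off from the trace,
  which is the same for all summands.\<close>

lemma average:
  assumes X: "X \<in> carrier_mat n n"
  shows "msum n (\<lambda>g. \<rho> g * X * \<rho> (inv g)) H = (of_nat (card H) / of_nat n * mtr X) \<cdot>\<^sub>m 1\<^sub>m n"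
proof -
  let ?M = "msum n (\<lambda>g. \<rho> g * X * \<rho> (inv g)) H"
  have car: "\<rho> g * X * \<rho> (inv g) \<in> carrier_mat n n" if "g \<in> H" for g using that X mult3_carrier by simp
  have "?M * \<rho> h = \<rho> h * ?M" if h: "h \<in> H" for h
    by (rule msum_intertwines[OF rho_carrier rho_mult rho_carrier rho_mult rho_one h X])
  then obtain c where c: "?M = c \<cdot>\<^sub>m 1\<^sub>m n" using schur[of ?M] by auto
  have "mtr ?M = (\<Sum>g\<in>H. mtr (\<rho> g * X * \<rho> (inv g)))" using car by (rule mtr_msum)
  also have "\<dots> = (\<Sum>g\<in>H. mtr X)"
  proof (rule sum.cong[OF refl])
    fix g assume g: "g \<in> H"
    have "mtr (\<rho> g * X * \<rho> (inv g)) = mtr (\<rho> (inv g) * (\<rho> g * X))" using g X by (intro mtr_comm[of _ n]) auto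
    also have "\<rho> (inv g) * (\<rho> g * X) = X"
      using assoc_mult_mat[of "\<rho> (inv g)" n n "\<rho> g" n X n] g X by (simp add: rho_inv)
    finally show "mtr (\<rho> g * X * \<rho> (inv g)) = mtr X" .
  qed
  finally have "c * of_nat n = of_nat (card H) * mtr X" unfolding c mtr_smult[OF one_carrier_mat] by (simp add: mtr_one)
  then have "c = of_nat (card H) / of_nat n * mtr X" using n_pos by (simp add: field_simps)
  then show ?thesis using c by simp
qed

text \<open>Entry \<open>(i, j)\<close> of the average of the matrix unit with index
  \<open>(k, l)\<close>.\<close>

lemma orthogonality:
  assumes "i < n" "j < n" "k < n" "l < n"
  shows "(\<Sum>g\<in>H. \<rho> g $$ (i, k) * \<rho> (inv g) $$ (l, j)) = (if i = j \<and> k = l then of_nat (card H) / of_nat n else 0)"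
proof -
  have "(\<Sum>g\<in>H. \<rho> g $$ (i, k) * \<rho> (inv g) $$ (l, j)) =
    msum n (\<lambda>g. \<rho> g * unit_mat n k l * \<rho> (inv g)) H $$ (i, j)"
    using assms by (simp add: index_mult_unit_mat_mult del: index_mult_mat)
  then show ?thesis unfolding average[OF unit_mat_carrier] using assms by (simp add: mtr_unit_mat)
qed

section \<open>The block of an irreducible representation as a full matrix algebra\<close>

definition Rl :: "('a \<Rightarrow> complex) \<Rightarrow> complex mat"
  where "Rl a = msum n (\<lambda>g. a g \<cdot>\<^sub>m \<rho> g) H"

lemma Rl_carrier [simp]: "Rl a \<in> carrier_mat n n"
  by (simp add: Rl_def)

lemma index_Rl: "i < n \<Longrightarrow> j < n \<Longrightarrow> Rl a $$ (i, j) = (\<Sum>g\<in>H. a g * \<rho> g $$ (i, j))"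
proof -
  assume ij: "i < n" "j < n"
  have "(a g \<cdot>\<^sub>m \<rho> g) $$ (i, j) = a g * \<rho> g $$ (i, j)" if "g \<in> H" for g
    using ij rho_carrier[OF that] by auto
  then show ?thesis using ij by (simp add: Rl_def cong: sum.cong)
qed

lemma dim_Rl [simp]: "dim_row (Rl a) = n" "dim_col (Rl a) = n"
  by (rule carrier_matD[OF Rl_carrier])+

lemma Rl_eqI: "M \<in> carrier_mat n n \<Longrightarrow> (\<And>i j. i < n \<Longrightarrow> j < n \<Longrightarrow> (\<Sum>g\<in>H. a g * \<rho> g $$ (i, j)) = M $$ (i, j)) \<Longrightarrow> Rl a = M"
  by (rule eq_matI) (auto simp: index_Rl)

lemma Rl_delta: "x \<in> H \<Longrightarrow> Rl (\<delta> x) = \<rho> x"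
proof (rule Rl_eqI)
  fix i j assume x: "x \<in> H" "i < n" "j < n"
  have "(\<Sum>g\<in>H. \<delta> x g * \<rho> g $$ (i, j)) = (\<Sum>g\<in>H. if g = x then \<rho> g $$ (i, j) else 0)"
    by (intro sum.cong) (auto simp: basis_elem_def)
  then show "(\<Sum>g\<in>H. \<delta> x g * \<rho> g $$ (i, j)) = \<rho> x $$ (i, j)" using x by simp
qed simp

lemma Rl_add: "Rl (a + b) = Rl a + Rl b"
  by (rule Rl_eqI) (auto simp: index_Rl algebra_simps sum.distrib)

lemma Rl_scale: "Rl (c \<cdot>\<^sub>f a) = c \<cdot>\<^sub>m Rl a"
  by (rule Rl_eqI) (auto simp: index_Rl sum_distrib_left mult_ac)

lemma mtr_Rl: "mtr (Rl a) = (\<Sum>g\<in>H. a g * mtr (\<rho> g))"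
proof -
  have "mtr (Rl a) = (\<Sum>g\<in>H. mtr (a g \<cdot>\<^sub>m \<rho> g))" unfolding Rl_def by (rule mtr_msum) simp
  then show ?thesis using mtr_smult[OF rho_carrier] by simp
qed

lemma Rl_conv:
  assumes a: "a \<in> supp_in H" and b: "b \<in> supp_in H"
  shows "Rl (a \<star> b) = Rl a * Rl b"
proof (rule Rl_eqI)
  fix i j assume ij: "i < n" "j < n"
  have cv: "(a \<star> b) g = (\<Sum>h\<in>H. a h * b (inv h \<otimes> g))" if g: "g \<in> H" for g
    unfolding conv_apply using g H_carrier finite_carrier a
    by (auto simp: supp_in_def intro!: sum.mono_neutral_right)
  have "(\<Sum>g\<in>H. (a \<star> b) g * \<rho> g $$ (i, j)) = (\<Sum>g\<in>H. \<Sum>h\<in>H. a h * b (inv h \<otimes> g) * \<rho> g $$ (i, j))"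
    by (simp add: cv sum_distrib_right)
  also have "\<dots> = (\<Sum>h\<in>H. \<Sum>g\<in>H. a h * b (inv h \<otimes> g) * \<rho> g $$ (i, j))" by (rule sum.swap)
  also have "\<dots> = (\<Sum>h\<in>H. \<Sum>g\<in>H. \<Sum>k<n. (a h * \<rho> h $$ (i, k)) * (b g * \<rho> g $$ (k, j)))"
  proof (rule sum.cong[OF refl])
    fix h assume h: "h \<in> H"
    have "(\<Sum>g\<in>H. a h * b (inv h \<otimes> g) * \<rho> g $$ (i, j)) =
      (\<Sum>g\<in>H. a h * b (inv h \<otimes> (h \<otimes> g)) * \<rho> (h \<otimes> g) $$ (i, j))"
      using sum.reindex_bij_betw[OF bij_mult_left[OF h], of "\<lambda>g. a h * b (inv h \<otimes> g) * \<rho> g $$ (i, j)"] by simp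
    also have "\<dots> = (\<Sum>g\<in>H. \<Sum>k<n. (a h * \<rho> h $$ (i, k)) * (b g * \<rho> g $$ (k, j)))"
    proof (rule sum.cong[OF refl])
      fix g assume g: "g \<in> H"
      have "inv h \<otimes> (h \<otimes> g) = g" using h g by (simp add: H_carrier m_assoc[symmetric])
      moreover have "\<rho> (h \<otimes> g) $$ (i, j) = (\<Sum>k<n. \<rho> h $$ (i, k) * \<rho> g $$ (k, j))"
        unfolding rho_mult[OF h g] using h g ij by (intro index_mult_mat_sum) auto
      ultimately show "a h * b (inv h \<otimes> (h \<otimes> g)) * \<rho> (h \<otimes> g) $$ (i, j) =
          (\<Sum>k<n. (a h * \<rho> h $$ (i, k)) * (b g * \<rho> g $$ (k, j)))"
        by (simp add: sum_distrib_left mult_ac)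
    qed
    finally show "(\<Sum>g\<in>H. a h * b (inv h \<otimes> g) * \<rho> g $$ (i, j)) =
      (\<Sum>g\<in>H. \<Sum>k<n. (a h * \<rho> h $$ (i, k)) * (b g * \<rho> g $$ (k, j)))" .
  qed
  also have "\<dots> = (\<Sum>h\<in>H. \<Sum>k<n. \<Sum>g\<in>H. (a h * \<rho> h $$ (i, k)) * (b g * \<rho> g $$ (k, j)))"
    by (intro sum.cong refl sum.swap)
  also have "\<dots> = (\<Sum>k<n. \<Sum>h\<in>H. \<Sum>g\<in>H. (a h * \<rho> h $$ (i, k)) * (b g * \<rho> g $$ (k, j)))"
    by (rule sum.swap)
  also have "\<dots> = (\<Sum>k<n. Rl a $$ (i, k) * Rl b $$ (k, j))"
    using ij by (intro sum.cong refl) (simp add: index_Rl sum_product)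
  also have "\<dots> = (Rl a * Rl b) $$ (i, j)"
    using ij by (intro index_mult_mat_sum[symmetric]) auto
  finally show "(\<Sum>g\<in>H. (a \<star> b) g * \<rho> g $$ (i, j)) = (Rl a * Rl b) $$ (i, j)" .
qed (metis Rl_carrier mult_carrier_mat)

lemma mtr_rho: "g \<in> H \<Longrightarrow> mtr (\<rho> g) = (\<Sum>i<n. \<rho> g $$ (i, i))"
  using carrier_matD(1)[OF rho_carrier] by (simp add: mtr_def)

text \<open>Only products of diagonal coefficients with equal index survive orthogonality, and each
  of these \<open>n\<close> contributes \<open>card H / n\<close>.\<close>

lemma sum_character_product: "(\<Sum>g\<in>H. mtr (\<rho> g) * mtr (\<rho> (inv g))) = of_nat (card H)"
proof -
  have "(\<Sum>g\<in>H. mtr (\<rho> g) * mtr (\<rho> (inv g))) = (\<Sum>g\<in>H. \<Sum>p<n. \<Sum>q<n. \<rho> g $$ (p, p) * \<rho> (inv g) $$ (q, q))"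
    by (intro sum.cong refl) (simp add: mtr_rho sum_product)
  also have "\<dots> = (\<Sum>p<n. \<Sum>g\<in>H. \<Sum>q<n. \<rho> g $$ (p, p) * \<rho> (inv g) $$ (q, q))" by (rule sum.swap)
  also have "\<dots> = (\<Sum>p<n. \<Sum>q<n. \<Sum>g\<in>H. \<rho> g $$ (p, p) * \<rho> (inv g) $$ (q, q))"
    by (intro sum.cong refl sum.swap)
  also have "\<dots> = (\<Sum>p<n. \<Sum>q<n. if q = p then of_nat (card H) / of_nat n else 0)"
    by (intro sum.cong refl) (auto simp: orthogonality)
  also have "\<dots> = of_nat (card H)" using n_pos by simp
  finally show ?thesis .
qed

text \<open>Links the inner product of the statement, which uses conjugation, to the algebraic
  formulas, which use inverses.\<close>

lemma mtr_rho_inv: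
  assumes g: "g \<in> H"
  shows "mtr (\<rho> (inv g)) = cnj (mtr (\<rho> g))"
proof -
  have pw: "g [^] k \<in> H \<and> \<rho> (g [^] k) = \<rho> g ^\<^sub>m k" for k :: nat
  proof (induction k)
    case 0
    show ?case using rho_carrier[OF g] by (simp add: rho_one)
  next
    case (Suc k)
    then show ?case using g by (simp add: rho_mult)
  qed
  have "\<rho> g ^\<^sub>m Coset.order G = 1\<^sub>m n"
    using pw[of "Coset.order G"] pow_order_eq_1[OF H_carrier[OF g]] rho_one by simp
  moreover have "0 < Coset.order G" using finite_carrier order_gt_0_iff_finite by blast
  ultimately show ?thesis using g by (intro mtr_inverse_finite_order) (auto simp: rho_inv)
qed

text \<open>Fourier inversion: the element of the block on which \<open>Rl\<close> takes the value
  \<open>X\<close>. The factor \<open>n / card H\<close> makes the identity matrix correspond to the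
  central idempotent.\<close>

definition \<Phi> :: "complex mat \<Rightarrow> 'a \<Rightarrow> complex"
  where "\<Phi> X g = (if g \<in> H then of_nat n / of_nat (card H) * mtr (X * \<rho> (inv g)) else 0)"

lemma \<Phi>_supp [simp]: "\<Phi> X \<in> supp_in H"
  by (simp add: \<Phi>_def supp_in_def)

lemma \<Phi>_add: "X \<in> carrier_mat n n \<Longrightarrow> Y \<in> carrier_mat n n \<Longrightarrow> \<Phi> (X + Y) = \<Phi> X + \<Phi> Y"
proof
  fix g assume XY: "X \<in> carrier_mat n n" "Y \<in> carrier_mat n n"
  show "\<Phi> (X + Y) g = (\<Phi> X + \<Phi> Y) g"
  proof (cases "g \<in> H")
    case True
    have "mtr ((X + Y) * \<rho> (inv g)) = mtr (X * \<rho> (inv g)) + mtr (Y * \<rho> (inv g))"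
      using add_mult_distrib_mat[OF XY rho_carrier, of "inv g"] True XY mtr_add[of "X * \<rho> (inv g)" n "Y * \<rho> (inv g)"]
      by simp
    then show ?thesis using True by (simp add: \<Phi>_def distrib_left)
  qed (simp add: \<Phi>_def)
qed

lemma \<Phi>_scale: "X \<in> carrier_mat n n \<Longrightarrow> \<Phi> (c \<cdot>\<^sub>m X) = c \<cdot>\<^sub>f \<Phi> X"
proof
  fix g assume X: "X \<in> carrier_mat n n"
  show "\<Phi> (c \<cdot>\<^sub>m X) g = (c \<cdot>\<^sub>f \<Phi> X) g"
  proof (cases "g \<in> H")
    case True
    have "mtr ((c \<cdot>\<^sub>m X) * \<rho> (inv g)) = c * mtr (X * \<rho> (inv g))"
      using mult_smult_assoc_mat[OF X rho_carrier, of "inv g"] True X mtr_smult[of "X * \<rho> (inv g)" n] by simp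
    then show ?thesis using True by (simp add: \<Phi>_def)
  qed (simp add: \<Phi>_def)
qed

lemma delta_\<Phi>:
  assumes l: "l \<in> H" and X: "X \<in> carrier_mat n n"
  shows "\<delta> l \<star> \<Phi> X = \<Phi> (\<rho> l * X)"
proof
  fix g
  have "inv l \<otimes> g \<in> H \<longleftrightarrow> g \<in> H" if "g \<in> carrier G"
    using l that subgroup.mem_carrier[OF subgroup_H] H_closed
    by (metis H_carrier inv_closed inv_solve_left m_closed)
  moreover have "mtr (X * \<rho> (inv (inv l \<otimes> g))) = mtr (\<rho> l * X * \<rho> (inv g))" if g: "g \<in> H"
  proof -
    have "X * \<rho> (inv (inv l \<otimes> g)) = X * \<rho> (inv g) * \<rho> l"
      using g l X by (simp add: inv_mult_group H_carrier rho_mult assoc_mult_mat[of _ n n _ n _ n])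
    also have "mtr (X * \<rho> (inv g) * \<rho> l) = mtr (\<rho> l * (X * \<rho> (inv g)))"
      using g l X by (intro mtr_comm[of _ n]) auto
    finally show ?thesis using g l X by (simp add: assoc_mult_mat[of _ n n _ n _ n])
  qed
  ultimately show "(\<delta> l \<star> \<Phi> X) g = \<Phi> (\<rho> l * X) g"
    using l H_carrier by (auto simp: delta_conv \<Phi>_def)
qed

lemma \<Phi>_delta:
  assumes l: "l \<in> H" and X: "X \<in> carrier_mat n n"
  shows "\<Phi> X \<star> \<delta> l = \<Phi> (X * \<rho> l)"
proof
  fix g
  have "g \<otimes> inv l \<in> H \<longleftrightarrow> g \<in> H" if "g \<in> carrier G"
    using l that H_closed by (metis H_carrier inv_closed inv_solve_right m_closed)
  moreover have "X * \<rho> (inv (g \<otimes> inv l)) = X * \<rho> l * \<rho> (inv g)" if g: "g \<in> H"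
    using g l X by (simp add: inv_mult_group H_carrier rho_mult assoc_mult_mat[of _ n n _ n _ n])
  ultimately show "(\<Phi> X \<star> \<delta> l) g = \<Phi> (X * \<rho> l) g"
    using l H_carrier by (auto simp: conv_delta \<Phi>_def)
qed

lemma Rl_\<Phi>:
  assumes X: "X \<in> carrier_mat n n"
  shows "Rl (\<Phi> X) = X"
proof (rule Rl_eqI[OF X])
  fix p q assume pq: "p < n" "q < n"
  have "(\<Sum>g\<in>H. \<Phi> X g * \<rho> g $$ (p, q)) =
     (\<Sum>g\<in>H. \<Sum>i<n. \<Sum>j<n. of_nat n / of_nat (card H) * X $$ (i, j) * (\<rho> g $$ (p, q) * \<rho> (inv g) $$ (j, i)))"
    using X by (intro sum.cong refl) (simp add: \<Phi>_def mtr_mult_sum[of _ n] sum_distrib_left sum_distrib_right mult_ac)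
  also have "\<dots> = (\<Sum>i<n. \<Sum>g\<in>H. \<Sum>j<n. of_nat n / of_nat (card H) * X $$ (i, j) * (\<rho> g $$ (p, q) * \<rho> (inv g) $$ (j, i)))"
    by (rule sum.swap)
  also have "\<dots> = (\<Sum>i<n. \<Sum>j<n. \<Sum>g\<in>H. of_nat n / of_nat (card H) * X $$ (i, j) * (\<rho> g $$ (p, q) * \<rho> (inv g) $$ (j, i)))"
    by (intro sum.cong refl sum.swap)
  also have "\<dots> = (\<Sum>i<n. \<Sum>j<n. if j = q then (if i = p then X $$ (p, q) else 0) else 0)"
  proof (intro sum.cong refl)
    fix i j assume "i \<in> {..<n}" "j \<in> {..<n}"
    then show "(\<Sum>g\<in>H. of_nat n / of_nat (card H) * X $$ (i, j) * (\<rho> g $$ (p, q) * \<rho> (inv g) $$ (j, i)))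
      = (if j = q then (if i = p then X $$ (p, q) else 0) else 0)"
      unfolding sum_distrib_left[symmetric] using pq n_pos card_H by (auto simp: orthogonality)
  qed
  also have "\<dots> = X $$ (p, q)" using pq by simp
  finally show "(\<Sum>g\<in>H. \<Phi> X g * \<rho> g $$ (p, q)) = X $$ (p, q)" .
qed

lemma Rl_sum: "finite I \<Longrightarrow> Rl (\<Sum>i\<in>I. f i) = msum n (\<lambda>i. Rl (f i)) I"
  by (rule Rl_eqI) (simp_all add: index_Rl sum_fun_apply sum_distrib_right sum.swap[of _ H])

lemma sum_induct_supp [consumes 1, case_names add scale delta]:
  assumes "a \<in> supp_in H" and "\<And>u v. P u \<Longrightarrow> P v \<Longrightarrow> P (u + v)"
    and "\<And>c u. P u \<Longrightarrow> P (c \<cdot>\<^sub>f u)" and "\<And>x. x \<in> H \<Longrightarrow> P (\<delta> x)"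
  shows "P a"
proof -
  have "P (0 \<cdot>\<^sub>f \<delta> \<one>)" by (intro assms(3,4)) simp
  moreover have "0 \<cdot>\<^sub>f \<delta> \<one> = 0" by (simp add: fun_eq_iff)
  ultimately have "P 0" by simp
  have "P (\<Sum>x\<in>I. a x \<cdot>\<^sub>f \<delta> x)" if "I \<subseteq> H" for I
    using finite_subset[OF that finite_H] that
    by (induction I rule: finite_induct) (use \<open>P 0\<close> assms in \<open>simp_all only: sum.empty sum.insert insert_subset not_False_eq_True\<close>)
  then show ?thesis using sum_delta[OF finite_H assms(1)] by (metis order_refl)
qed

text \<open>Together with \<open>\<Phi>_conv\<close> this makes the image of \<open>\<Phi>\<close> a
  two-sided ideal in which multiplication is matrix multiplication. It suffices to check group
  elements, by linearity.\<close>

lemma conv_\<Phi>: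
  assumes a: "a \<in> supp_in H" and X: "X \<in> carrier_mat n n"
  shows "a \<star> \<Phi> X = \<Phi> (Rl a * X)"
  using a
proof (induction rule: sum_induct_supp)
  case (add u v)
  then show ?case using X
    by (simp only: conv_add_left Rl_add add_mult_distrib_mat[OF Rl_carrier Rl_carrier X] \<Phi>_add[OF mult_carrier_mat[OF Rl_carrier X] mult_carrier_mat[OF Rl_carrier X]])
next
  case (scale c u)
  then show ?case using X
    by (simp only: conv_scale_left Rl_scale mult_smult_assoc_mat[OF Rl_carrier X] \<Phi>_scale[OF mult_carrier_mat[OF Rl_carrier X]])
next
  case (delta x)
  then show ?case using X by (simp add: delta_\<Phi> Rl_delta)
qed

lemma \<Phi>_conv:
  assumes a: "a \<in> supp_in H" and X: "X \<in> carrier_mat n n"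
  shows "\<Phi> X \<star> a = \<Phi> (X * Rl a)"
  using a
proof (induction rule: sum_induct_supp)
  case (add u v)
  then show ?case using X
    by (simp only: conv_add_right Rl_add mult_add_distrib_mat[OF X Rl_carrier Rl_carrier] \<Phi>_add[OF mult_carrier_mat[OF X Rl_carrier] mult_carrier_mat[OF X Rl_carrier]])
next
  case (scale c u)
  then show ?case using X
    by (simp only: conv_scale_right Rl_scale mult_smult_distrib[OF X Rl_carrier] \<Phi>_scale[OF mult_carrier_mat[OF X Rl_carrier]])
next
  case (delta x)
  then show ?case using X by (simp add: \<Phi>_delta Rl_delta)
qed

lemma \<Phi>_\<Phi>: "X \<in> carrier_mat n n \<Longrightarrow> Y \<in> carrier_mat n n \<Longrightarrow> \<Phi> X \<star> \<Phi> Y = \<Phi> (X * Y)"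
  by (simp add: conv_\<Phi> Rl_\<Phi>)

lemma \<Phi>_one: "\<Phi> (1\<^sub>m n) = char_idem G H (rep_character (subgrp G H) n \<rho>)"
proof
  fix g
  have "rep_character (subgrp G H) n \<rho> l = mtr (\<rho> l)" if "l \<in> H" for l
    using that by (simp add: rep_character_def mtr_rho)
  then show "\<Phi> (1\<^sub>m n) g = char_idem G H (rep_character (subgrp G H) n \<rho>) g"
    by (auto simp: \<Phi>_def char_idem_def rho_one mtr_one)
qed

text \<open>The sum lies in the block, so it is determined by its image under \<open>Rl\<close>,
  where the matrix average applies.\<close>

lemma conj_average:
  assumes X: "X \<in> carrier_mat n n"
  shows "(\<Sum>g\<in>H. \<delta> g \<star> \<Phi> X \<star> \<delta> (inv g)) = (of_nat (card H) / of_nat n * mtr X) \<cdot>\<^sub>f \<Phi> (1\<^sub>m n)"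
proof -
  have "\<delta> g \<star> \<Phi> X \<star> \<delta> (inv g) = \<Phi> (\<rho> g * X * \<rho> (inv g))" if "g \<in> H" for g
    using that X by (simp add: delta_\<Phi> \<Phi>_delta)
  then have eq: "(\<Sum>g\<in>H. \<delta> g \<star> \<Phi> X \<star> \<delta> (inv g)) = (\<Sum>g\<in>H. \<Phi> (\<rho> g * X * \<rho> (inv g)))"
    by (intro sum.cong) auto
  let ?u = "\<Sum>g\<in>H. \<Phi> (\<rho> g * X * \<rho> (inv g))"
  have u: "?u = ?u \<star> \<Phi> (1\<^sub>m n)"
    unfolding conv_sum_left using X by (intro sum.cong) (auto simp: \<Phi>_\<Phi>)
  have "?u \<in> supp_in H" by (intro supp_in_sum) simp
  then have "?u = \<Phi> (Rl ?u)" by (subst u) (simp add: conv_\<Phi>)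
  also have "Rl ?u = msum n (\<lambda>g. \<rho> g * X * \<rho> (inv g)) H"
    unfolding Rl_sum[OF finite_H] using mult3_carrier X by (intro msum_cong) (simp add: Rl_\<Phi>)
  finally show ?thesis unfolding eq by (simp only: average[OF X] \<Phi>_scale[OF one_carrier_mat])
qed

end

lemma mtr_unit_mat_mult:
  assumes "M \<in> carrier_mat n n" "k < n" "l < n"
  shows "mtr (unit_mat n k l * M) = M $$ (l, k)"
proof -
  have "mtr (unit_mat n k l * M) = (\<Sum>i<n. \<Sum>j<n. if j = l then (if i = k then M $$ (l, k) else 0) else 0)"
    unfolding mtr_mult_sum[OF unit_mat_carrier assms(1)]
    by (intro sum.cong refl) (auto simp: unit_mat_def)
  then show ?thesis using assms by simp
qed

section \<open>The units \<open>c\<^sub>x\<close>\<close>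

text \<open>The hypotheses of the theorem in matrix form, \<open>\<rho>\<close> affording the
  character of \<open>L\<close> and \<open>\<tau>\<close> the one of \<open>K\<close>. Full
  ramification appears as \<open>vanishes\<close>.\<close>

locale fully_ramified_section = finite_group_algebra G + lo: subgroup_irrep G L n \<rho> + up: subgroup_irrep G K d \<tau>
  for G :: "('a, 'b) monoid_scheme" (structure) and L n \<rho> K d \<tau> +
  assumes normal_L: "L \<lhd> G" and normal_K: "K \<lhd> G" and L_K: "L \<subseteq> K"
    and rho_invariant: "x \<in> carrier G \<Longrightarrow> l \<in> L \<Longrightarrow> mtr (\<rho> (inv x \<otimes> l \<otimes> x)) = mtr (\<rho> l)"
    and above: "(\<Sum>l\<in>L. mtr (\<tau> l) * cnj (mtr (\<rho> l))) \<noteq> 0"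
    and vanishes: "k \<in> K \<Longrightarrow> k \<notin> L \<Longrightarrow> mtr (\<tau> k) = 0"
    and cosets_comm: "X \<in> r_coset G L ` K \<Longrightarrow> Y \<in> r_coset G L ` K \<Longrightarrow> X <#> Y = Y <#> X"
    and cosets_odd: "odd (card (r_coset G L ` K))"
begin

lemma L_G [simp]: "l \<in> L \<Longrightarrow> l \<in> carrier G" and K_G [simp]: "k \<in> K \<Longrightarrow> k \<in> carrier G"
  using lo.H_carrier up.H_carrier by auto

lemma L_conj [simp]: "x \<in> carrier G \<Longrightarrow> l \<in> L \<Longrightarrow> inv x \<otimes> l \<otimes> x \<in> L"
  using normal.inv_op_closed1[OF normal_L] by blast

definition e where "e = lo.\<Phi> (1\<^sub>m n)"

lemma e_supp [simp]: "e \<in> supp_in L"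
  by (simp add: e_def)

lemma conv_e: "a \<in> supp_in L \<Longrightarrow> a \<star> e = lo.\<Phi> (lo.Rl a)" and e_conv: "a \<in> supp_in L \<Longrightarrow> e \<star> a = lo.\<Phi> (lo.Rl a)"
  by (simp_all add: e_def lo.conv_\<Phi> lo.\<Phi>_conv)

lemma \<Phi>_e [simp]: "X \<in> carrier_mat n n \<Longrightarrow> lo.\<Phi> X \<star> e = lo.\<Phi> X" "X \<in> carrier_mat n n \<Longrightarrow> e \<star> lo.\<Phi> X = lo.\<Phi> X"
  by (simp_all add: e_def lo.\<Phi>_\<Phi>)

lemma e_e [simp]: "e \<star> e = e"
  unfolding e_def by (simp add: lo.\<Phi>_\<Phi>)

text \<open>Invariance of the character under \<open>G\<close> makes its idempotent fixed under
  conjugation.\<close>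

lemma delta_e:
  assumes x: "x \<in> carrier G"
  shows "\<delta> x \<star> e = e \<star> \<delta> x"
proof
  fix g
  show "(\<delta> x \<star> e) g = (e \<star> \<delta> x) g"
  proof (cases "g \<in> carrier G")
    case True
    define l where "l = g \<otimes> inv x"
    have l: "l \<in> carrier G" "inv x \<otimes> g = inv x \<otimes> l \<otimes> x" using x True by (auto simp: l_def m_assoc)
    have "l \<in> L \<longleftrightarrow> inv x \<otimes> l \<otimes> x \<in> L"
    proof
      assume 1: "inv x \<otimes> l \<otimes> x \<in> L"
      then have "x \<otimes> (inv x \<otimes> l \<otimes> x) \<otimes> inv x \<in> L" using normal.inv_op_closed2[OF normal_L x] by blast
      moreover have "x \<otimes> (inv x \<otimes> l \<otimes> x) \<otimes> inv x = l" using x l(1)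
        by (simp add: m_assoc) (simp add: m_assoc[symmetric])
      ultimately show "l \<in> L" by simp
    qed (use x in simp)
    moreover have "inv (inv x \<otimes> l \<otimes> x) = inv x \<otimes> inv l \<otimes> x" if "l \<in> L"
      using x l(1) by (simp add: inv_mult_group m_assoc)
    ultimately have "e (inv x \<otimes> l \<otimes> x) = e l"
      using rho_invariant[OF x, of "inv l"] x by (auto simp: e_def lo.\<Phi>_def)
    then show ?thesis using x True l by (simp add: delta_conv conv_delta l_def[symmetric])
  qed (simp add: conv_apply)
qed

text \<open>Existence of \<open>c\<^sub>x\<close>. By invariance \<open>\<rho>\<close> and its
  conjugate by \<open>x\<close> have the same character, and \<open>C\<close> is an explicit
  intertwiner between them: averages in the two directions multiply to a scalar, which can be made
  nonzero because the character has nonzero norm.\<close>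

lemma ex_unit:
  assumes x: "x \<in> carrier G"
  shows "\<exists>C D. C \<in> carrier_mat n n \<and> D \<in> carrier_mat n n \<and> C * D = 1\<^sub>m n \<and> D * C = 1\<^sub>m n \<and>
    (\<forall>l\<in>L. \<rho> (inv x \<otimes> l \<otimes> x) = D * \<rho> l * C)"
proof -
  define r where "r l = \<rho> (inv x \<otimes> l \<otimes> x)" for l
  have r_car [simp]: "r l \<in> carrier_mat n n" if "l \<in> L" for l
    using that x by (simp add: r_def)
  have r_mult: "r (l \<otimes> m) = r l * r m" if "l \<in> L" "m \<in> L" for l m
  proof -
    have "inv x \<otimes> (l \<otimes> m) \<otimes> x = (inv x \<otimes> l \<otimes> x) \<otimes> (inv x \<otimes> m \<otimes> x)"
      using that x by (simp add: m_assoc) (simp add: m_assoc[symmetric])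
    then show ?thesis using that x by (simp add: r_def lo.rho_mult)
  qed
  have r_one: "r \<one> = 1\<^sub>m n" using x by (simp add: r_def lo.rho_one)
  define N where "N X = msum n (\<lambda>l. \<rho> l * X * r (inv l)) L" for X
  define N' where "N' Y = msum n (\<lambda>l. r l * Y * \<rho> (inv l)) L" for Y
  have [simp]: "N X \<in> carrier_mat n n" "N' X \<in> carrier_mat n n" for X by (simp_all add: N_def N'_def)
  have N: "N X * r h = \<rho> h * N X" if "h \<in> L" "X \<in> carrier_mat n n" for X h
    unfolding N_def by (rule lo.msum_intertwines[OF lo.rho_carrier lo.rho_mult r_car r_mult r_one that])
  have N': "N' X * \<rho> h = r h * N' X" if "h \<in> L" "X \<in> carrier_mat n n" for X h
    unfolding N'_def by (rule lo.msum_intertwines[OF r_car r_mult lo.rho_carrier lo.rho_mult lo.rho_one that])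
  have NN': "N X * N' Y = (of_nat (card L) / of_nat n * mtr (X * N' Y)) \<cdot>\<^sub>m 1\<^sub>m n"
    if X: "X \<in> carrier_mat n n" and Y: "Y \<in> carrier_mat n n" for X Y
  proof -
    have "N X * N' Y = msum n (\<lambda>l. \<rho> l * X * r (inv l) * N' Y) L"
      using X unfolding N_def by (intro msum_mult) auto
    also have "\<dots> = msum n (\<lambda>l. \<rho> l * (X * N' Y) * \<rho> (inv l)) L"
    proof (rule msum_cong)
      fix l assume l: "l \<in> L"
      have "\<rho> l * X * r (inv l) * N' Y = \<rho> l * X * (r (inv l) * N' Y)"
        using l X by (simp add: assoc_mult_mat[of _ n n _ n _ n])
      also have "\<dots> = \<rho> l * (X * N' Y) * \<rho> (inv l)"
        using l X Y by (simp add: N'[symmetric] assoc_mult_mat[of _ n n _ n _ n])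
      finally show "\<rho> l * X * r (inv l) * N' Y = \<rho> l * (X * N' Y) * \<rho> (inv l)" .
    qed
    finally show ?thesis using lo.average[of "X * N' Y"] X by simp
  qed
  \<comment> \<open>The entry is the sum over \<open>l\<close> of
    \<open>r l $$ (p, p) * \<rho> (inv l) $$ (q, q)\<close>. Adding these over all \<open>p\<close>
    and \<open>q\<close> gives \<open>card L\<close>, so they cannot all vanish.\<close>
  have "\<exists>p q. p < n \<and> q < n \<and> N' (unit_mat n p q) $$ (p, q) \<noteq> 0"
  proof (rule ccontr)
    assume "\<not> ?thesis"
    then have 0: "N' (unit_mat n p q) $$ (p, q) = 0" if "p < n" "q < n" for p q using that by auto
    have "(\<Sum>l\<in>L. r l $$ (p, p) * \<rho> (inv l) $$ (q, q)) = 0" if pq: "p < n" "q < n" for p q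
      using 0[OF pq] pq by (simp add: N'_def index_mult_unit_mat_mult del: index_mult_mat)
    then have "(\<Sum>p<n. \<Sum>q<n. \<Sum>l\<in>L. r l $$ (p, p) * \<rho> (inv l) $$ (q, q)) = 0" by simp
    also have "(\<Sum>p<n. \<Sum>q<n. \<Sum>l\<in>L. r l $$ (p, p) * \<rho> (inv l) $$ (q, q)) =
       (\<Sum>p<n. \<Sum>l\<in>L. \<Sum>q<n. r l $$ (p, p) * \<rho> (inv l) $$ (q, q))"
      by (intro sum.cong refl sum.swap)
    also have "\<dots> = (\<Sum>l\<in>L. \<Sum>p<n. \<Sum>q<n. r l $$ (p, p) * \<rho> (inv l) $$ (q, q))" by (rule sum.swap)
    also have "\<dots> = (\<Sum>l\<in>L. mtr (r l) * mtr (\<rho> (inv l)))"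
      by (intro sum.cong refl) (simp add: r_def x lo.mtr_rho sum_product)
    also have "\<dots> = (\<Sum>l\<in>L. mtr (\<rho> l) * mtr (\<rho> (inv l)))"
      by (intro sum.cong refl) (simp add: r_def x rho_invariant)
    also have "\<dots> = of_nat (card L)" by (rule lo.sum_character_product)
    finally show False using lo.card_H by simp
  qed
  then obtain p q where pq: "p < n" "q < n" "N' (unit_mat n p q) $$ (p, q) \<noteq> 0" by blast
  \<comment> \<open>The indices are swapped here so that the trace of
    \<open>unit_mat n q p * D0\<close> is the nonzero entry \<open>(p, q)\<close>.\<close>
  define C where "C = N (unit_mat n q p)"
  define D0 where "D0 = N' (unit_mat n p q)"
  define c where "c = of_nat (card L) / of_nat n * D0 $$ (p, q)"
  have c: "c \<noteq> 0" "C * D0 = c \<cdot>\<^sub>m 1\<^sub>m n"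
    using pq lo.card_H lo.n_pos NN'[of "unit_mat n q p" "unit_mat n p q"]
    by (simp_all add: c_def C_def D0_def mtr_unit_mat_mult)
  define D where "D = (1 / c) \<cdot>\<^sub>m D0"
  have car: "C \<in> carrier_mat n n" "D0 \<in> carrier_mat n n" "D \<in> carrier_mat n n" by (simp_all add: C_def D_def D0_def)
  have CD: "C * D = 1\<^sub>m n"
  proof -
    have "C * D = (1 / c) \<cdot>\<^sub>m (c \<cdot>\<^sub>m 1\<^sub>m n)" using car c by (simp add: D_def mult_smult_distrib[of _ n n _ n])
    then show ?thesis using c by (auto intro!: eq_matI)
  qed
  have DC: "D * C = 1\<^sub>m n" using mat_mult_left_right_inverse[OF car(1,3) CD] .
  have "\<rho> (inv x \<otimes> l \<otimes> x) = D * \<rho> l * C" if l: "l \<in> L" for l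
  proof -
    have "D * \<rho> l * C = D * (C * r l)" using car l N[OF l, of "unit_mat n q p"]
      by (simp add: C_def[symmetric] assoc_mult_mat[of _ n n _ n _ n])
    also have "\<dots> = r l" using car l DC assoc_mult_mat[OF car(3,1) r_car[OF l]] by simp
    finally show ?thesis by (simp add: r_def)
  qed
  then show ?thesis using car CD DC by blast
qed

text \<open>A simultaneous choice of the matrix of \<open>c\<^sub>x\<close> and of its
  inverse.\<close>

definition CD where "CD x = (SOME (C, D). C \<in> carrier_mat n n \<and> D \<in> carrier_mat n n \<and> C * D = 1\<^sub>m n \<and> D * C = 1\<^sub>m n \<and>
    (\<forall>l\<in>L. \<rho> (inv x \<otimes> l \<otimes> x) = D * \<rho> l * C))"

definition cu where "cu x = lo.\<Phi> (fst (CD x))"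
definition ci where "ci x = lo.\<Phi> (snd (CD x))"

lemma CD:
  assumes "x \<in> carrier G"
  shows "fst (CD x) \<in> carrier_mat n n" "snd (CD x) \<in> carrier_mat n n"
    "fst (CD x) * snd (CD x) = 1\<^sub>m n" "snd (CD x) * fst (CD x) = 1\<^sub>m n"
    "l \<in> L \<Longrightarrow> \<rho> (inv x \<otimes> l \<otimes> x) = snd (CD x) * \<rho> l * fst (CD x)"
proof -
  have "case CD x of (C, D) \<Rightarrow> C \<in> carrier_mat n n \<and> D \<in> carrier_mat n n \<and> C * D = 1\<^sub>m n \<and> D * C = 1\<^sub>m n \<and>
    (\<forall>l\<in>L. \<rho> (inv x \<otimes> l \<otimes> x) = D * \<rho> l * C)"
    unfolding CD_def using ex_unit[OF assms] by (rule_tac someI_ex) auto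
  then show "fst (CD x) \<in> carrier_mat n n" "snd (CD x) \<in> carrier_mat n n"
    "fst (CD x) * snd (CD x) = 1\<^sub>m n" "snd (CD x) * fst (CD x) = 1\<^sub>m n"
    "l \<in> L \<Longrightarrow> \<rho> (inv x \<otimes> l \<otimes> x) = snd (CD x) * \<rho> l * fst (CD x)"
    by (auto split: prod.splits)
qed

lemma cu_ci: "x \<in> carrier G \<Longrightarrow> cu x \<star> ci x = e" "x \<in> carrier G \<Longrightarrow> ci x \<star> cu x = e"
  by (simp_all add: cu_def ci_def e_def lo.\<Phi>_\<Phi> CD)

lemma cu_ci_e [simp]:
  assumes "x \<in> carrier G"
  shows "cu x \<star> e = cu x" "e \<star> cu x = cu x" "ci x \<star> e = ci x" "e \<star> ci x = ci x"
  using CD(1,2)[OF assms] by (simp_all add: cu_def ci_def)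

lemma cu_ci_supp [simp]: "cu x \<in> supp_in L" "ci x \<in> supp_in L"
  by (simp_all add: cu_def ci_def)

lemma delta_inv: "x \<in> carrier G \<Longrightarrow> \<delta> x \<star> \<delta> (inv x) = \<delta> \<one>" "x \<in> carrier G \<Longrightarrow> \<delta> (inv x) \<star> \<delta> x = \<delta> \<one>"
  by (simp_all add: delta_delta)

lemma supp_L_G [simp]: "a \<in> supp_in L \<Longrightarrow> a \<in> supp_in (carrier G)"
  by (erule supp_in_mono) auto

lemma conj_e:
  assumes x: "x \<in> carrier G" and a: "a \<in> supp_in L"
  shows "\<delta> (inv x) \<star> a \<star> \<delta> x \<star> e = ci x \<star> a \<star> cu x"
  using a
proof (induction rule: lo.sum_induct_supp)
  case (add u v)
  then show ?case by (simp only: conv_add_left conv_add_right)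
next
  case (scale c u)
  then show ?case by (simp only: conv_scale_left conv_scale_right)
next
  case (delta l)
  then have "\<delta> (inv x) \<star> \<delta> l \<star> \<delta> x \<star> e = \<delta> (inv x \<otimes> l \<otimes> x) \<star> e" using x by (simp add: delta_delta)
  also have "\<dots> = lo.\<Phi> (\<rho> (inv x \<otimes> l \<otimes> x))" using x delta by (simp add: e_def lo.delta_\<Phi>)
  also have "\<dots> = ci x \<star> \<delta> l \<star> cu x" using x delta CD[OF x]
    by (simp add: ci_def cu_def lo.\<Phi>_delta lo.\<Phi>_\<Phi>)
  finally show ?case .
qed

lemma conj_CLe:
  assumes x: "x \<in> carrier G" and a: "a \<in> supp_in L" "a \<star> e = a"
  shows "\<delta> (inv x) \<star> a \<star> \<delta> x = ci x \<star> a \<star> cu x"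
proof -
  have "\<delta> (inv x) \<star> a \<star> \<delta> x = \<delta> (inv x) \<star> (a \<star> e) \<star> \<delta> x" using a by simp
  also have "\<dots> = \<delta> (inv x) \<star> a \<star> \<delta> x \<star> e" using delta_e[OF x] by (simp add: conv_assoc)
  finally show ?thesis using conj_e[OF x a(1)] by simp
qed

definition w where "w x = \<delta> x \<star> ci x"
definition w' where "w' x = cu x \<star> \<delta> (inv x)"

lemma w_e [simp]: "x \<in> carrier G \<Longrightarrow> w x \<star> e = w x" "x \<in> carrier G \<Longrightarrow> e \<star> w x = w x"
  by (simp add: w_def conv_assoc) (simp add: w_def conv_assoc[symmetric] delta_e[symmetric], simp add: conv_assoc)

lemma w'_e [simp]: "x \<in> carrier G \<Longrightarrow> w' x \<star> e = w' x" "x \<in> carrier G \<Longrightarrow> e \<star> w' x = w' x"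
  by (simp add: w'_def conv_assoc delta_e, simp add: conv_assoc[symmetric]) (simp add: w'_def conv_assoc[symmetric])

lemma w_w': "x \<in> carrier G \<Longrightarrow> w x \<star> w' x = e"
proof -
  assume x: "x \<in> carrier G"
  have "w x \<star> w' x = \<delta> x \<star> (ci x \<star> cu x) \<star> \<delta> (inv x)" by (simp add: w_def w'_def conv_assoc)
  also have "\<dots> = e \<star> (\<delta> x \<star> \<delta> (inv x))" using x by (simp add: cu_ci delta_e conv_assoc)
  finally show ?thesis using x by (simp add: delta_inv conv_one)
qed

lemma w'_w: "x \<in> carrier G \<Longrightarrow> w' x \<star> w x = e"
proof -
  assume x: "x \<in> carrier G"
  have "w' x \<star> w x = cu x \<star> (\<delta> (inv x) \<star> \<delta> x) \<star> ci x" by (simp add: w_def w'_def conv_assoc)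
  also have "\<dots> = e" using x by (simp add: delta_inv conv_one cu_ci)
  finally show ?thesis .
qed

lemma w_cu: "x \<in> carrier G \<Longrightarrow> w x \<star> cu x = \<delta> x \<star> e"
  by (simp add: w_def conv_assoc cu_ci)

text \<open>On \<open>\<complex>Le\<^sub>\<phi>\<close> conjugation by \<open>x\<close> agrees with
  conjugation by \<open>cu x\<close>, so their quotient \<open>w x\<close> centralises it; the part
  of \<open>a\<close> outside this block is killed by \<open>e\<close>.\<close>

lemma w_commutes:
  assumes x: "x \<in> carrier G" and a: "a \<in> supp_in L"
  shows "a \<star> w x = w x \<star> a"
proof -
  have a': "a \<star> e \<in> supp_in L" "a \<star> e \<star> e = a \<star> e"
    using a by (auto simp: conv_assoc intro: supp_in_conv_subgroup[OF lo.subgroup_H])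
  have "\<delta> x \<star> (\<delta> (inv x) \<star> (a \<star> e) \<star> \<delta> x) = \<delta> x \<star> (ci x \<star> (a \<star> e) \<star> cu x)"
    using conj_CLe[OF x a'] by simp
  then have "\<delta> \<one> \<star> (a \<star> e) \<star> \<delta> x = w x \<star> (a \<star> e) \<star> cu x"
    using x by (simp add: w_def conv_assoc[symmetric] delta_inv)
  then have "a \<star> e \<star> \<delta> x \<star> ci x = w x \<star> (a \<star> e) \<star> (cu x \<star> ci x)"
    using a' by (simp add: one_conv conv_assoc)
  then have "a \<star> (e \<star> w x) = w x \<star> (a \<star> e \<star> e)" using x by (simp add: w_def cu_ci conv_assoc)
  moreover have "a \<star> e = e \<star> a" using a by (simp add: conv_e e_conv)
  ultimately show ?thesis using x by (simp add: conv_assoc) (simp add: conv_assoc[symmetric])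
qed

section \<open>The graded components of the centraliser\<close>

definition comp where "comp X = {u \<in> supp_in X. u \<star> e = u \<and> (\<forall>a\<in>supp_in L. a \<star> u = u \<star> a)}"

lemma comp_mult: "u \<in> comp X \<Longrightarrow> v \<in> comp Y \<Longrightarrow> u \<star> v \<in> comp (X <#> Y)"
  by (auto simp: comp_def supp_in_conv conv_assoc) (metis conv_assoc)

lemma e_comp: "u \<in> comp X \<Longrightarrow> e \<star> u = u"
  by (auto simp: comp_def)

lemma comp_scale: "u \<in> comp X \<Longrightarrow> c \<cdot>\<^sub>f u \<in> comp X"
  by (auto simp: comp_def conv_scale_left conv_scale_right supp_in_scale)

lemma w_comp:
  assumes x: "x \<in> carrier G"
  shows "w x \<in> comp (L #> x)"
proof -
  have "w x \<in> supp_in ({x} <#> L)" unfolding w_def by (intro supp_in_conv supp_in_delta) auto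
  moreover have "{x} <#> L = L #> x" using normal.coset_eq[OF normal_L] x by (auto simp: l_coset_def set_mult_def)
  ultimately show ?thesis using x w_commutes by (simp add: comp_def)
qed

lemma w'_comp:
  assumes x: "x \<in> carrier G"
  shows "w' x \<in> comp (L #> inv x)"
proof -
  have "w' x \<in> supp_in (L <#> {inv x})" unfolding w'_def by (intro supp_in_conv supp_in_delta) auto
  moreover have "L <#> {inv x} = L #> inv x" by (auto simp: r_coset_def set_mult_def)
  moreover have "a \<star> w' x = w' x \<star> a" if a: "a \<in> supp_in L" for a
  proof -
    have ae: "a \<star> e = e \<star> a" using a by (simp add: conv_e e_conv)
    have "a \<star> w' x = e \<star> a \<star> w' x" using x ae by (metis conv_assoc w'_e(2))
    also have "\<dots> = w' x \<star> (w x \<star> a) \<star> w' x" using x by (simp add: w'_w[symmetric] conv_assoc)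
    also have "\<dots> = w' x \<star> a \<star> (w x \<star> w' x)" using w_commutes[OF x a] by (metis conv_assoc)
    also have "\<dots> = w' x \<star> a" using x ae by (metis conv_assoc w'_e(1) w_w')
    finally show ?thesis .
  qed
  ultimately show ?thesis using x by (simp add: comp_def)
qed

text \<open>The component of the trivial coset is the centre of a full matrix algebra.\<close>

lemma comp_L_scalar:
  assumes "u \<in> comp L"
  obtains c where "u = c \<cdot>\<^sub>f e"
proof -
  have u: "u \<in> supp_in L" "u \<star> e = u" "\<And>a. a \<in> supp_in L \<Longrightarrow> a \<star> u = u \<star> a" using assms by (auto simp: comp_def)
  define M where "M = lo.Rl u"
  have uM: "u = lo.\<Phi> M" using u conv_e[of u] by (simp add: M_def)
  have M: "M \<in> carrier_mat n n" by (simp add: M_def)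
  have "M * \<rho> l = \<rho> l * M" if l: "l \<in> L" for l
  proof -
    have "lo.\<Phi> (\<rho> l * M) = lo.\<Phi> (M * \<rho> l)"
      using u(3)[OF supp_in_delta[OF l]] unfolding uM lo.delta_\<Phi>[OF l M] lo.\<Phi>_delta[OF l M] .
    then have "lo.Rl (lo.\<Phi> (\<rho> l * M)) = lo.Rl (lo.\<Phi> (M * \<rho> l))" by simp
    then show ?thesis using l M by (simp add: lo.Rl_\<Phi>)
  qed
  then obtain c where "M = c \<cdot>\<^sub>m 1\<^sub>m n" using lo.schur[of M] M by auto
  then have "u = c \<cdot>\<^sub>f e" using uM by (simp add: e_def lo.\<Phi>_scale)
  then show thesis by (rule that)
qed

text \<open>Multiplication by \<open>w' x\<close> moves the component of \<open>x\<close> into that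
  of the trivial coset. So every component is a line spanned by a unit.\<close>

lemma comp_w:
  assumes x: "x \<in> carrier G" and u: "u \<in> comp (L #> x)"
  obtains c where "u = c \<cdot>\<^sub>f w x"
proof -
  have "(L #> inv x) <#> (L #> x) = L"
    using normal.rcos_sum[OF normal_L, of "inv x" x] x coset_mult_one[OF subgroup.subset[OF lo.subgroup_H]] by simp
  then have "w' x \<star> u \<in> comp L" using comp_mult[OF w'_comp[OF x] u] by simp
  then obtain c where c: "w' x \<star> u = c \<cdot>\<^sub>f e" by (rule comp_L_scalar)
  have "u = w x \<star> (w' x \<star> u)" using w_w'[OF x] e_comp[OF u] by (simp add: conv_assoc[symmetric])
  then have "u = c \<cdot>\<^sub>f w x" using c x by (simp add: conv_scale_right)
  then show thesis by (rule that)
qed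

text \<open>Being central, \<open>e\<close> acts on the irreducible \<open>\<tau>\<close> as an
  idempotent scalar; its trace is a nonzero multiple of the inner product in \<open>above\<close>,
  so the scalar is 1.\<close>

lemma up_e: "up.Rl e = 1\<^sub>m d"
proof -
  have eK: "e \<in> supp_in K" using supp_in_mono[OF e_supp L_K] .
  have "up.Rl e * \<tau> k = \<tau> k * up.Rl e" if k: "k \<in> K" for k
    using delta_e[of k] k eK up.Rl_conv[of e "\<delta> k"] up.Rl_conv[of "\<delta> k" e] by (simp add: up.Rl_delta supp_in_delta)
  then obtain c where c: "up.Rl e = c \<cdot>\<^sub>m 1\<^sub>m d" using up.schur[of "up.Rl e"] by auto
  have "up.Rl e * up.Rl e = up.Rl e" using up.Rl_conv[OF eK eK] by simp
  then have "(up.Rl e * up.Rl e) $$ (0, 0) = up.Rl e $$ (0, 0)" by simp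
  then have cc: "c * c = c" using up.n_pos unfolding c
    by (simp add: mult_smult_distrib[of _ d d _ d] mult_smult_assoc_mat[of _ d d _ d])
  have "mtr (up.Rl e) = (\<Sum>g\<in>L. e g * mtr (\<tau> g))"
    unfolding up.mtr_Rl using L_K e_supp by (intro sum.mono_neutral_right) (auto simp: supp_in_def)
  also have "\<dots> = (\<Sum>g\<in>L. of_nat n / of_nat (card L) * (mtr (\<tau> g) * cnj (mtr (\<rho> g))))"
    by (intro sum.cong refl) (simp add: e_def lo.\<Phi>_def lo.mtr_rho_inv)
  also have "\<dots> \<noteq> 0" unfolding sum_distrib_left[symmetric] using above lo.n_pos lo.card_H by simp
  finally have "c \<noteq> 0" unfolding c by (auto simp: mtr_def)
  then show ?thesis using cc c by (auto intro!: eq_matI)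
qed

definition rep where "rep X = (SOME x. x \<in> X)"

lemma rep:
  assumes "X \<in> carrier (G Mod L)"
  shows "rep X \<in> carrier G" "L #> rep X = X"
proof -
  obtain x where x: "x \<in> carrier G" "X = L #> x" using assms by (auto simp: FactGroup_def RCOSETS_def)
  have "x \<in> X" using x rcos_self[OF x(1) lo.subgroup_H] by simp
  then have rX: "rep X \<in> X" unfolding rep_def by (rule someI)
  then show "rep X \<in> carrier G" using x r_coset_subset_G[OF subgroup.subset[OF lo.subgroup_H] x(1)] by blast
  show "L #> rep X = X" using repr_independence[OF _ x(1) lo.subgroup_H, of "rep X"] rX x by simp
qed

text \<open>The representative is arbitrary: another one changes the basis element by a nonzero
  scalar, as \<open>w_W\<close> shows.\<close>

definition W where "W X = w (rep X)"
definition W' where "W' X = w' (rep X)"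

definition A where "A = r_coset G L ` K"

lemma A_Q [simp]: "X \<in> A \<Longrightarrow> X \<in> carrier (G Mod L)"
  by (auto simp: A_def FactGroup_def RCOSETS_def)

lemma W_comp: "X \<in> carrier (G Mod L) \<Longrightarrow> W X \<in> comp X"
  using w_comp[OF rep(1)] rep(2) by (simp add: W_def)

lemma comp_W:
  assumes "X \<in> carrier (G Mod L)" "u \<in> comp X"
  obtains c where "u = c \<cdot>\<^sub>f W X"
  using comp_w[OF rep(1), of X u] rep(2) assms unfolding W_def by auto

lemma rep_A: "X \<in> A \<Longrightarrow> rep X \<in> K"
proof -
  assume X: "X \<in> A"
  then obtain k where k: "k \<in> K" "X = L #> k" by (auto simp: A_def)
  have "rep X \<in> X" using rep[of X] rcos_self[OF _ lo.subgroup_H, of "rep X"] X by simp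
  then show ?thesis using k L_K by (auto simp: r_coset_def)
qed

lemma e_neq_0: "e \<noteq> 0"
proof -
  have "up.Rl 0 = 0 \<cdot>\<^sub>m 1\<^sub>m d" by (rule up.Rl_eqI) auto
  moreover have "(1\<^sub>m d :: complex mat) $$ (0, 0) \<noteq> (0 \<cdot>\<^sub>m 1\<^sub>m d) $$ (0, 0)" using up.n_pos by simp
  ultimately show ?thesis using up_e by metis
qed

lemma w_W:
  assumes x: "x \<in> carrier G"
  obtains c where "c \<noteq> 0" "w x = c \<cdot>\<^sub>f W (L #> x)"
proof -
  have X: "L #> x \<in> carrier (G Mod L)" using x by (auto simp: FactGroup_def RCOSETS_def)
  obtain c where c: "w x = c \<cdot>\<^sub>f W (L #> x)" using comp_W[OF X w_comp[OF x]] .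
  moreover have "c \<noteq> 0"
  proof
    assume "c = 0"
    then have "w x = 0" using c by (simp add: fun_eq_iff)
    then show False using w_w'[OF x] e_neq_0 by simp
  qed
  ultimately show thesis using that by blast
qed

lemma comp_A_supp: "X \<in> A \<Longrightarrow> u \<in> comp X \<Longrightarrow> u \<in> supp_in K"
proof -
  assume "X \<in> A" "u \<in> comp X"
  moreover from this have "X \<subseteq> K" using L_K by (auto simp: A_def r_coset_def)
  ultimately show "u \<in> supp_in K" using supp_in_mono by (auto simp: comp_def)
qed

text \<open>Traces only see the component of the trivial coset, as \<open>\<theta>\<close> vanishes off \<open>L\<close>.\<close>

lemma trace_comp:
  assumes "X \<in> A" "X \<noteq> L" "u \<in> supp_in X"
  shows "mtr (up.Rl u) = 0"
proof -
  obtain k where k: "k \<in> K" "X = L #> k" using assms by (auto simp: A_def)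
  have "g \<notin> L" if "g \<in> X" for g
  proof
    assume "g \<in> L"
    then have "L #> g = L" by (simp add: lo.subgroup_H subgroup.rcos_const)
    moreover have "L #> g = L #> k" using repr_independence[of g L k] that k lo.subgroup_H by simp
    ultimately show False using k assms(2) by simp
  qed
  then have "u g * mtr (\<tau> g) = 0" if "g \<in> K" for g
    using vanishes[OF that] assms(3) by (cases "g \<in> X") (auto simp: supp_in_def)
  then show ?thesis by (simp add: up.mtr_Rl)
qed

text \<open>If \<open>W X\<close> commutes with every \<open>W Y\<close>, it commutes with all of
  \<open>K\<close>, since each \<open>\<delta> h \<star> e\<close> is \<open>w h\<close> times an
  element of \<open>\<complex>Le\<^sub>\<phi>\<close>. Then \<open>\<tau>\<close> maps it to a
  scalar, of trace zero when \<open>X\<close> is not \<open>L\<close>, hence to zero, although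
  \<open>W X\<close> is invertible.\<close>

lemma W_nondegenerate:
  assumes X: "X \<in> A" and comm: "\<And>Y. Y \<in> A \<Longrightarrow> W X \<star> W Y = W Y \<star> W X"
  shows "X = L"
proof (rule ccontr)
  assume "X \<noteq> L"
  then have tr0: "mtr (up.Rl (W X)) = 0" using trace_comp[OF X] W_comp[of X] X by (auto simp: comp_def)
  have WK: "W X \<in> supp_in K" using comp_A_supp[OF X W_comp] X by simp
  have "up.Rl (W X) * \<tau> h = \<tau> h * up.Rl (W X)" if h: "h \<in> K" for h
  proof -
    obtain c where c: "w h = c \<cdot>\<^sub>f W (L #> h)" using w_W[of h] h by auto
    have "W X \<star> w h = w h \<star> W X" unfolding c using comm[of "L #> h"] h by (simp add: conv_scale_left conv_scale_right A_def)
    moreover have "cu h \<star> W X = W X \<star> cu h" using W_comp[of X] X by (simp add: comp_def)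
    ultimately have "W X \<star> (w h \<star> cu h) = w h \<star> cu h \<star> W X" by (metis conv_assoc)
    then have "W X \<star> (\<delta> h \<star> e) = \<delta> h \<star> (e \<star> W X)" using h by (simp add: w_cu conv_assoc)
    moreover have "W X \<star> (\<delta> h \<star> e) = W X \<star> \<delta> h"
      using h delta_e[of h] W_comp[of X] X by (simp add: comp_def conv_assoc[symmetric])
    ultimately have "W X \<star> \<delta> h = \<delta> h \<star> W X" using e_comp[OF W_comp[of X]] X by simp
    then show ?thesis using up.Rl_conv[OF WK supp_in_delta[OF h]] up.Rl_conv[OF supp_in_delta[OF h] WK] h
      by (simp add: up.Rl_delta)
  qed
  then obtain c where c: "up.Rl (W X) = c \<cdot>\<^sub>m 1\<^sub>m d" using up.schur[of "up.Rl (W X)"] by auto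
  have "c * of_nat d = 0" using tr0 unfolding c mtr_smult[OF one_carrier_mat] mtr_one .
  then have "c = 0" using up.n_pos by simp
  then have "up.Rl (W X) = 0 \<cdot>\<^sub>m 1\<^sub>m d" using c by simp
  moreover have W'K: "W' X \<in> supp_in K"
  proof -
    have "L #> inv (rep X) \<subseteq> K" using L_K rep_A[OF X] by (auto simp: r_coset_def)
    moreover have "w' (rep X) \<in> supp_in (L #> inv (rep X))" using w'_comp[OF rep(1)] X by (simp add: comp_def)
    ultimately show ?thesis unfolding W'_def by (rule supp_in_mono[rotated])
  qed
  have "1\<^sub>m d = up.Rl (W X) * up.Rl (W' X)"
    using up.Rl_conv[OF WK W'K] w_w'[OF rep(1)] X up_e by (simp add: W_def W'_def)
  ultimately have "(1\<^sub>m d :: complex mat) = (0 \<cdot>\<^sub>m 1\<^sub>m d) * up.Rl (W' X)" by simp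
  then have "(1\<^sub>m d :: complex mat) $$ (0, 0) = ((0 \<cdot>\<^sub>m 1\<^sub>m d) * up.Rl (W' X)) $$ (0, 0)" by simp
  then show False using up.n_pos mult_smult_assoc_mat[OF one_carrier_mat up.Rl_carrier, of 0 "W' X"] by simp
qed

lemma Q_mult: "x \<in> carrier G \<Longrightarrow> y \<in> carrier G \<Longrightarrow> (L #> x) \<otimes>\<^bsub>G Mod L\<^esub> (L #> y) = L #> (x \<otimes> y)"
  using normal.rcos_sum[OF normal_L] by (simp add: FactGroup_def)

lemma Q_inv: "x \<in> carrier G \<Longrightarrow> inv\<^bsub>G Mod L\<^esub> (L #> x) = L #> inv x"
  using normal.inv_FactGroup[OF normal_L, of "L #> x"] normal.rcos_inv[OF normal_L]
  by (auto simp: FactGroup_def RCOSETS_def)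

lemma normal_A: "A \<lhd> G Mod L"
proof -
  interpret Q: group "G Mod L" using normal.factorgroup_is_group[OF normal_L] .
  note mult = Q_mult and inv = Q_inv
  have one: "L \<in> A" using up.H_closed(3) coset_mult_one[OF subgroup.subset[OF lo.subgroup_H]] by (metis A_def imageI)
  show ?thesis
  proof (rule Q.normal_invI)
    show "subgroup A (G Mod L)"
    proof (rule Q.subgroupI)
      show "A \<subseteq> carrier (G Mod L)" by auto
      show "A \<noteq> {}" using one by auto
      show "inv\<^bsub>G Mod L\<^esub> a \<in> A" if "a \<in> A" for a using that inv by (auto simp: A_def)
      show "a \<otimes>\<^bsub>G Mod L\<^esub> b \<in> A" if "a \<in> A" "b \<in> A" for a b using that mult by (auto simp: A_def)
    qed
  next
    fix x h assume "x \<in> carrier (G Mod L)" "h \<in> A"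
    then obtain y k where yk: "y \<in> carrier G" "x = L #> y" "k \<in> K" "h = L #> k"
      by (auto simp: A_def FactGroup_def RCOSETS_def)
    have "x \<otimes>\<^bsub>G Mod L\<^esub> h \<otimes>\<^bsub>G Mod L\<^esub> inv\<^bsub>G Mod L\<^esub> x = L #> (y \<otimes> k \<otimes> inv y)"
      unfolding yk(2,4) inv[OF yk(1)] mult[OF yk(1) K_G[OF yk(3)]] using yk by (intro mult) auto
    moreover have "y \<otimes> k \<otimes> inv y \<in> K" using normal.inv_op_closed2[OF normal_K] yk by blast
    ultimately show "x \<otimes>\<^bsub>G Mod L\<^esub> h \<otimes>\<^bsub>G Mod L\<^esub> inv\<^bsub>G Mod L\<^esub> x \<in> A" by (auto simp: A_def)
  qed
qed

lemma W_W:
  assumes XY: "X \<in> carrier (G Mod L)" "Y \<in> carrier (G Mod L)"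
  shows "\<exists>c. W X \<star> W Y = c \<cdot>\<^sub>f W (X \<otimes>\<^bsub>G Mod L\<^esub> Y)"
proof -
  interpret Q: group "G Mod L" using normal.factorgroup_is_group[OF normal_L] .
  have "W X \<star> W Y \<in> comp (X \<otimes>\<^bsub>G Mod L\<^esub> Y)"
    using comp_mult[OF W_comp W_comp] XY by (simp add: FactGroup_def)
  then show ?thesis using comp_W Q.m_closed[OF XY] by metis
qed

sublocale tw: twisted_algebra fun_scale "G Mod L" conv e W W' A
proof (intro twisted_algebra.intro twisted_algebra_axioms.intro vector_space_fun_scale
    normal.factorgroup_is_group[OF normal_L] conv_assoc conv_add_left conv_add_right conv_scale_left
    conv_scale_right W_W e_neq_0 normal_A)
  show "finite A" by (simp add: A_def)
  show "odd (card A)" using cosets_odd by (simp add: A_def)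
  show "a \<otimes>\<^bsub>G Mod L\<^esub> b = b \<otimes>\<^bsub>G Mod L\<^esub> a" if "a \<in> A" "b \<in> A" for a b
    using that cosets_comm by (simp add: A_def FactGroup_def)
  show "a = \<one>\<^bsub>G Mod L\<^esub>" if "a \<in> A" "\<And>b. b \<in> A \<Longrightarrow> W a \<star> W b = W b \<star> W a" for a
    using W_nondegenerate[OF that] by (simp add: FactGroup_def)
qed (simp_all add: W_def W'_def rep w_w' w'_w)

end

context fully_ramified_section
begin

section \<open>The normalising functional\<close>

abbreviation t where "t u \<equiv> mtr (up.Rl u)"

lemma t_add: "t (u + v) = t u + t v" and t_scale: "t (c \<cdot>\<^sub>f u) = c * t u"
  unfolding up.Rl_add up.Rl_scale by (rule mtr_add[OF up.Rl_carrier up.Rl_carrier], rule mtr_smult[OF up.Rl_carrier])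

lemma t_sum: "finite I \<Longrightarrow> t (\<Sum>i\<in>I. f i) = (\<Sum>i\<in>I. t (f i))"
  by (simp add: up.Rl_sum mtr_msum)

lemma L_supp_K [simp]: "a \<in> supp_in L \<Longrightarrow> a \<in> supp_in K"
  using L_K by (rule supp_in_mono[rotated])

lemma t_conj: "g \<in> K \<Longrightarrow> a \<in> supp_in K \<Longrightarrow> t (\<delta> g \<star> a \<star> \<delta> (inv g)) = t a"
proof -
  assume g: "g \<in> K" and a: "a \<in> supp_in K"
  have "up.Rl (\<delta> g \<star> a \<star> \<delta> (inv g)) = \<tau> g * up.Rl a * \<tau> (inv g)"
    using g a by (simp add: up.Rl_conv supp_in_conv_subgroup[OF up.subgroup_H] supp_in_delta up.Rl_delta)
  also have "mtr \<dots> = mtr (\<tau> (inv g) * (\<tau> g * up.Rl a))" using g by (intro mtr_comm[of _ d]) auto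
  also have "\<tau> (inv g) * (\<tau> g * up.Rl a) = up.Rl a"
    using assoc_mult_mat[of "\<tau> (inv g)" d d "\<tau> g" d "up.Rl a" d] g by (simp add: up.rho_inv)
  finally show ?thesis .
qed

lemma t_e: "t e = of_nat d"
  by (simp add: up_e mtr_one)

text \<open>Conjugation by \<open>L\<close> preserves the trace, and the average of the conjugates
  is a multiple of \<open>e\<close>, whose trace is \<open>d\<close>.\<close>

lemma t_\<Phi>:
  assumes X: "X \<in> carrier_mat n n"
  shows "t (lo.\<Phi> X) = of_nat d / of_nat n * mtr X"
proof -
  have "of_nat (card L) * t (lo.\<Phi> X) = (\<Sum>g\<in>L. t (\<delta> g \<star> lo.\<Phi> X \<star> \<delta> (inv g)))"
    using L_K by (simp add: t_conj subset_iff)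
  also have "\<dots> = t (\<Sum>g\<in>L. \<delta> g \<star> lo.\<Phi> X \<star> \<delta> (inv g))" by (rule t_sum[symmetric]) simp
  also have "\<dots> = of_nat (card L) / of_nat n * mtr X * of_nat d"
    unfolding lo.conj_average[OF X] t_scale e_def[symmetric] t_e ..
  also have "\<dots> = of_nat (card L) * (of_nat d / of_nat n * mtr X)" by simp
  finally show ?thesis using lo.card_H by (simp only: mult_cancel_left of_nat_eq_0_iff) blast
qed

text \<open>The ramification index: on \<open>L\<close> the character of \<open>\<tau>\<close> is
  \<open>q\<close> times that of \<open>\<rho>\<close>.\<close>

definition q :: complex where "q = of_nat d / of_nat n"

lemma q_neq_0: "q \<noteq> 0"
  using lo.n_pos up.n_pos by (simp add: q_def)

lemma mtr_tau: "l \<in> L \<Longrightarrow> mtr (\<tau> l) = q * mtr (\<rho> l)"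
proof -
  assume l: "l \<in> L"
  then have lK: "l \<in> K" using L_K by blast
  have "up.Rl (lo.\<Phi> (\<rho> l)) = up.Rl (\<delta> l \<star> e)" using l by (simp add: e_def lo.delta_\<Phi>)
  also have "\<dots> = \<tau> l" using lK by (simp add: up.Rl_conv up.Rl_delta supp_in_delta up_e)
  finally show ?thesis using t_\<Phi>[of "\<rho> l"] l by (simp add: q_def)
qed

lemma card_A: "card A * card L = card K"
proof -
  interpret K: group "subgrp G K" using subgroup.subgroup_is_group[OF up.subgroup_H is_group] .
  have LK: "subgroup L (subgrp G K)"
    using subgroup_incl[OF lo.subgroup_H up.subgroup_H L_K] .
  have "rcosets\<^bsub>subgrp G K\<^esub> L = A" by (auto simp: RCOSETS_def r_coset_def A_def)
  then show ?thesis using K.lagrange[OF LK] by (simp add: Coset.order_def)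
qed

text \<open>The norm of the character of \<open>\<tau>\<close> can be computed over
  \<open>L\<close>, as it vanishes elsewhere on \<open>K\<close>; there it is \<open>q\<close> times
  the character of \<open>\<rho>\<close>, which gives
  \<open>card K = q * q * card L\<close>.\<close>

lemma q_square: "q * q = of_nat (card A)"
proof -
  have "of_nat (card K) = (\<Sum>k\<in>K. mtr (\<tau> k) * mtr (\<tau> (inv k)))" by (rule up.sum_character_product[symmetric])
  also have "\<dots> = (\<Sum>k\<in>L. mtr (\<tau> k) * mtr (\<tau> (inv k)))"
    using L_K vanishes by (intro sum.mono_neutral_right) auto
  also have "\<dots> = (\<Sum>k\<in>L. q * q * (mtr (\<rho> k) * mtr (\<rho> (inv k))))"
    by (intro sum.cong refl) (simp add: mtr_tau)
  also have "\<dots> = q * q * of_nat (card L)"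
    unfolding sum_distrib_left[symmetric] lo.sum_character_product ..
  finally have "of_nat (card A) * of_nat (card L) = q * q * (of_nat (card L) :: complex)"
    unfolding card_A[symmetric] of_nat_mult .
  then show ?thesis using lo.card_H by simp
qed

lemma s_comp: "X \<in> A \<Longrightarrow> tw.s X \<in> comp X"
  unfolding tw.s_def by (intro comp_scale W_comp) simp

lemma Sp_supp: "u \<in> tw.Sp \<Longrightarrow> u \<in> supp_in K"
proof (induction rule: tw.Sp_induct)
  case (basis X)
  then show ?case using comp_A_supp s_comp by blast
qed (rule supp_in_add supp_in_scale supp_in_zero; assumption?)+

lemma Sp_commutes: "u \<in> tw.Sp \<Longrightarrow> a \<in> supp_in L \<Longrightarrow> a \<star> u = u \<star> a"
proof (induction rule: tw.Sp_induct)
  case (basis X)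
  then show ?case using s_comp by (simp add: comp_def)
qed (simp_all only: conv_zero_left conv_zero_right conv_add_left conv_add_right conv_scale_left conv_scale_right)

text \<open>A rank one idempotent of \<open>\<complex>Le\<^sub>\<phi>\<close>. It commutes with
  \<open>Sp\<close>, so its image in the space of \<open>\<tau>\<close> is an
  \<open>S\<close>-module, of dimension \<open>t f = q\<close>.\<close>

definition f where "f = lo.\<Phi> (unit_mat n 0 0)"

lemma f_supp [simp]: "f \<in> supp_in L" "f \<star> e = f" "e \<star> f = f" "f \<star> f = f"
  using lo.n_pos by (simp_all add: f_def lo.\<Phi>_\<Phi> unit_mat_idem)

lemma t_f: "t f = q"
  using lo.n_pos by (simp add: f_def t_\<Phi> mtr_unit_mat q_def)

text \<open>For \<open>\<epsilon>\<close> equal to 1 or -1 this is the projection onto the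
  \<epsilon>-eigenspace of the involution \<open>Z / q\<close>.\<close>

definition P where "P \<epsilon> = (1 / 2) \<cdot>\<^sub>f (e + (\<epsilon> / q) \<cdot>\<^sub>f tw.Z)"

lemma P_Sp: "P \<epsilon> \<in> tw.Sp"
  unfolding P_def by (intro tw.Sp_scale tw.Sp_add tw.Z_Sp tw.e_Sp)

lemma P_P: "\<epsilon> * \<epsilon> = 1 \<Longrightarrow> P \<epsilon> \<star> P \<epsilon> = P \<epsilon>"
proof -
  assume "\<epsilon> * \<epsilon> = 1"
  then have "(\<epsilon> / q) * (\<epsilon> / q) * of_nat (card A) = 1"
    using q_square q_neq_0 by (simp add: q_square[symmetric] field_simps)
  moreover define z where "z = (\<epsilon> / q) \<cdot>\<^sub>f tw.Z"
  ultimately have zz: "z \<star> z = e"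
    unfolding z_def conv_scale_left conv_scale_right tw.Z_square by (simp add: fun_eq_iff mult.assoc[symmetric])
  have ze: "z \<star> e = z" "e \<star> z = z"
    using tw.Sp_e[OF tw.Z_Sp] by (simp_all only: conv_scale_left conv_scale_right z_def)
  show ?thesis
    unfolding P_def z_def[symmetric] conv_scale_left conv_scale_right conv_add_left conv_add_right e_e zz ze
    by (simp add: fun_eq_iff field_simps)
qed

definition F where "F \<epsilon> = f \<star> P \<epsilon>"

lemma F_supp [simp]: "F \<epsilon> \<in> supp_in K"
  unfolding F_def using Sp_supp[OF P_Sp] by (intro supp_in_conv_subgroup[OF up.subgroup_H]) auto

lemma F_e: "F \<epsilon> \<star> e = F \<epsilon>" "e \<star> F \<epsilon> = F \<epsilon>"
  unfolding F_def using tw.Sp_e[OF P_Sp] by (simp add: conv_assoc, simp add: conv_assoc[symmetric])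

lemma C_F:
  assumes "u \<in> tw.C"
  shows "F \<epsilon> \<star> u = u \<star> F \<epsilon>"
proof -
  have u: "u \<in> tw.Sp" "u \<star> tw.Z = tw.Z \<star> u" using assms by (auto simp: tw.C_def)
  have "P \<epsilon> \<star> u = u \<star> P \<epsilon>"
    unfolding P_def conv_scale_left conv_scale_right conv_add_left conv_add_right u(2) tw.Sp_e[OF u(1)] ..
  then show ?thesis unfolding F_def using Sp_commutes[OF u(1) f_supp(1)] by (metis conv_assoc)
qed

lemma F_F:
  assumes "\<epsilon> * \<epsilon> = 1"
  shows "F \<epsilon> \<star> F \<epsilon> = F \<epsilon>"
proof -
  have "F \<epsilon> \<star> F \<epsilon> = f \<star> (P \<epsilon> \<star> f) \<star> P \<epsilon>" by (simp add: F_def conv_assoc)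
  also have "\<dots> = (f \<star> f) \<star> (P \<epsilon> \<star> P \<epsilon>)"
    using Sp_commutes[OF P_Sp f_supp(1)] by (metis conv_assoc)
  finally show ?thesis using P_P[OF assms] by (simp add: F_def)
qed

text \<open>Acts as \<open>u\<close> on the image of \<open>F \<epsilon>\<close> and as the identity
  on the complement. Its determinant in dimension \<open>d\<close> is therefore that of
  \<open>u\<close> on the eigenspace, obtained without choosing a basis there.\<close>

definition corner where "corner \<epsilon> u = u \<star> F \<epsilon> + (e + (-1) \<cdot>\<^sub>f F \<epsilon>)"

lemma C_Sp: "u \<in> tw.C \<Longrightarrow> u \<in> tw.Sp"
  by (simp add: tw.C_def)

lemma corner_supp: "u \<in> tw.C \<Longrightarrow> corner \<epsilon> u \<in> supp_in K"
  unfolding corner_def using Sp_supp[OF C_Sp]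
  by (intro supp_in_add supp_in_scale supp_in_conv_subgroup[OF up.subgroup_H]) auto

lemma corner_mult:
  assumes \<epsilon>: "\<epsilon> * \<epsilon> = 1" and u: "u \<in> tw.C" and v: "v \<in> tw.C"
  shows "corner \<epsilon> (u \<star> v) = corner \<epsilon> u \<star> corner \<epsilon> v"
proof -
  let ?F = "F \<epsilon>"
  have 1: "u \<star> ?F \<star> (v \<star> ?F) = u \<star> v \<star> ?F" using C_F[OF v] F_F[OF \<epsilon>] by (metis conv_assoc)
  have 2: "?F \<star> (v \<star> ?F) = v \<star> ?F" using C_F[OF v] F_F[OF \<epsilon>] by (metis conv_assoc)
  have 3: "u \<star> ?F \<star> ?F = u \<star> ?F" "u \<star> ?F \<star> e = u \<star> ?F" "e \<star> (v \<star> ?F) = v \<star> ?F"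
    using F_F[OF \<epsilon>] F_e tw.Sp_e[OF C_Sp[OF v]] by (simp_all add: conv_assoc) (simp add: conv_assoc[symmetric])
  show ?thesis
    unfolding corner_def conv_add_left conv_add_right conv_scale_left conv_scale_right 1 2 3 F_e F_F[OF \<epsilon>] e_e
    by (simp add: fun_eq_iff)
qed

lemma scale_e_C: "c \<noteq> 0 \<Longrightarrow> c \<cdot>\<^sub>f e \<in> tw.C"
  unfolding tw.C_def using tw.Sp_e[OF tw.Z_Sp]
  by (auto simp: conv_scale_left conv_scale_right tw.Sp_scale fun_vs.scale_scale intro!: bexI[of _ "(1 / c) \<cdot>\<^sub>f e"])

definition detR where "detR u = det (up.Rl u)"

lemma detR_corner_mult: "\<epsilon> * \<epsilon> = 1 \<Longrightarrow> u \<in> tw.C \<Longrightarrow> v \<in> tw.C \<Longrightarrow> detR (corner \<epsilon> (u \<star> v)) = detR (corner \<epsilon> u) * detR (corner \<epsilon> v)"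
  unfolding corner_mult detR_def by (simp add: up.Rl_conv corner_supp det_mult[of _ d])

text \<open>The degree of the determinant in the scalars is the dimension of the eigenspace, that
  is, the trace of the idempotent \<open>F \<epsilon>\<close>.\<close>

lemma detR_corner_scale:
  assumes \<epsilon>: "\<epsilon> * \<epsilon> = 1"
  obtains k :: nat where "t (F \<epsilon>) = of_nat k" "\<And>c. detR (corner \<epsilon> (c \<cdot>\<^sub>f e)) = c ^ k"
proof -
  let ?P = "up.Rl (F \<epsilon>)"
  have "?P * ?P = ?P" using up.Rl_conv[of "F \<epsilon>" "F \<epsilon>"] F_F[OF \<epsilon>] by simp
  then obtain k where k: "mtr ?P = of_nat k" "\<And>c. det (c \<cdot>\<^sub>m ?P + (1\<^sub>m d - ?P)) = c ^ k"
    using det_idempotent[OF up.Rl_carrier] by metis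
  have "up.Rl (corner \<epsilon> (c \<cdot>\<^sub>f e)) = c \<cdot>\<^sub>m ?P + (1\<^sub>m d - ?P)" for c
    unfolding corner_def conv_scale_left F_e up.Rl_add up.Rl_scale up_e
    by (rule eq_matI) auto
  then show thesis using k that by (simp add: detR_def)
qed

text \<open>The multiplicities of the two eigenvalues of the involution \<open>Z / q\<close> on the image of the
  idempotent \<open>f\<close> differ by one.\<close>

lemma t_f_Z: "t (f \<star> tw.Z) = q"
proof -
  have "t (f \<star> tw.Z) = (\<Sum>X\<in>A. t (f \<star> tw.s X))"
    unfolding tw.Z_def conv_sum_right by (rule t_sum) (simp add: tw.finite_A)
  also have "\<dots> = (\<Sum>X\<in>A. if X = L then q else 0)"
  proof (rule sum.cong[OF refl])
    fix X assume X: "X \<in> A"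
    show "t (f \<star> tw.s X) = (if X = L then q else 0)"
    proof (cases "X = L")
      case True
      have "tw.s L = e" using tw.s_one by (simp add: FactGroup_def)
      then show ?thesis using True t_f by simp
    next
      case False
      \<comment> \<open>Multiplication by \<open>f\<close> does not leave the coset
        \<open>X\<close>, so for \<open>X\<close> other than \<open>L\<close> the trace sees only
        places where the character vanishes.\<close>
      have "f \<star> tw.s X \<in> supp_in (L <#> X)" using s_comp[OF X] by (intro supp_in_conv) (auto simp: comp_def)
      moreover have "L <#> X = X"
        using X by (intro normal.rcosets_mult_eq[OF normal_L]) (auto simp: A_def RCOSETS_def)
      ultimately show ?thesis using trace_comp[OF X False] False by simp
    qed
  qed
  also have "\<dots> = q" using tw.A_closed(3) tw.finite_A by (simp add: FactGroup_def)
  finally show ?thesis .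
qed

text \<open>The difference of the two idempotents is \<open>f \<star> tw.Z\<close> divided by
  \<open>q\<close>, and \<open>f \<star> tw.Z\<close> has trace \<open>q\<close>.\<close>

lemma t_F_diff: "t (F 1) = t (F (-1)) + 1"
proof -
  have "F 1 = F (-1) + (1 / q) \<cdot>\<^sub>f (f \<star> tw.Z)"
    unfolding F_def P_def conv_scale_left conv_scale_right conv_add_right by (simp add: fun_eq_iff field_simps)
  then show ?thesis using q_neq_0 by (simp only: t_add t_scale t_f_Z) simp
qed

definition D where "D u = detR (corner 1 u) / detR (corner (-1) u)"

text \<open>The inverse of \<open>u\<close> commutes with \<open>Z\<close> as well, so
  multiplicativity applies to it and the two determinants multiply to 1.\<close>

lemma detR_corner_neq_0:
  assumes \<epsilon>: "\<epsilon> * \<epsilon> = 1" and u: "u \<in> tw.C"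
  shows "detR (corner \<epsilon> u) \<noteq> 0"
proof -
  obtain u' where u': "u' \<in> tw.Sp" "u \<star> u' = e" "u' \<star> u = e" and uZ: "u \<star> tw.Z = tw.Z \<star> u" "u \<in> tw.Sp"
    using u by (auto simp: tw.C_def)
  have "u' \<star> tw.Z = u' \<star> (tw.Z \<star> u) \<star> u'"
    using u' tw.Sp_e[OF tw.Z_Sp] by (metis conv_assoc)
  also have "\<dots> = tw.Z \<star> u'"
    unfolding uZ(1)[symmetric] using u' tw.Sp_e[OF tw.Z_Sp] by (metis conv_assoc)
  finally have "u' \<in> tw.C" using u' uZ by (auto simp: tw.C_def)
  then have "detR (corner \<epsilon> u) * detR (corner \<epsilon> u') = detR (corner \<epsilon> e)"
    using detR_corner_mult[OF \<epsilon> u] u'(2) by metis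
  moreover obtain k where "\<And>c. detR (corner \<epsilon> (c \<cdot>\<^sub>f e)) = c ^ k" using detR_corner_scale[OF \<epsilon>] by metis
  then have "detR (corner \<epsilon> e) = 1" by (metis fun_vs.scale_one power_one)
  ultimately show ?thesis by auto
qed

lemma ex_magic:
  obtains \<sigma> \<sigma>' where
    "\<And>x. x \<in> tw.H \<Longrightarrow> \<sigma> x \<in> tw.Sp \<and> \<sigma>' x \<in> tw.Sp \<and> \<sigma> x \<star> \<sigma>' x = e \<and> \<sigma>' x \<star> \<sigma> x = e"
    "\<And>x y. x \<in> tw.H \<Longrightarrow> y \<in> tw.H \<Longrightarrow> \<sigma> (x \<otimes>\<^bsub>G Mod L\<^esub> y) = \<sigma> x \<star> \<sigma> y"
    "\<And>x v. x \<in> tw.H \<Longrightarrow> v \<in> tw.Sp \<Longrightarrow> tw.act x v = \<sigma>' x \<star> v \<star> \<sigma> x"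
proof (rule tw.magic_from_determinant[of D])
  fix u v assume uv: "u \<in> tw.C" "v \<in> tw.C"
  show "D (u \<star> v) = D u * D v" using uv by (simp add: D_def detR_corner_mult)
  show "D u \<noteq> 0" using uv by (simp add: D_def detR_corner_neq_0)
next
  fix c :: complex and u assume u: "u \<in> tw.C" and c: "c \<noteq> 0"
  obtain k where k: "t (F 1) = of_nat k" "\<And>c. detR (corner 1 (c \<cdot>\<^sub>f e)) = c ^ k" using detR_corner_scale[of 1] by auto
  obtain m where m: "t (F (-1)) = of_nat m" "\<And>c. detR (corner (-1) (c \<cdot>\<^sub>f e)) = c ^ m" using detR_corner_scale[of "-1"] by auto
  \<comment> \<open>The degrees of the two determinants are consecutive, so their quotient has
    degree exactly one.\<close>
  have "(of_nat k :: complex) = of_nat (Suc m)" using t_F_diff k(1) m(1) by simp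
  then have km: "k = Suc m" by (simp only: of_nat_eq_iff)
  have "c \<cdot>\<^sub>f u = (c \<cdot>\<^sub>f e) \<star> u" using tw.Sp_e[OF C_Sp[OF u]] by (simp only: conv_scale_left)
  moreover have "detR (corner 1 ((c \<cdot>\<^sub>f e) \<star> u)) = c ^ k * detR (corner 1 u)"
    using detR_corner_mult[OF _ scale_e_C[OF c] u, of 1] k(2) by simp
  moreover have "detR (corner (-1) ((c \<cdot>\<^sub>f e) \<star> u)) = c ^ m * detR (corner (-1) u)"
    using detR_corner_mult[OF _ scale_e_C[OF c] u, of "-1"] m(2) by simp
  ultimately show "D (c \<cdot>\<^sub>f u) = c * D u"
    using c unfolding D_def by (simp only: km power_Suc) simp
qed (use that in blast)

end

context fully_ramified_section
begin

section \<open>The algebras of the statement\<close>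

lemma coset_L: "l \<in> L \<Longrightarrow> L #> l = L"
  by (rule subgroup.rcos_const[OF lo.subgroup_H is_group])

lemma coset_mult_L:
  assumes "l \<in> L" "g \<in> carrier G"
  shows "L #> (l \<otimes> g) = L #> g" "L #> (g \<otimes> l) = L #> g"
proof -
  have g: "L #> g \<in> carrier (G Mod L)" using assms by (auto simp: FactGroup_def RCOSETS_def)
  have "\<one>\<^bsub>G Mod L\<^esub> = L" by (simp add: FactGroup_def)
  then show "L #> (l \<otimes> g) = L #> g" "L #> (g \<otimes> l) = L #> g"
    using Q_mult[of l g] Q_mult[of g l] assms tw.l_one[OF g] tw.r_one[OF g] by (simp_all only: coset_L L_G)
qed

lemma mem_coset: "g \<in> carrier G \<Longrightarrow> k \<in> carrier G \<Longrightarrow> g \<in> L #> k \<longleftrightarrow> L #> g = L #> k"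
  using repr_independence[of g L k] rcos_self[of g L] lo.subgroup_H by metis

lemma mem_A: "X \<in> A \<Longrightarrow> g \<in> carrier G \<Longrightarrow> g \<in> X \<longleftrightarrow> X = L #> g"
  using mem_coset by (auto simp: A_def)

definition restr :: "'a set \<Rightarrow> ('a \<Rightarrow> complex) \<Rightarrow> 'a \<Rightarrow> complex" where "restr X r g = (if g \<in> X then r g else 0)"

lemma restr_add: "restr X (u + v) = restr X u + restr X v"
  and restr_scale: "restr X (c \<cdot>\<^sub>f u) = c \<cdot>\<^sub>f restr X u"
  by (auto simp: restr_def fun_eq_iff)

text \<open>Multiplication by elements of \<open>L\<close> permutes each coset within itself, so
  cutting down to a coset commutes with the action of \<open>\<complex>L\<close>.\<close>

lemma restr_conv:
  assumes X: "X \<in> A" and a: "a \<in> supp_in L"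
  shows "a \<star> restr X r = restr X (a \<star> r) \<and> restr X r \<star> a = restr X (r \<star> a)"
  using a
proof (induction rule: lo.sum_induct_supp)
  case (add u v)
  then show ?case by (simp only: conv_add_left conv_add_right restr_add)
next
  case (scale c u)
  then show ?case by (simp only: conv_scale_left conv_scale_right restr_scale)
next
  case (delta l)
  have "inv l \<otimes> g \<in> X \<longleftrightarrow> g \<in> X" "g \<otimes> inv l \<in> X \<longleftrightarrow> g \<in> X" if "g \<in> carrier G" for g
    using that delta mem_A[OF X] coset_mult_L[of "inv l" g] by auto
  then show ?case using delta by (auto simp: fun_eq_iff restr_def delta_conv conv_delta)
qed

lemma sum_restr:
  assumes r: "r \<in> supp_in K"
  shows "r = (\<Sum>X\<in>A. restr X r)"
proof
  fix g
  have "(\<Sum>X\<in>A. restr X r) g = (\<Sum>X\<in>A. restr X r g)" using tw.finite_A by (rule sum_fun_apply)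
  also have "\<dots> = r g"
  proof (cases "g \<in> K")
    case True
    then have "(\<Sum>X\<in>A. restr X r g) = (\<Sum>X\<in>A. if X = L #> g then r g else 0)"
      using mem_A by (intro sum.cong) (auto simp: restr_def)
    then show ?thesis using True tw.finite_A by (simp add: A_def)
  next
    case False
    then have "r g = 0" using r by (simp add: supp_in_def)
    then show ?thesis by (simp add: restr_def)
  qed
  finally show "r g = (\<Sum>X\<in>A. restr X r) g" by simp
qed

text \<open>The restriction of such an \<open>r\<close> to each coset again centralises
  \<open>L\<close>, so it lies in a component \<open>comp X\<close>, which is the line through
  \<open>W X\<close>.\<close>

lemma Sp_I:
  assumes r: "r \<in> supp_in K" "r \<star> e = r" and comm: "\<And>l. l \<in> L \<Longrightarrow> \<delta> l \<star> r = r \<star> \<delta> l"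
  shows "r \<in> tw.Sp"
proof -
  have comm': "a \<star> r = r \<star> a" if "a \<in> supp_in L" for a
    using that
  proof (induction rule: lo.sum_induct_supp)
    case (delta l)
    then show ?case by (rule comm)
  qed (simp_all only: conv_add_left conv_add_right conv_scale_left conv_scale_right)
  have "restr X r \<in> tw.Sp" if X: "X \<in> A" for X
  proof -
    have "restr X r \<in> comp X"
      using restr_conv[OF X, of _ r] r comm' by (simp add: comp_def) (simp add: supp_in_def restr_def)
    then obtain c where "restr X r = c \<cdot>\<^sub>f W X" using comp_W X A_Q by metis
    then show ?thesis using tw.W_eq_s[OF X] X by (simp add: tw.Sp_scale)
  qed
  then show ?thesis by (subst sum_restr[OF r(1)]) (rule tw.Sp_sum)
qed

section \<open>Identification of the algebras of the statement with subsets of the convolution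
  algebra\<close>

abbreviation \<phi> where "\<phi> \<equiv> rep_character (subgrp G L) n \<rho>"

abbreviation S where "S \<equiv> S_alg G K L \<phi>"

lemma char_idem_e: "char_idem G L \<phi> = e"
  by (simp add: e_def lo.\<Phi>_one)

lemma S_simps: "monoid.mult S = monoid.mult (group_algebra (subgrp G K))" "monoid.one S = e"
  by (simp_all add: S_alg_def centralizer_ring_def ideal_ring_def char_idem_e)

lemma S_mult: "u \<in> supp_in K \<Longrightarrow> v \<in> supp_in K \<Longrightarrow> u \<otimes>\<^bsub>S\<^esub> v = u \<star> v"
  unfolding S_simps by (rule subgroup_conv[OF up.subgroup_H])

lemma S_carrier: "carrier S = tw.Sp"
proof
  have S: "carrier S = {r. (\<exists>a\<in>supp_in K. r = a \<otimes>\<^bsub>group_algebra (subgrp G K)\<^esub> e) \<and>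
     (\<forall>l\<in>L. \<delta> l \<otimes>\<^bsub>group_algebra (subgrp G K)\<^esub> r = r \<otimes>\<^bsub>group_algebra (subgrp G K)\<^esub> \<delta> l)}"
    by (auto simp: S_alg_def centralizer_ring_def ideal_ring_def char_idem_e carrier_group_algebra)
  show "carrier S \<subseteq> tw.Sp"
  proof
    fix r assume "r \<in> carrier S"
    then obtain a where a: "a \<in> supp_in K" "r = a \<otimes>\<^bsub>group_algebra (subgrp G K)\<^esub> e"
      and c: "\<And>l. l \<in> L \<Longrightarrow> \<delta> l \<otimes>\<^bsub>group_algebra (subgrp G K)\<^esub> r = r \<otimes>\<^bsub>group_algebra (subgrp G K)\<^esub> \<delta> l"
      unfolding S by blast
    have r: "r = a \<star> e" using a by (simp add: subgroup_conv[OF up.subgroup_H])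
    then have rK: "r \<in> supp_in K" using a by (simp add: supp_in_conv_subgroup[OF up.subgroup_H])
    have "\<delta> l \<star> r = r \<star> \<delta> l" if "l \<in> L" for l
      using c[OF that] that rK L_K by (simp add: subgroup_conv[OF up.subgroup_H] supp_in_delta subset_iff)
    then show "r \<in> tw.Sp" using rK r by (intro Sp_I) (simp_all add: conv_assoc)
  qed
  show "tw.Sp \<subseteq> carrier S"
  proof
    fix r assume r: "r \<in> tw.Sp"
    have "r = r \<otimes>\<^bsub>group_algebra (subgrp G K)\<^esub> e"
      using Sp_supp[OF r] tw.Sp_e[OF r] by (simp add: subgroup_conv[OF up.subgroup_H])
    moreover have "\<delta> l \<otimes>\<^bsub>group_algebra (subgrp G K)\<^esub> r = r \<otimes>\<^bsub>group_algebra (subgrp G K)\<^esub> \<delta> l" if "l \<in> L" for l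
      using Sp_supp[OF r] Sp_commutes[OF r supp_in_delta[OF that]] that L_K
      by (simp add: subgroup_conv[OF up.subgroup_H] supp_in_delta subset_iff)
    ultimately show "r \<in> carrier S" unfolding S using Sp_supp[OF r] by blast
  qed
qed

lemma S_monoid: "monoid S"
proof (rule monoidI)
  show "\<one>\<^bsub>S\<^esub> \<in> carrier S" by (simp add: S_simps S_carrier)
  fix x y z assume x: "x \<in> carrier S" and y: "y \<in> carrier S" and z: "z \<in> carrier S"
  note xyz = x[unfolded S_carrier] y[unfolded S_carrier] z[unfolded S_carrier]
  note [simp] = xyz[THEN Sp_supp]
  have [simp]: "x \<star> y \<in> supp_in K" "y \<star> z \<in> supp_in K" using xyz by (auto intro: Sp_supp tw.Sp_mul)
  show "x \<otimes>\<^bsub>S\<^esub> y \<in> carrier S" using xyz by (simp add: S_mult S_carrier tw.Sp_mul)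
  show "x \<otimes>\<^bsub>S\<^esub> y \<otimes>\<^bsub>S\<^esub> z = x \<otimes>\<^bsub>S\<^esub> (y \<otimes>\<^bsub>S\<^esub> z)" by (simp add: S_mult conv_assoc)
  show "\<one>\<^bsub>S\<^esub> \<otimes>\<^bsub>S\<^esub> x = x" "x \<otimes>\<^bsub>S\<^esub> \<one>\<^bsub>S\<^esub> = x"
    using xyz by (simp_all add: S_simps(2) S_mult tw.Sp_e)
qed

lemma S_inverse:
  assumes "u \<in> tw.Sp" "u' \<in> tw.Sp" "u \<star> u' = e" "u' \<star> u = e"
  shows "u \<in> Units S" "inv\<^bsub>S\<^esub> u = u'"
proof -
  interpret S: monoid S by (rule S_monoid)
  have 1: "u \<in> carrier S" "u' \<in> carrier S" "u \<otimes>\<^bsub>S\<^esub> u' = \<one>\<^bsub>S\<^esub>" "u' \<otimes>\<^bsub>S\<^esub> u = \<one>\<^bsub>S\<^esub>"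
    using assms Sp_supp by (simp_all add: S_carrier S_mult S_simps(2))
  then show "u \<in> Units S" by (auto simp: Units_def)
  then show "inv\<^bsub>S\<^esub> u = u'" using 1 S.inv_unique'[of u u'] by simp
qed

lemma group_algebra_monoid: "monoid (group_algebra G)"
proof (rule monoidI)
  have car: "carrier (group_algebra G) = supp_in (carrier G)"
    by (simp add: group_algebra_def supp_in_def)
  have one: "\<one>\<^bsub>group_algebra G\<^esub> = \<delta> \<one>" by (simp add: group_algebra_def basis_elem_def)
  show "\<one>\<^bsub>group_algebra G\<^esub> \<in> carrier (group_algebra G)" by (simp add: car one supp_in_delta)
  fix x y z assume x: "x \<in> carrier (group_algebra G)" "y \<in> carrier (group_algebra G)"
  then show "x \<otimes>\<^bsub>group_algebra G\<^esub> y \<in> carrier (group_algebra G)"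
    using supp_in_conv_subgroup[OF subgroup_self] by (simp add: car conv_def[symmetric])
  show "x \<otimes>\<^bsub>group_algebra G\<^esub> y \<otimes>\<^bsub>group_algebra G\<^esub> z = x \<otimes>\<^bsub>group_algebra G\<^esub> (y \<otimes>\<^bsub>group_algebra G\<^esub> z)"
    unfolding conv_def[symmetric] by (rule conv_assoc)
  show "\<one>\<^bsub>group_algebra G\<^esub> \<otimes>\<^bsub>group_algebra G\<^esub> x = x" "x \<otimes>\<^bsub>group_algebra G\<^esub> \<one>\<^bsub>group_algebra G\<^esub> = x"
    using x by (simp_all add: one car conv_def[symmetric] one_conv conv_one)
qed

lemma alg_conj_conv: "x \<in> carrier G \<Longrightarrow> alg_conj G a x = \<delta> (inv x) \<star> a \<star> \<delta> x"
proof -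
  assume x: "x \<in> carrier G"
  interpret R: monoid "group_algebra G" by (rule group_algebra_monoid)
  have car: "carrier (group_algebra G) = supp_in (carrier G)"
    by (simp add: group_algebra_def supp_in_def)
  have one: "\<one>\<^bsub>group_algebra G\<^esub> = \<delta> \<one>" by (simp add: group_algebra_def basis_elem_def)
  have 1: "\<delta> x \<in> carrier (group_algebra G)" "\<delta> (inv x) \<in> carrier (group_algebra G)"
    "\<delta> x \<otimes>\<^bsub>group_algebra G\<^esub> \<delta> (inv x) = \<one>\<^bsub>group_algebra G\<^esub>" "\<delta> (inv x) \<otimes>\<^bsub>group_algebra G\<^esub> \<delta> x = \<one>\<^bsub>group_algebra G\<^esub>"
    using x by (simp_all add: car one supp_in_delta conv_def[symmetric] delta_inv)
  then have "inv\<^bsub>group_algebra G\<^esub> (\<delta> x) = \<delta> (inv x)"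
    using R.inv_unique'[of "\<delta> x" "\<delta> (inv x)"] by simp
  then show ?thesis by (simp add: alg_conj_def conjugate_by_def conv_def)
qed

abbreviation M where "M \<equiv> CLe G L \<phi>"

lemma M_simps: "monoid.mult M = monoid.mult (group_algebra (subgrp G L))" "monoid.one M = e"
  by (simp_all add: CLe_def ideal_ring_def char_idem_e)

lemma M_mult: "u \<in> supp_in L \<Longrightarrow> v \<in> supp_in L \<Longrightarrow> u \<otimes>\<^bsub>M\<^esub> v = u \<star> v"
  unfolding M_simps by (rule subgroup_conv[OF lo.subgroup_H])

lemma L_closed: "u \<in> supp_in L \<Longrightarrow> v \<in> supp_in L \<Longrightarrow> u \<star> v \<in> supp_in L"
  by (rule supp_in_conv_subgroup[OF lo.subgroup_H])

lemma M_carrier: "carrier M = {a \<in> supp_in L. a \<star> e = a}"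
proof -
  have M: "carrier M = {r. \<exists>a\<in>supp_in L. r = a \<otimes>\<^bsub>group_algebra (subgrp G L)\<^esub> e}"
    by (auto simp: CLe_def ideal_ring_def char_idem_e carrier_group_algebra)
  show ?thesis
  proof
    show "carrier M \<subseteq> {a \<in> supp_in L. a \<star> e = a}"
      unfolding M by (auto simp: subgroup_conv[OF lo.subgroup_H] conv_assoc L_closed)
    show "{a \<in> supp_in L. a \<star> e = a} \<subseteq> carrier M"
    proof
      fix a assume "a \<in> {a \<in> supp_in L. a \<star> e = a}"
      then have "a \<in> supp_in L" "a = a \<otimes>\<^bsub>group_algebra (subgrp G L)\<^esub> e"
        by (simp_all add: subgroup_conv[OF lo.subgroup_H])
      then show "a \<in> carrier M" unfolding M by blast
    qed
  qed
qed

lemma e_M: "a \<in> carrier M \<Longrightarrow> e \<star> a = a"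
  using conv_e[of a] e_conv[of a] by (simp add: M_carrier)

lemma M_monoid: "monoid M"
proof (rule monoidI)
  show "\<one>\<^bsub>M\<^esub> \<in> carrier M" by (simp add: M_simps M_carrier)
  fix x y z assume x: "x \<in> carrier M" "y \<in> carrier M" "z \<in> carrier M"
  then show "x \<otimes>\<^bsub>M\<^esub> y \<in> carrier M" by (simp add: M_mult M_carrier L_closed conv_assoc)
  show "x \<otimes>\<^bsub>M\<^esub> y \<otimes>\<^bsub>M\<^esub> z = x \<otimes>\<^bsub>M\<^esub> (y \<otimes>\<^bsub>M\<^esub> z)"
    using x by (simp add: M_mult M_carrier L_closed conv_assoc)
  show "\<one>\<^bsub>M\<^esub> \<otimes>\<^bsub>M\<^esub> x = x" "x \<otimes>\<^bsub>M\<^esub> \<one>\<^bsub>M\<^esub> = x"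
    using x e_M[of x] by (simp_all add: M_simps(2) M_mult M_carrier)
qed

lemma M_inverse:
  assumes "u \<in> carrier M" "u' \<in> carrier M" "u \<star> u' = e" "u' \<star> u = e"
  shows "u \<in> Units M" "inv\<^bsub>M\<^esub> u = u'"
proof -
  interpret M: monoid M by (rule M_monoid)
  have 1: "u \<otimes>\<^bsub>M\<^esub> u' = \<one>\<^bsub>M\<^esub>" "u' \<otimes>\<^bsub>M\<^esub> u = \<one>\<^bsub>M\<^esub>"
    using assms by (simp_all add: M_carrier M_mult M_simps(2))
  then show "u \<in> Units M" using assms by (auto simp: Units_def)
  then show "inv\<^bsub>M\<^esub> u = u'" using 1 assms M.inv_unique'[of u u'] by simp
qed

section \<open>Uniqueness of the units inducing conjugation, and the bracket\<close>

lemma cu_ci_M [simp]: "x \<in> carrier G \<Longrightarrow> cu x \<in> carrier M" "x \<in> carrier G \<Longrightarrow> ci x \<in> carrier M"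
  by (simp_all add: M_carrier)

lemma scaled_inverse:
  assumes x: "x \<in> carrier G" and "c \<noteq> 0"
  shows "inv\<^bsub>M\<^esub> (c \<cdot>\<^sub>f cu x) = (1 / c) \<cdot>\<^sub>f ci x" and "c \<cdot>\<^sub>f cu x \<in> carrier M"
proof -
  show "c \<cdot>\<^sub>f cu x \<in> carrier M" using x by (simp add: M_carrier conv_scale_left supp_in_scale)
  then show "inv\<^bsub>M\<^esub> (c \<cdot>\<^sub>f cu x) = (1 / c) \<cdot>\<^sub>f ci x"
    using x assms(2)
    by (intro M_inverse(2)) (simp_all add: M_carrier supp_in_scale conv_scale_left conv_scale_right cu_ci)
qed

lemma inner_unit_cu:
  assumes x: "x \<in> carrier G"
  shows "inner_unit G L \<phi> x (cu x)"
  unfolding inner_unit_def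
proof (intro conjI ballI)
  show "cu x \<in> Units M" using x by (intro M_inverse(1)[of _ "ci x"]) (simp_all add: cu_ci)
  fix a assume a: "a \<in> carrier M"
  have "inv\<^bsub>M\<^esub> (cu x) = ci x" using x by (intro M_inverse(2)) (simp_all add: cu_ci)
  then show "alg_conj G a x = conjugate_by M a (cu x)"
    using a x conj_CLe[OF x] by (simp add: alg_conj_conv conjugate_by_def M_mult M_carrier L_closed)
qed

text \<open>If \<open>c\<close> and \<open>cu x\<close> induce the same conjugation on
  \<open>\<complex>Le\<^sub>\<phi>\<close>, then \<open>c \<star> ci x\<close> is central there,
  hence a scalar.\<close>

lemma inner_unit_unique:
  assumes x: "x \<in> carrier G" and c: "inner_unit G L \<phi> x c"
  obtains \<kappa> where "\<kappa> \<noteq> 0" "c = \<kappa> \<cdot>\<^sub>f cu x"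
proof -
  interpret M: monoid M by (rule M_monoid)
  have cU: "c \<in> Units M" and conj: "\<And>a. a \<in> carrier M \<Longrightarrow> alg_conj G a x = conjugate_by M a c"
    using c by (auto simp: inner_unit_def)
  define c' where "c' = inv\<^bsub>M\<^esub> c"
  have c': "c \<in> carrier M" "c' \<in> carrier M" using cU by (auto simp: c'_def)
  have cc': "c \<star> c' = e"
    using M.Units_r_inv[OF cU] c' by (simp add: c'_def[symmetric] M_mult M_carrier M_simps(2))
  have eq: "a \<star> (c \<star> ci x) = c \<star> ci x \<star> a" if a: "a \<in> carrier M" for a
  proof -
    have "ci x \<star> a \<star> cu x = c' \<star> a \<star> c"
      using conj[OF a] conj_CLe[OF x, of a] a c' x
      by (simp add: alg_conj_conv conjugate_by_def c'_def[symmetric] M_mult M_carrier L_closed)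
    then have "c \<star> (ci x \<star> a \<star> cu x) \<star> ci x = c \<star> (c' \<star> a \<star> c) \<star> ci x" by simp
    then have "c \<star> ci x \<star> a \<star> (cu x \<star> ci x) = (c \<star> c') \<star> a \<star> c \<star> ci x" by (simp add: conv_assoc)
    then show ?thesis using x a e_M[OF a] by (simp add: cu_ci cc' M_carrier conv_assoc)
  qed
  have "c \<star> ci x \<in> comp L"
    unfolding comp_def mem_Collect_eq
  proof (intro conjI ballI)
    show cci: "c \<star> ci x \<in> supp_in L" "c \<star> ci x \<star> e = c \<star> ci x"
      using c' x by (simp_all add: M_carrier L_closed conv_assoc)
    fix a assume a: "a \<in> supp_in L"
    have ae: "a \<star> e \<in> carrier M" using a by (simp add: M_carrier L_closed conv_assoc)
    have "e \<star> (c \<star> ci x) = c \<star> ci x" using e_M[of "c \<star> ci x"] cci by (simp add: M_carrier)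
    then have "a \<star> (c \<star> ci x) = a \<star> e \<star> (c \<star> ci x)" by (simp add: conv_assoc)
    also have "\<dots> = c \<star> ci x \<star> (e \<star> a)" using eq[OF ae] conv_e[OF a] e_conv[OF a] by simp
    also have "\<dots> = c \<star> ci x \<star> a" using cci(2) by (metis conv_assoc)
    finally show "a \<star> (c \<star> ci x) = c \<star> ci x \<star> a" .
  qed
  then obtain \<kappa> where \<kappa>: "c \<star> ci x = \<kappa> \<cdot>\<^sub>f e" by (rule comp_L_scalar)
  have "c = c \<star> ci x \<star> cu x" using x c' by (simp add: conv_assoc cu_ci M_carrier)
  then have c\<kappa>: "c = \<kappa> \<cdot>\<^sub>f cu x" using \<kappa> x by (simp add: conv_scale_left)
  moreover have "\<kappa> \<noteq> 0"
  proof
    assume "\<kappa> = 0"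
    then have "c = 0" using c\<kappa> by simp
    then show False using cc' e_neq_0 by simp
  qed
  ultimately show thesis using that by blast
qed

lemma w_mult_commute:
  assumes c: "c \<in> carrier G" and g: "g \<in> carrier G" and comm: "W (L #> c) \<star> W (L #> g) = W (L #> g) \<star> W (L #> c)"
  shows "w c \<star> w g = w g \<star> w c"
proof -
  obtain a b where "w c = a \<cdot>\<^sub>f W (L #> c)" "w g = b \<cdot>\<^sub>f W (L #> g)" using w_W c g by metis
  then show ?thesis using comm by (simp add: conv_scale_left conv_scale_right mult.commute)
qed

text \<open>Since \<open>(g \<otimes> c) \<otimes> commutator G c g = c \<otimes> g\<close>, the
  claim is checked after multiplication by \<open>\<delta> (g \<otimes> c)\<close>. Modulo
  \<open>e\<close> each group element \<open>x\<close> is \<open>w x \<star> cu x\<close>, and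
  \<open>w\<close> commutes with every \<open>cu\<close>, so the two parts separate and the
  \<open>w\<close> parts agree by assumption.\<close>

lemma commutator_e:
  assumes c: "c \<in> carrier G" and g: "g \<in> carrier G" and comm: "w c \<star> w g = w g \<star> w c"
  shows "\<delta> (commutator G c g) \<star> (ci g \<star> ci c \<star> cu g \<star> cu c) = e"
proof -
  have de: "\<delta> (x \<otimes> y) \<star> e = w x \<star> w y \<star> (cu x \<star> cu y)" if "x \<in> carrier G" "y \<in> carrier G" for x y
  proof -
    have "\<delta> (x \<otimes> y) \<star> e = \<delta> x \<star> (\<delta> y \<star> e) \<star> e" using that by (simp add: delta_delta[symmetric] conv_assoc)
    also have "\<dots> = (\<delta> x \<star> e) \<star> (\<delta> y \<star> e)" using delta_e[OF that(2)] by (simp add: conv_assoc)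
    also have "\<dots> = w x \<star> (cu x \<star> w y) \<star> cu y" using that by (simp add: w_cu[symmetric] conv_assoc)
    also have "\<dots> = w x \<star> w y \<star> (cu x \<star> cu y)" using w_commutes[OF that(2), of "cu x"] by (simp add: conv_assoc)
    finally show ?thesis .
  qed
  let ?y = "ci g \<star> ci c \<star> cu g \<star> cu c"
  have ey: "e \<star> ?y = ?y" using g by (simp add: conv_assoc[symmetric])
  have cancel: "x \<otimes> (inv x \<otimes> y) = y" if "x \<in> carrier G" "y \<in> carrier G" for x y
    using that by (simp add: m_assoc[symmetric])
  have "(g \<otimes> c) \<otimes> commutator G c g = c \<otimes> g"
    using c g by (simp add: commutator_def m_assoc cancel)
  moreover have kG: "commutator G c g \<in> carrier G" using c g by (simp add: commutator_def)
  ultimately have "\<delta> (g \<otimes> c) \<star> (\<delta> (commutator G c g) \<star> ?y) = \<delta> (c \<otimes> g) \<star> ?y"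
    using c g by (simp add: conv_assoc[symmetric] delta_delta)
  also have "\<dots> = \<delta> (c \<otimes> g) \<star> e \<star> ?y" using ey by (simp add: conv_assoc)
  also have "\<dots> = w g \<star> w c \<star> (cu c \<star> (cu g \<star> ci g) \<star> ci c \<star> (cu g \<star> cu c))"
    using c g comm by (simp add: de conv_assoc)
  also have "\<dots> = w g \<star> w c \<star> (cu g \<star> cu c)" using c g by (simp add: cu_ci conv_assoc[symmetric])
  also have "\<dots> = \<delta> (g \<otimes> c) \<star> e" using c g by (simp add: de)
  finally have "\<delta> (inv (g \<otimes> c)) \<star> (\<delta> (g \<otimes> c) \<star> (\<delta> (commutator G c g) \<star> ?y)) = \<delta> (inv (g \<otimes> c)) \<star> (\<delta> (g \<otimes> c) \<star> e)"
    by simp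
  then have "\<delta> \<one> \<star> (\<delta> (commutator G c g) \<star> ?y) = \<delta> \<one> \<star> e"
    using c g delta_inv(2)[of "g \<otimes> c"] by (simp only: conv_assoc[symmetric] m_closed)
  then show ?thesis using kG
    by (simp add: one_conv conv_assoc[symmetric] delta_delta)
qed

text \<open>Any admissible units are nonzero multiples of \<open>cu c\<close> and
  \<open>cu g\<close>, and the scalars cancel in their commutator; so the description has the value
  1 and no other.\<close>

lemma bracket_eq_1:
  assumes c: "c \<in> carrier G" and g: "g \<in> carrier G" and comm: "w c \<star> w g = w g \<star> w c"
  shows "bracket G L \<phi> c g = 1"
  unfolding bracket_def
proof (rule the_equality)
  have M_comm: "commutator M (b \<cdot>\<^sub>f cu g) (a \<cdot>\<^sub>f cu c) = ci g \<star> ci c \<star> cu g \<star> cu c" if "a \<noteq> 0" "b \<noteq> 0" for a b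
    using that scaled_inverse[OF c that(1)] scaled_inverse[OF g that(2)]
    by (simp add: commutator_def M_mult L_closed supp_in_scale conv_scale_left conv_scale_right)
  have val: "\<delta> (commutator G c g) \<otimes>\<^bsub>group_algebra G\<^esub> commutator M (b \<cdot>\<^sub>f cu g) (a \<cdot>\<^sub>f cu c) = e" if "a \<noteq> 0" "b \<noteq> 0" for a b
    unfolding M_comm[OF that] conv_def[symmetric] by (rule commutator_e[OF assms])
  have "(\<lambda>l. 1 * char_idem G L \<phi> l) = \<delta> (commutator G c g) \<otimes>\<^bsub>group_algebra G\<^esub> commutator M (cu g) (cu c)"
    using val[of 1 1] by (simp add: char_idem_e)
  then show "\<exists>cx cy. inner_unit G L \<phi> c cx \<and> inner_unit G L \<phi> g cy \<and>
     (\<lambda>l. 1 * char_idem G L \<phi> l) = \<delta> (commutator G c g) \<otimes>\<^bsub>group_algebra G\<^esub> commutator M cy cx"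
    using inner_unit_cu c g by blast
  fix z assume "\<exists>cx cy. inner_unit G L \<phi> c cx \<and> inner_unit G L \<phi> g cy \<and>
     (\<lambda>l. z * char_idem G L \<phi> l) = \<delta> (commutator G c g) \<otimes>\<^bsub>group_algebra G\<^esub> commutator M cy cx"
  then obtain cx cy where cxy: "inner_unit G L \<phi> c cx" "inner_unit G L \<phi> g cy"
     "(\<lambda>l. z * char_idem G L \<phi> l) = \<delta> (commutator G c g) \<otimes>\<^bsub>group_algebra G\<^esub> commutator M cy cx" by blast
  obtain a where a: "a \<noteq> 0" "cx = a \<cdot>\<^sub>f cu c" using inner_unit_unique[OF c cxy(1)] .
  obtain b where b: "b \<noteq> 0" "cy = b \<cdot>\<^sub>f cu g" using inner_unit_unique[OF g cxy(2)] .
  have "z \<cdot>\<^sub>f e = 1 \<cdot>\<^sub>f e" using cxy(3) val[OF a(1) b(1)] by (simp add: a b char_idem_e fun_scale_def)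
  then show "z = 1" using e_neq_0 fun_vs.scale_cancel_right by blast
qed

section \<open>The complement and its magic representation\<close>

definition HG where "HG = {x \<in> carrier G. L #> x \<in> tw.H}"

lemma HG_carrier: "x \<in> HG \<Longrightarrow> x \<in> carrier G" and HG_H: "x \<in> HG \<Longrightarrow> L #> x \<in> tw.H"
  by (auto simp: HG_def)

lemma one_Q: "\<one>\<^bsub>G Mod L\<^esub> = L"
  by (simp add: FactGroup_def)

lemma subgroup_HG: "subgroup HG G"
proof (rule subgroupI)
  show "HG \<subseteq> carrier G" by (auto simp: HG_def)
  have "L #> \<one> \<in> tw.H" using subgroup.one_closed[OF tw.subgroup_H] one_Q coset_L[of \<one>] by simp
  then show "HG \<noteq> {}" unfolding HG_def using one_closed by blast
  show "inv a \<in> HG" if a: "a \<in> HG" for a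
    using subgroup.m_inv_closed[OF tw.subgroup_H HG_H[OF a]] Q_inv[OF HG_carrier[OF a]] HG_carrier[OF a]
    unfolding HG_def by simp
  show "a \<otimes> b \<in> HG" if a: "a \<in> HG" and b: "b \<in> HG" for a b
    using subgroup.m_closed[OF tw.subgroup_H HG_H[OF a] HG_H[OF b]] Q_mult[OF HG_carrier[OF a] HG_carrier[OF b]]
      HG_carrier[OF a] HG_carrier[OF b] unfolding HG_def by simp
qed

lemma HG_K: "HG <#> K = carrier G"
proof
  show "HG <#> K \<subseteq> carrier G" unfolding set_mult_def using HG_carrier K_G by blast
  show "carrier G \<subseteq> HG <#> K"
  proof
    fix x assume x: "x \<in> carrier G"
    then have "L #> x \<in> carrier (G Mod L)" by (auto simp: FactGroup_def RCOSETS_def)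
    then obtain h a where ha: "h \<in> tw.H" "a \<in> A" "L #> x = h \<otimes>\<^bsub>G Mod L\<^esub> a" using tw.H_A_decompose by metis
    define y where "y = rep h"
    have hQ: "h \<in> carrier (G Mod L)" using ha(1) by (rule tw.H_carrier)
    have y: "y \<in> carrier G" "h = L #> y" using rep[OF hQ] by (auto simp: y_def)
    obtain k where k: "k \<in> K" "a = L #> k" using ha(2) by (auto simp: A_def)
    have "L #> x = L #> (y \<otimes> k)" using ha(3) unfolding y(2) k(2) Q_mult[OF y(1) K_G[OF k(1)]] .
    then have "x \<in> L #> (y \<otimes> k)" using mem_coset[of x "y \<otimes> k"] x y k by simp
    \<comment> \<open>The factor \<open>l\<close> by which \<open>x\<close> differs from
      \<open>y \<otimes> k\<close> is absorbed into the element of \<open>HG\<close>, which is a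
      union of cosets of \<open>L\<close>.\<close>
    then obtain l where l: "l \<in> L" "x = l \<otimes> (y \<otimes> k)" by (auto simp: r_coset_def)
    have "l \<otimes> y \<in> HG" using l y ha(1) coset_mult_L(1)[of l y] by (simp add: HG_def)
    moreover have "x = (l \<otimes> y) \<otimes> k" using l y k by (simp add: m_assoc)
    ultimately show "x \<in> HG <#> K" using k(1) unfolding set_mult_def by blast
  qed
qed

lemma HG_inter_K: "HG \<inter> K = L"
proof
  show "HG \<inter> K \<subseteq> L"
  proof
    fix x assume x: "x \<in> HG \<inter> K"
    then have "L #> x \<in> tw.H \<inter> A" by (auto simp: HG_def A_def)
    then have "L #> x = L" unfolding tw.H_inter_A one_Q by simp
    then show "x \<in> L" using rcos_self[of x L] x lo.subgroup_H by auto
  qed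
  show "L \<subseteq> HG \<inter> K"
    using L_K coset_L subgroup.one_closed[OF tw.subgroup_H] unfolding HG_def one_Q by auto
qed

text \<open>Commuting cosets have commuting basis elements as soon as one lies in the stabiliser,
  and that trivialises the bracket.\<close>

lemma HG_good:
  assumes "h \<in> HG"
  shows "good G K L \<phi> h"
  unfolding good_def
proof (intro conjI ballI impI)
  show h: "h \<in> carrier G" using assms by (rule HG_carrier)
  fix c assume c: "c \<in> K" and "(L #> c) \<otimes>\<^bsub>G Mod L\<^esub> (L #> h) = (L #> h) \<otimes>\<^bsub>G Mod L\<^esub> (L #> c)"
  then have "W (L #> h) \<star> W (L #> c) = W (L #> c) \<star> W (L #> h)"
    by (intro tw.H_commute HG_H[OF assms]) (auto simp: A_def)
  then have "w c \<star> w h = w h \<star> w c" using c h by (intro w_mult_commute) auto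
  then show "bracket G L \<phi> c h = 1" using c h by (intro bracket_eq_1) auto
qed

text \<open>Modulo \<open>e\<close>, \<open>x\<close> is \<open>w x \<star> cu x\<close>, and
  conjugation by the factor \<open>cu x\<close> is trivial on the centraliser of \<open>L\<close>.
  The scalar between \<open>w x\<close> and \<open>W (L #> x)\<close> cancels in the
  conjugation.\<close>

lemma conj_act:
  assumes x: "x \<in> carrier G" and v: "v \<in> tw.Sp" and act: "tw.act (L #> x) v \<in> tw.Sp"
  shows "\<delta> (inv x) \<star> v \<star> \<delta> x = tw.act (L #> x) v"
proof -
  have X: "L #> x \<in> carrier (G Mod L)" using x by (auto simp: FactGroup_def RCOSETS_def)
  obtain c where c: "c \<noteq> 0" "w x = c \<cdot>\<^sub>f W (L #> x)" using w_W[OF x] .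
  have A: "w' x = w' x \<star> (W (L #> x) \<star> W' (L #> x))" using tw.W_W'[OF X] x by simp
  have W: "W (L #> x) = (1 / c) \<cdot>\<^sub>f w x" using c by (simp add: fun_vs.scale_scale)
  have "w' x \<star> (((1 / c) \<cdot>\<^sub>f w x) \<star> W' (L #> x)) = (1 / c) \<cdot>\<^sub>f (w' x \<star> w x \<star> W' (L #> x))"
    by (simp only: conv_scale_left conv_scale_right conv_assoc)
  with A have w': "w' x = (1 / c) \<cdot>\<^sub>f W' (L #> x)"
    unfolding W w'_w[OF x] tw.e_W'[OF X] by (rule trans)
  have wvw: "w' x \<star> v \<star> w x = tw.act (L #> x) v"
    unfolding w' c(2) tw.act_def using c(1) by (simp add: conv_scale_left conv_scale_right)
  have "e \<star> \<delta> (inv x) = ci x \<star> w' x" using x by (simp add: w'_def conv_assoc[symmetric] cu_ci)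
  moreover have "\<delta> (inv x) \<star> v \<star> \<delta> x = (\<delta> (inv x) \<star> e) \<star> v \<star> (e \<star> \<delta> x)"
    using tw.Sp_e[OF v] by (metis conv_assoc)
  ultimately have "\<delta> (inv x) \<star> v \<star> \<delta> x = ci x \<star> (w' x \<star> v \<star> w x) \<star> cu x"
    using x delta_e[of x] delta_e[of "inv x"] w_cu[OF x] by (simp add: conv_assoc)
  also have "\<dots> = tw.act (L #> x) v \<star> (ci x \<star> cu x)"
    unfolding wvw using Sp_commutes[OF act, of "ci x"] by (simp add: conv_assoc)
  finally show ?thesis using x tw.Sp_e[OF act] by (simp add: cu_ci)
qed

lemma ex_magic_rep: "\<exists>\<sigma>. magic_rep G K L \<phi> HG \<sigma>"
proof -
  obtain \<sigma> \<sigma>' where \<sigma>: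
    "\<And>x. x \<in> tw.H \<Longrightarrow> \<sigma> x \<in> tw.Sp \<and> \<sigma>' x \<in> tw.Sp \<and> \<sigma> x \<star> \<sigma>' x = e \<and> \<sigma>' x \<star> \<sigma> x = e"
    "\<And>x y. x \<in> tw.H \<Longrightarrow> y \<in> tw.H \<Longrightarrow> \<sigma> (x \<otimes>\<^bsub>G Mod L\<^esub> y) = \<sigma> x \<star> \<sigma> y"
    "\<And>x v. x \<in> tw.H \<Longrightarrow> v \<in> tw.Sp \<Longrightarrow> tw.act x v = \<sigma>' x \<star> v \<star> \<sigma> x"
    using ex_magic by blast
  have car: "X \<in> tw.H" if "X \<in> carrier (subgrp G HG Mod L)" for X
    using that HG_H by (auto simp: FactGroup_def RCOSETS_def r_coset_def)
  have mult: "X \<otimes>\<^bsub>subgrp G HG Mod L\<^esub> Y = X \<otimes>\<^bsub>G Mod L\<^esub> Y" for X Y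
    by (simp add: FactGroup_def set_mult_def)
  have "\<sigma> \<in> hom (subgrp G HG Mod L) (units_of S)"
  proof (rule homI)
    fix X assume "X \<in> carrier (subgrp G HG Mod L)"
    then show "\<sigma> X \<in> carrier (units_of S)"
      using \<sigma>(1)[OF car] S_inverse(1)[of "\<sigma> X" "\<sigma>' X"] by (simp add: units_of_carrier)
  next
    fix X Y assume X: "X \<in> carrier (subgrp G HG Mod L)" and Y: "Y \<in> carrier (subgrp G HG Mod L)"
    then show "\<sigma> (X \<otimes>\<^bsub>subgrp G HG Mod L\<^esub> Y) = \<sigma> X \<otimes>\<^bsub>units_of S\<^esub> \<sigma> Y"
      unfolding mult units_of_mult using \<sigma>(1)[OF car] \<sigma>(2)[OF car[OF X] car[OF Y]] Sp_supp by (simp add: S_mult)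
  qed
  moreover have "alg_conj G s x = conjugate_by S s (\<sigma> (L #> x))" if x: "x \<in> HG" and s: "s \<in> carrier S" for x s
  proof -
    have sSp: "s \<in> tw.Sp" using s by (simp add: S_carrier)
    note H = HG_H[OF x]
    have act: "tw.act (L #> x) s = \<sigma>' (L #> x) \<star> s \<star> \<sigma> (L #> x)" using \<sigma>(3)[OF H sSp] .
    then have "tw.act (L #> x) s \<in> tw.Sp" using \<sigma>(1)[OF H] sSp by (simp add: tw.Sp_mul)
    then have "alg_conj G s x = tw.act (L #> x) s"
      using conj_act[OF HG_carrier[OF x] sSp] by (simp add: alg_conj_conv[OF HG_carrier[OF x]])
    moreover have "conjugate_by S s (\<sigma> (L #> x)) = \<sigma>' (L #> x) \<star> s \<star> \<sigma> (L #> x)"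
      using S_inverse(2)[of "\<sigma> (L #> x)" "\<sigma>' (L #> x)"] \<sigma>(1)[OF H] sSp Sp_supp tw.Sp_mul
      by (simp add: conjugate_by_def S_mult)
    ultimately show ?thesis using act by simp
  qed
  ultimately show ?thesis
    unfolding magic_rep_def using subgroup_HG HG_K HG_inter_K by blast
qed

lemma good_complement:
  "\<exists>H. subgroup H G \<and> carrier G = H <#> K \<and> L = H \<inter> K \<and>
    (\<forall>h\<in>H. good G K L \<phi> h) \<and> (\<exists>\<sigma>. magic_rep G K L \<phi> H \<sigma>)"
  using subgroup_HG HG_K HG_inter_K HG_good ex_magic_rep by blast

end

text \<open>Multiplying \<open>\<tau>\<close> by a linear character of \<open>K/L\<close> does not change its restriction to \<open>L\<close>.\<close>

lemma (in subgroup_irrep) trace_vanishes: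
  assumes L: "L \<lhd> G" "L \<subseteq> H" and comm: "comm_group (subgrp G H Mod L)"
    and above: "lies_above G L (rep_character (subgrp G H) n \<rho>) \<phi>"
    and unique: "\<And>\<chi>. \<chi> \<in> Irr (subgrp G H) \<Longrightarrow> lies_above G L \<chi> \<phi> \<Longrightarrow> \<chi> = rep_character (subgrp G H) n \<rho>"
    and k: "k \<in> H" "k \<notin> L"
  shows "mtr (\<rho> k) = 0"
proof -
  let ?A = "subgrp G H Mod L"
  interpret A: comm_group ?A by (rule comm)
  have LG: "subgroup L G" using L(1) by (rule normal_imp_subgroup)
  have carA: "carrier ?A = r_coset G L ` H" by (auto simp: FactGroup_def RCOSETS_def r_coset_def)
  have multA: "(L #> x) \<otimes>\<^bsub>?A\<^esub> (L #> y) = L #> (x \<otimes> y)" if "x \<in> H" "y \<in> H" for x y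
    using normal.rcos_sum[OF L(1)] that H_carrier by (simp add: FactGroup_def set_mult_def)
  have oneA: "\<one>\<^bsub>?A\<^esub> = L" by (simp add: FactGroup_def)
  have "L #> k \<noteq> L" using rcos_self[OF H_carrier[OF k(1)] LG] k(2) by auto
  then have ne: "L #> k \<noteq> \<one>\<^bsub>?A\<^esub>" unfolding oneA .
  have mem: "L #> k \<in> carrier ?A" unfolding carA using k(1) by (rule imageI)
  have fin: "finite (carrier ?A)" unfolding carA by simp
  \<comment> \<open>As \<open>k\<close> is not in \<open>L\<close>, some linear character of the
    quotient takes a value other than 1 at its coset.\<close>
  obtain \<mu> :: "'a set \<Rightarrow> complex" where \<mu>: "\<And>x. x \<in> carrier ?A \<Longrightarrow> \<mu> x \<noteq> 0"
    "\<And>x y. x \<in> carrier ?A \<Longrightarrow> y \<in> carrier ?A \<Longrightarrow> \<mu> (x \<otimes>\<^bsub>?A\<^esub> y) = \<mu> x * \<mu> y" "\<mu> (L #> k) \<noteq> 1"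
    by (rule A.nontrivial_linear_character[OF fin mem ne]) (blast intro: that)
  define m where "m x = \<mu> (L #> x)" for x
  have m: "m x \<noteq> 0" "m (x \<otimes> y) = m x * m y" if "x \<in> H" "y \<in> H" for x y
    using \<mu>(1,2) multA[OF that] that unfolding m_def carA by (auto, metis imageI)
  have "m \<one> = 1" using m[of \<one> \<one>] by simp
  have mL: "m l = 1" if "l \<in> L" for l
    using \<open>m \<one> = 1\<close> subgroup.rcos_const[OF LG is_group] that subgroup.one_closed[OF LG] by (simp add: m_def)
  define r where "r x = m x \<cdot>\<^sub>m \<rho> x" for x
  have r_mult: "r (x \<otimes> y) = r x * r y" if "x \<in> H" "y \<in> H" for x y
  proof -
    have "r x * r y = m y \<cdot>\<^sub>m (m x \<cdot>\<^sub>m (\<rho> x * \<rho> y))"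
      using that mult_smult_distrib[of "m x \<cdot>\<^sub>m \<rho> x" n n "\<rho> y" n "m y"]
        mult_smult_assoc_mat[of "\<rho> x" n n "\<rho> y" n "m x"] by (simp add: r_def)
    moreover have "m y \<cdot>\<^sub>m (m x \<cdot>\<^sub>m B) = (m x * m y) \<cdot>\<^sub>m B" for B by (rule eq_matI) auto
    ultimately show ?thesis using that m[OF that] by (simp add: r_def rho_mult)
  qed
  have r_one: "r \<one> = 1\<^sub>m n" using \<open>m \<one> = 1\<close> by (auto simp: r_def rho_one intro!: eq_matI)
  have r_car: "r x \<in> carrier_mat n n" if "x \<in> H" for x using that by (simp add: r_def)
  have "r \<in> hom (subgrp G H) (units_of (ring_mat TYPE(complex) n ()))"
  proof (rule homI)
    fix x assume "x \<in> carrier (subgrp G H)"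
    then have x: "x \<in> H" by simp
    then have "r x * r (inv x) = 1\<^sub>m n" "r (inv x) * r x = 1\<^sub>m n"
      using r_mult[symmetric] r_one by (simp_all add: H_carrier)
    then show "r x \<in> carrier (units_of (ring_mat TYPE(complex) n ()))"
      using r_car[OF x] r_car[of "inv x"] x by (auto simp: units_of_def Units_def ring_mat_def)
  next
    fix x y assume "x \<in> carrier (subgrp G H)" "y \<in> carrier (subgrp G H)"
    then show "r (x \<otimes>\<^bsub>subgrp G H\<^esub> y) = r x \<otimes>\<^bsub>units_of (ring_mat TYPE(complex) n ())\<^esub> r y"
      by (simp add: r_mult units_of_def ring_mat_def)
  qed
  moreover have "W = {0\<^sub>v n} \<or> W = carrier_vec n"
    if W: "VectorSpace.subspace class_ring W (module_vec TYPE(complex) n)"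
      and inv: "\<forall>g\<in>carrier (subgrp G H). \<forall>w\<in>W. r g *\<^sub>v w \<in> W" for W
  proof -
    have sub: "submodule (class_ring :: complex ring) W (module_vec TYPE(complex) n)"
      using W by (simp add: VectorSpace.subspace_def)
    have "\<rho> g *\<^sub>v w \<in> W" if g: "g \<in> H" and w: "w \<in> W" for g w
    proof -
      have wc: "w \<in> carrier_vec n" using submodule.subset[OF sub] w by (auto simp: module_vec_simps)
      have "(1 / m g) \<odot>\<^bsub>module_vec TYPE(complex) n\<^esub> (r g *\<^sub>v w) \<in> W"
        using submodule.smult_closed[OF sub, of "1 / m g" "r g *\<^sub>v w"] inv g w by simp
      moreover have "(1 / m g) \<odot>\<^bsub>module_vec TYPE(complex) n\<^esub> (r g *\<^sub>v w) = \<rho> g *\<^sub>v w"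
      proof -
        have "r g *\<^sub>v w = m g \<cdot>\<^sub>v (\<rho> g *\<^sub>v w)"
          unfolding r_def using rho_carrier[OF g] wc by (intro eq_vecI) (auto simp: scalar_prod_def sum_distrib_left mult_ac)
        then show ?thesis using m(1)[OF g g] by (simp add: module_vec_simps smult_smult_assoc)
      qed
      ultimately show ?thesis by simp
    qed
    then show ?thesis using irreducible W by (simp add: irreducible_rep_def)
  qed
  ultimately have "irreducible_rep (subgrp G H) n r"
    using n_pos by (simp add: irreducible_rep_def matrix_rep_def)
  then have Irr: "rep_character (subgrp G H) n r \<in> Irr (subgrp G H)" by (auto simp: Irr_def)
  have rc: "rep_character (subgrp G H) n r x = m x * rep_character (subgrp G H) n \<rho> x" if x: "x \<in> H" for x
    using x carrier_matD[OF rho_carrier[OF x]]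
    by (auto simp: rep_character_def r_def sum_distrib_left intro!: sum.cong)
  \<comment> \<open>The twisting factor \<open>m\<close> is 1 on \<open>L\<close>, so the twisted
    character has the same inner product with \<open>\<phi>\<close> and lies above it too.\<close>
  have "char_inner (subgrp G L) (rep_character (subgrp G H) n r) \<phi> =
      char_inner (subgrp G L) (rep_character (subgrp G H) n \<rho>) \<phi>"
    using L(2) mL rc by (auto simp: char_inner_def subset_iff intro!: sum.cong)
  then have "lies_above G L (rep_character (subgrp G H) n r) \<phi>" using above by (simp add: lies_above_def)
  \<comment> \<open>Uniqueness equates the character with its twist; at \<open>k\<close> they differ
    by the factor \<open>m k\<close>, which is not 1, so the value is zero.\<close>
  then have "rep_character (subgrp G H) n r k = rep_character (subgrp G H) n \<rho> k" using unique[OF Irr] by simp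
  then have "m k * rep_character (subgrp G H) n \<rho> k = rep_character (subgrp G H) n \<rho> k" using rc[OF k(1)] by simp
  then have "rep_character (subgrp G H) n \<rho> k = 0" using \<mu>(3) by (simp add: m_def)
  then show ?thesis using k(1) by (simp add: rep_character_def mtr_rho)
qed

theorem theorem7p1:
  fixes G :: "('a, 'b) monoid_scheme"
    and K L :: "'a set"
    and \<theta> \<phi> :: "'a \<Rightarrow> complex"
  assumes "character_five G K L \<theta> \<phi>"
    and "comm_group (subgrp G K Mod L)"
    and "odd (Coset.order (subgrp G K Mod L))"
  shows "\<exists>H. subgroup H G \<and> carrier G = H <#>\<^bsub>G\<^esub> K \<and> L = H \<inter> K \<and>
           (\<forall>h\<in>H. good G K L \<phi> h) \<and>
           (\<exists>\<sigma>. magic_rep G K L \<phi> H \<sigma>)"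
proof -
  interpret c5: character_five G K L \<theta> \<phi> by (rule assms(1))
  obtain n \<rho> where \<rho>: "irreducible_rep (subgrp G L) n \<rho>" "\<phi> = rep_character (subgrp G L) n \<rho>"
    using c5.phi_Irr by (auto simp: Irr_def)
  obtain d \<tau> where \<tau>: "irreducible_rep (subgrp G K) d \<tau>" "\<theta> = rep_character (subgrp G K) d \<tau>"
    using c5.theta_Irr by (auto simp: Irr_def)
  interpret finite_group_algebra G by unfold_locales (rule c5.finite_G)
  interpret lo: subgroup_irrep G L n \<rho>
    by (intro subgroup_irrep.intro subgroup_irrep_axioms.intro finite_group_algebra_axioms
        normal_imp_subgroup c5.normal_L \<rho>(1))
  interpret up: subgroup_irrep G K d \<tau>
    by (intro subgroup_irrep.intro subgroup_irrep_axioms.intro finite_group_algebra_axioms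
        normal_imp_subgroup c5.normal_K \<tau>(1))
  have \<phi>: "\<phi> l = mtr (\<rho> l)" if "l \<in> L" for l
    using that by (simp add: \<rho>(2) rep_character_def lo.mtr_rho)
  have \<theta>: "\<theta> k = mtr (\<tau> k)" if "k \<in> K" for k
    using that by (simp add: \<tau>(2) rep_character_def up.mtr_rho)
  have carA: "carrier (subgrp G K Mod L) = r_coset G L ` K" by (auto simp: FactGroup_def RCOSETS_def r_coset_def)
  have LK: "L \<subseteq> K" by (rule c5.L_le_K)
  interpret fully_ramified_section G L n \<rho> K d \<tau>
  proof (intro fully_ramified_section.intro fully_ramified_section_axioms.intro
      finite_group_algebra_axioms lo.subgroup_irrep_axioms up.subgroup_irrep_axioms c5.normal_L c5.normal_K LK)
    show "mtr (\<rho> (inv\<^bsub>G\<^esub> x \<otimes>\<^bsub>G\<^esub> l \<otimes>\<^bsub>G\<^esub> x)) = mtr (\<rho> l)" if "x \<in> carrier G" "l \<in> L" for x l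
      using c5.phi_invariant[OF that] \<phi> that normal.inv_op_closed1[OF c5.normal_L that]
      by (simp add: conjugate_by_def)
    show "(\<Sum>l\<in>L. mtr (\<tau> l) * cnj (mtr (\<rho> l))) \<noteq> 0"
      using c5.theta_above LK by (auto simp: lies_above_def char_inner_def \<phi> \<theta> subset_iff)
    show "mtr (\<tau> k) = 0" if "k \<in> K" "k \<notin> L" for k
    proof (rule up.trace_vanishes[OF c5.normal_L LK assms(2) _ _ that])
      show "lies_above G L (rep_character (subgrp G K) d \<tau>) \<phi>" using c5.theta_above by (simp add: \<tau>(2))
      show "\<chi> = rep_character (subgrp G K) d \<tau>" if "\<chi> \<in> Irr (subgrp G K)" "lies_above G L \<chi> \<phi>" for \<chi>
        using c5.phi_fully_ramified c5.theta_Irr c5.theta_above that \<tau>(2) by (auto simp: fully_ramified_def)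
    qed
    show "X <#>\<^bsub>G\<^esub> Y = Y <#>\<^bsub>G\<^esub> X" if "X \<in> r_coset G L ` K" "Y \<in> r_coset G L ` K" for X Y
      using comm_groupE(4)[OF assms(2)] that carA by (auto simp: FactGroup_def set_mult_def)
    show "odd (card (r_coset G L ` K))" using assms(3) carA by (simp add: Coset.order_def)
  qed
  show ?thesis using good_complement by (simp add: \<rho>(2))
qed

end
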